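(* Suppose that $X$ is linearly ordered, $1<p<\infty$, and $\chi\in T$. The semicommutator $[T_\chi,T_{\bar\chi})$ is compact on $H^p(G)$ if and only if $\chi\in X^i$. Consequently, if the operators $[T_\chi,T_{\bar\chi})$ are compact on $H^p(G)$ for all $\chi\in T$, then $G$ is isomorphic to the one-dimensional torus $\mathbb T$.
   Context: $G$ is a nontrivial connected compact abelian group with normalized Haar measure $m$; $X$ is its (discrete) character group, written multiplicatively, with unit character $\mathbf 1$. $T\subset X$ is a fixed subsemigroup (positive cone) with $\mathbf 1\in T$, $T\cap T^{-1}=\{\mathbf 1\}$, $X=T^{-1}T$; it defines an order on $X$ by $\xi\le\chi$ iff $\chi\xi^{-1}\in T$. $X$ is linearly ordered means $T\cup T^{-1}=X$. Fourier transform: $\widehat f(\chi)=\int_G f\overline{\chi}\,dm$. $H^p(G)=\{f\in L^p(G):\widehat f(\chi)=0 \text{ for all }\chi\in X\setminus T\}$ with the $L^p$ norm. $Pol(G)$ and $Pol_T(G)$ are the linear spans of $X$ and of $T$. The Riesz projection $P_T:Pol(G)\to Pol_T(G)$ is $P_T(\sum_{\chi\in M}c_\chi\chi)=\sum_{\chi\in M\cap T}c_\chi\chi$; for linearly ordered $X$ and $1<p<\infty$ it extends to a bounded projection $P_T:L^p(G)\to H^p(G)$ (Bochner–Helson). For $\varphi\in L^\infty(G)$ the Toeplitz operator is $T_\varphi f=P_T(\varphi f)$, $f\in H^p(G)$. The semicommutator is $[T_\varphi,T_\psi):=T_\varphi T_\psi-T_{\varphi\psi}$. $X^i$ is the set of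 characters having an index, i.e. the set of $\chi\in X$ of the form $\chi=\chi_1\chi_2^{-1}$ with $\chi_j\in T$ and both sets $T\setminus\chi_jT$ finite ($j=1,2$). *)

theory Defs
  imports "HOL-Probability.Probability"
begin

section \<open>Compact abelian groups and their characters\<close>

text \<open>The compact abelian group is a type of class \<^class>\<open>topological_ab_group_add\<close> and
  \<^class>\<open>t2_space\<close>, written additively. On a group that is not second countable,
  translation invariance has to be accompanied by regularity; for a finite Borel
  measure on a compact Hausdorff space, inner regularity implies outer regularity.\<close>

definition normalized_haar :: "'a::{topological_ab_group_add, t2_space} measure \<Rightarrow> bool" where
  "normalized_haar m \<longleftrightarrow>
     sets m = sets borel \<and> prob_space m \<and>
     (\<forall>a. distr m borel (\<lambda>x. a + x) = m) \<and>
     (\<forall>A\<in>sets m. emeasure m A = (\<Squnion>K\<in>{K. compact K \<and> K \<subseteq> A}. emeasure m K))"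

definition characters :: "('a::topological_ab_group_add \<Rightarrow> complex) set" where
  "characters = {\<xi>. continuous_on UNIV \<xi> \<and> (\<forall>x. norm (\<xi> x) = 1) \<and>
                     (\<forall>x y. \<xi> (x + y) = \<xi> x * \<xi> y)}"

definition char_mult :: "('a \<Rightarrow> complex) \<Rightarrow> ('a \<Rightarrow> complex) \<Rightarrow> 'a \<Rightarrow> complex" where
  "char_mult \<phi> \<psi> = (\<lambda>x. \<phi> x * \<psi> x)"

text \<open>The complex conjugate of a character is its inverse in the character group.\<close>

definition conj_fun :: "('a \<Rightarrow> complex) \<Rightarrow> 'a \<Rightarrow> complex" where
  "conj_fun \<phi> = (\<lambda>x. cnj (\<phi> x))"

definition positive_cone :: "('a::topological_ab_group_add \<Rightarrow> complex) set \<Rightarrow> bool" where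
  "positive_cone T \<longleftrightarrow>
     T \<subseteq> characters \<and>
     (\<lambda>_. 1) \<in> T \<and>
     (\<forall>\<phi>\<in>T. \<forall>\<psi>\<in>T. char_mult \<phi> \<psi> \<in> T) \<and>
     T \<inter> conj_fun ` T = {\<lambda>_. 1} \<and>
     characters = {char_mult (conj_fun \<phi>) \<psi> | \<phi> \<psi>. \<phi> \<in> T \<and> \<psi> \<in> T}"

definition linearly_ordered_by :: "('a::topological_ab_group_add \<Rightarrow> complex) set \<Rightarrow> bool" where
  "linearly_ordered_by T \<longleftrightarrow> T \<union> conj_fun ` T = characters"

definition indexed_characters ::
    "('a::topological_ab_group_add \<Rightarrow> complex) set \<Rightarrow> ('a \<Rightarrow> complex) set" where
  "indexed_characters T =
     {char_mult \<xi>\<^sub>1 (conj_fun \<xi>\<^sub>2) | \<xi>\<^sub>1 \<xi>\<^sub>2. \<xi>\<^sub>1 \<in> T \<and> \<xi>\<^sub>2 \<in> T \<and>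
        finite (T - char_mult \<xi>\<^sub>1 ` T) \<and> finite (T - char_mult \<xi>\<^sub>2 ` T)}"

section \<open>Lebesgue and Hardy spaces\<close>

text \<open>Elements of \<open>L\<^sup>p\<close> are represented by functions. Operators are maps between
  functions, and equations between elements of \<open>L\<^sup>p\<close> are equations almost everywhere.\<close>

definition Lp_space :: "'a measure \<Rightarrow> real \<Rightarrow> ('a \<Rightarrow> complex) set" where
  "Lp_space m p = {f \<in> borel_measurable m. integrable m (\<lambda>x. norm (f x) powr p)}"

definition Lp_norm :: "'a measure \<Rightarrow> real \<Rightarrow> ('a \<Rightarrow> complex) \<Rightarrow> real" where
  "Lp_norm m p f = (LINT x|m. norm (f x) powr p) powr (1 / p)"

definition fourier :: "'a measure \<Rightarrow> ('a \<Rightarrow> complex) \<Rightarrow> ('a \<Rightarrow> complex) \<Rightarrow> complex" where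
  "fourier m f \<xi> = (LINT x|m. f x * cnj (\<xi> x))"

definition Hp_space ::
    "'a::topological_ab_group_add measure \<Rightarrow> ('a \<Rightarrow> complex) set \<Rightarrow> real \<Rightarrow> ('a \<Rightarrow> complex) set" where
  "Hp_space m T p = {f \<in> Lp_space m p. \<forall>\<xi>\<in>characters - T. fourier m f \<xi> = 0}"

definition linear_ae ::
    "'a measure \<Rightarrow> ('a \<Rightarrow> complex) set \<Rightarrow> (('a \<Rightarrow> complex) \<Rightarrow> 'a \<Rightarrow> complex) \<Rightarrow> bool" where
  "linear_ae m V K \<longleftrightarrow>
     (\<forall>f\<in>V. \<forall>g\<in>V. \<forall>a b. AE x in m. K (\<lambda>y. a * f y + b * g y) x = a * K f x + b * K g x)"

definition compact_operator_Hp ::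
    "'a::topological_ab_group_add measure \<Rightarrow> ('a \<Rightarrow> complex) set \<Rightarrow> real \<Rightarrow>
     (('a \<Rightarrow> complex) \<Rightarrow> 'a \<Rightarrow> complex) \<Rightarrow> bool" where
  "compact_operator_Hp m T p K \<longleftrightarrow>
     K ` Hp_space m T p \<subseteq> Hp_space m T p \<and>
     linear_ae m (Hp_space m T p) K \<and>
     (\<forall>f :: nat \<Rightarrow> 'a \<Rightarrow> complex.
        range f \<subseteq> Hp_space m T p \<and> bounded (range (\<lambda>n. Lp_norm m p (f n))) \<longrightarrow>
        (\<exists>g\<in>Hp_space m T p. \<exists>r. strict_mono r \<and>
           (\<lambda>n. Lp_norm m p (\<lambda>x. K (f (r n)) x - g x)) \<longlonglongrightarrow> 0))"

section \<open>Riesz projection and Toeplitz operators\<close>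

definition trig_poly :: "('a \<Rightarrow> complex) set \<Rightarrow> (('a \<Rightarrow> complex) \<Rightarrow> complex) \<Rightarrow> 'a \<Rightarrow> complex" where
  "trig_poly M c = (\<lambda>x. \<Sum>\<xi>\<in>M. c \<xi> * \<xi> x)"

definition is_riesz_projection ::
    "'a::topological_ab_group_add measure \<Rightarrow> ('a \<Rightarrow> complex) set \<Rightarrow> real \<Rightarrow>
     (('a \<Rightarrow> complex) \<Rightarrow> 'a \<Rightarrow> complex) \<Rightarrow> bool" where
  "is_riesz_projection m T p P \<longleftrightarrow>
     P ` Lp_space m p \<subseteq> Hp_space m T p \<and>
     linear_ae m (Lp_space m p) P \<and>
     (\<exists>C. \<forall>f\<in>Lp_space m p. Lp_norm m p (P f) \<le> C * Lp_norm m p f) \<and>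
     (\<forall>f\<in>Hp_space m T p. AE x in m. P f x = f x) \<and>
     (\<forall>M c. finite M \<and> M \<subseteq> characters \<longrightarrow>
        (AE x in m. P (trig_poly M c) x = trig_poly (M \<inter> T) c x))"

text \<open>The bounded extension is unique up to equality almost everywhere, because the
  trigonometric polynomials are dense in \<open>L\<^sup>p\<close>. It exists, by the theorem of Bochner and
  Helson, if the character group is linearly ordered and \<open>1 < p < \<infinity>\<close>.\<close>

definition riesz_projection ::
    "'a::topological_ab_group_add measure \<Rightarrow> ('a \<Rightarrow> complex) set \<Rightarrow> real \<Rightarrow>
     ('a \<Rightarrow> complex) \<Rightarrow> 'a \<Rightarrow> complex" where
  "riesz_projection m T p = (SOME P. is_riesz_projection m T p P)"

definition toeplitz ::
    "'a::topological_ab_group_add measure \<Rightarrow> ('a \<Rightarrow> complex) set \<Rightarrow> real \<Rightarrow>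
     ('a \<Rightarrow> complex) \<Rightarrow> ('a \<Rightarrow> complex) \<Rightarrow> 'a \<Rightarrow> complex" where
  "toeplitz m T p \<phi> f = riesz_projection m T p (\<lambda>x. \<phi> x * f x)"

definition semicommutator ::
    "'a::topological_ab_group_add measure \<Rightarrow> ('a \<Rightarrow> complex) set \<Rightarrow> real \<Rightarrow>
     ('a \<Rightarrow> complex) \<Rightarrow> ('a \<Rightarrow> complex) \<Rightarrow> ('a \<Rightarrow> complex) \<Rightarrow> 'a \<Rightarrow> complex" where
  "semicommutator m T p \<phi> \<psi> f =
     (\<lambda>x. toeplitz m T p \<phi> (toeplitz m T p \<psi> f) x - toeplitz m T p (\<lambda>y. \<phi> y * \<psi> y) f x)"

section \<open>Isomorphism with the circle group\<close>

definition isomorphic_to_circle :: "'a::topological_ab_group_add itself \<Rightarrow> bool" where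
  "isomorphic_to_circle _ \<longleftrightarrow>
     (\<exists>(h :: 'a \<Rightarrow> complex) k. homeomorphism UNIV (sphere 0 1) h k \<and>
        (\<forall>x y. h (x + y) = h x * h y))"

end

theory Submission
  imports Defs
begin

text \<open>
  For \<open>\<xi> \<in> T\<close> the semicommutator of \<open>\<xi>\<close> and its conjugate is \<open>f \<mapsto> \<xi> P(cnj \<xi> f) - f\<close>. It kills
  every character in \<open>\<xi>T\<close> and sends a character \<open>\<psi> \<in> T - \<xi>T\<close> to \<open>-\<psi>\<close>: it is minus the projection
  onto the span of \<open>T - \<xi>T\<close>. If this set is finite, the operator has finite rank and is compact
  (\<open>compact_if_finite\<close>). If it is infinite, a sequence of its members has no subsequence with
  convergent images, because Fourier coefficients are bounded by the norm
  (\<open>finite_if_compact\<close>). For \<open>\<xi> \<in> T\<close> the finiteness of \<open>T - \<xi>T\<close> says exactly that \<open>\<xi>\<close> has an index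
  (\<open>indexed_iff\<close>).

  In the order given by \<open>T\<close>, the set \<open>T - \<xi>T\<close> consists of the elements of \<open>T\<close> below \<open>\<xi>\<close>. If all these
  sets are finite, then \<open>T\<close> has a least element \<open>\<eta>\<close> other than the unit and consists of the powers of
  \<open>\<eta>\<close> (\<open>cone_generator\<close>). Since characters separate points, \<open>\<eta>\<close> is injective; since the group is
  connected, \<open>\<eta>\<close> maps onto the circle; by compactness it is a homeomorphism
  (\<open>isomorphic_to_circle_if_finite\<close>).

  Two classical theorems carry these arguments.

  The first is that characters separate points (\<open>characters_separate_points\<close>). For a nonzero
  continuous \<open>k\<close> with \<open>k(-x) = cnj (k x)\<close>, the convolution powers of \<open>k * k\<close>, divided by the powers of
  their growth rate, converge uniformly to an idempotent \<open>e\<close> (\<open>eigen_idempotent\<close>): in Fourier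
  terms, the coefficients of \<open>k * k\<close> are nonnegative, and in the normalized powers only the
  largest of them survive. If some translate of \<open>e\<close> is not a multiple of \<open>e\<close>, the same construction
  inside the ideal of \<open>e\<close> gives a proper summand of \<open>e\<close>, and the squared norm drops by at least 1
  (\<open>idempotent_split\<close>). So after finitely many steps all translates of \<open>e\<close> are multiples of \<open>e\<close>, which
  means that \<open>e\<close> is a multiple of a character. Choosing \<open>k\<close> orthogonal to all characters that take
  the value 1 at a given point yields a character that does not.

  The second is the theorem of Bochner and Helson that the Riesz projection is bounded on \<open>L\<^sup>p\<close>
  for \<open>1 < p < \<infinity>\<close> (\<open>riesz_projection_exists\<close>). The key is that the mean value is multiplicative on
  analytic polynomials (\<open>analytic_mult\<close>). Let \<open>f\<close> be a positive trigonometric polynomial and \<open>F\<close> the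
  analytic polynomial with real part \<open>f\<close> and the same mean. For \<open>1 < p \<le> 2\<close> there is a pointwise
  inequality \<open>\<bar>Im w\<bar>\<^sup>p \<le> A (Re w)\<^sup>p - B Re (w\<^sup>p)\<close> on the right half plane with \<open>A, B \<ge> 0\<close>. At \<open>w = F\<close> the
  last term has the mean \<open>-B (mean f)\<^sup>p \<le> 0\<close>, so the imaginary part of \<open>F\<close> is controlled by
  \<open>f\<close> (\<open>riesz_bound_positive\<close>). A general real polynomial is a difference of two positive ones of
  comparable norm. A bound for \<open>p\<close> yields one for \<open>2p\<close> by applying it to the imaginary part of \<open>F\<^sup>2\<close>
  (\<open>riesz_bound_double\<close>), so every \<open>p > 1\<close> is reached. Density of the trigonometric polynomials
  and completeness extend the projection to \<open>L\<^sup>p\<close>.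

  The inequality \<open>(a + b)\<^sup>p \<le> 2\<^sup>p (a\<^sup>p + b\<^sup>p)\<close> serves as triangle inequality throughout: only
  boundedness and convergence matter, not the constants.
\<close>

section \<open>Integration on a compact group\<close>

lemma continuous_on_slices:
  fixes F :: "'a::topological_space \<Rightarrow> 'b::topological_space \<Rightarrow> 'c::topological_space"
  assumes F: "continuous_on UNIV (\<lambda>z. F (fst z) (snd z))"
  shows "continuous_on UNIV (\<lambda>z. F (snd z) (fst z))" "continuous_on UNIV (F y)" "continuous_on UNIV (\<lambda>y. F y x)"
proof -
  have "continuous_on UNIV (\<lambda>x. (\<lambda>z. F (fst z) (snd z)) (y, x))"
    by (rule continuous_on_compose2[OF F]) (auto intro!: continuous_intros)
  then show "continuous_on UNIV (F y)" by simp
  have "continuous_on UNIV (\<lambda>y. (\<lambda>z. F (fst z) (snd z)) (y, x))"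
    by (rule continuous_on_compose2[OF F]) (auto intro!: continuous_intros)
  then show "continuous_on UNIV (\<lambda>y. F y x)" by simp
  have "continuous_on UNIV (\<lambda>u. (\<lambda>z. F (fst z) (snd z)) (snd u, fst u))"
    by (rule continuous_on_compose2[OF F]) (auto intro!: continuous_intros)
  then show "continuous_on UNIV (\<lambda>z. F (snd z) (fst z))" by simp
qed

locale compact_haar =
  fixes m :: "'a::{topological_ab_group_add, t2_space} measure"
  assumes compact_UNIV: "compact (UNIV :: 'a set)"
    and haar: "normalized_haar m"

sublocale compact_haar \<subseteq> prob_space m
  using haar by (simp add: normalized_haar_def)

context compact_haar
begin

lemma sets_m [simp, measurable_cong]: "sets m = sets borel"
  using haar by (simp add: normalized_haar_def)

lemma space_m [simp]: "space m = UNIV"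
  using sets_eq_imp_space_eq[OF sets_m] by simp

lemma prob_UNIV [simp]: "measure m UNIV = 1"
  using prob_space by simp

lemma continuous_measurable:
  fixes f :: "'a \<Rightarrow> 'b::topological_space"
  assumes "continuous_on UNIV f"
  shows "f \<in> borel_measurable m"
  using borel_measurable_continuous_onI[OF assms] by (simp cong: measurable_cong_sets)

lemma continuous_bounded:
  fixes f :: "'a \<Rightarrow> 'b::real_normed_vector"
  assumes "continuous_on UNIV f"
  obtains B where "B > 0" "\<And>x. norm (f x) \<le> B"
proof -
  have "bounded (range f)"
    using compact_continuous_image[OF assms compact_UNIV] compact_imp_bounded by blast
  then show ?thesis
    using that by (auto simp: bounded_pos)
qed

lemma continuous_integrable:
  fixes f :: "'a \<Rightarrow> 'b::{banach, second_countable_topology}"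
  assumes "continuous_on UNIV f"
  shows "integrable m f"
proof -
  obtain B where "\<And>x. norm (f x) \<le> B"
    using continuous_bounded[OF assms] by metis
  then show ?thesis
    using continuous_measurable[OF assms] by (intro integrable_const_bound[of _ B]) auto
qed

lemma integral_translate:
  fixes f :: "'a \<Rightarrow> 'b::{banach, second_countable_topology}"
  assumes "continuous_on UNIV f"
  shows "(\<integral>x. f (a + x) \<partial>m) = (\<integral>x. f x \<partial>m)"
proof -
  have t: "(\<lambda>x. a + x) \<in> measurable m borel"
    by (intro continuous_measurable continuous_intros)
  have d: "distr m borel (\<lambda>x. a + x) = m"
    using haar by (simp add: normalized_haar_def)
  have "(\<integral>x. f x \<partial>m) = (\<integral>x. f x \<partial>(distr m borel (\<lambda>x. a + x)))"
    by (simp add: d)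
  also have "\<dots> = (\<integral>x. f (a + x) \<partial>m)"
    using borel_measurable_continuous_onI[OF assms] by (intro integral_distr[OF t])
  finally show ?thesis by simp
qed

lemma integral_dist_le:
  fixes f g :: "'a \<Rightarrow> 'b::{banach, second_countable_topology}"
  assumes "integrable m f" "integrable m g" "\<And>x. dist (f x) (g x) \<le> e"
  shows "dist (\<integral>x. f x \<partial>m) (\<integral>x. g x \<partial>m) \<le> e"
proof -
  have "norm (\<integral>x. f x - g x \<partial>m) \<le> (\<integral>x. norm (f x - g x) \<partial>m)"
    by (rule integral_norm_bound)
  also have "\<dots> \<le> (\<integral>x. e \<partial>m)"
    using assms by (intro integral_mono) (auto simp: dist_norm)
  also have "\<dots> = e"
    using prob_space by simp
  finally show ?thesis
    using assms by (simp add: dist_norm)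
qed

lemma uniformly_close_slices:
  fixes F :: "'a \<Rightarrow> 'a \<Rightarrow> 'b::metric_space"
  assumes "continuous_on UNIV (\<lambda>z. F (fst z) (snd z))" and "e > 0"
  obtains U where "open U" "y0 \<in> U" "\<And>y x. y \<in> U \<Longrightarrow> dist (F y x) (F y0 x) \<le> e"
proof -
  have "continuous_on (UNIV \<times> UNIV) (\<lambda>z. F (fst z) (snd z))"
    using assms by simp
  then obtain U where "y0 \<in> U" "open U"
    and U: "\<forall>y\<in>U \<inter> UNIV. \<forall>x\<in>UNIV.
      dist ((\<lambda>z. F (fst z) (snd z)) (y, x)) ((\<lambda>z. F (fst z) (snd z)) (y0, x)) \<le> e"
    by (rule continuous_on_prod_compactE[OF _ compact_UNIV UNIV_I \<open>e > 0\<close>])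
  moreover from U have "dist (F y x) (F y0 x) \<le> e" if "y \<in> U" for y x
    using that by simp
  ultimately show ?thesis using that by blast
qed

lemma continuous_on_parameter_integral:
  fixes F :: "'a \<Rightarrow> 'a \<Rightarrow> 'b::{banach, second_countable_topology}"
  assumes F: "continuous_on UNIV (\<lambda>z. F (fst z) (snd z))"
  shows "continuous_on UNIV (\<lambda>y. \<integral>x. F y x \<partial>m)"
proof -
  have int: "integrable m (F y)" for y
    by (rule continuous_integrable[OF continuous_on_slices(2)[OF F]])
  have "\<exists>A. open A \<and> y \<in> A \<and> (\<forall>z\<in>A. dist (\<integral>x. F z x \<partial>m) (\<integral>x. F y x \<partial>m) < e)"
    if "e > 0" for y e
  proof -
    obtain U where U: "open U" "y \<in> U" "\<And>z x. z \<in> U \<Longrightarrow> dist (F z x) (F y x) \<le> e / 2"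
      using uniformly_close_slices[OF F, of "e / 2" y] \<open>e > 0\<close> by (metis half_gt_zero)
    have "dist (\<integral>x. F z x \<partial>m) (\<integral>x. F y x \<partial>m) < e" if "z \<in> U" for z
      using integral_dist_le[OF int int U(3)[OF that]] \<open>e > 0\<close> by linarith
    then show ?thesis using U by blast
  qed
  then have "((\<lambda>z. \<integral>x. F z x \<partial>m) \<longlongrightarrow> (\<integral>x. F y x \<partial>m)) (at y)" for y
    unfolding tendsto_iff eventually_at_topological by (metis)
  then show ?thesis
    by (simp add: continuous_on_def)
qed

text \<open>
  On a group without a countable basis the Borel sets of the square need not all belong to the
  product \<open>\<sigma>\<close>-algebra, so a continuous function of two variables need not be measurable for the
  product measure, and the general Fubini theorem does not apply. It is replaced by
  the approximation of \<open>F\<close>, uniformly in both variables, by a function that depends on the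
  first variable only through a measurable map with finitely many values.
\<close>

lemma Fubini_continuous:
  fixes F :: "'a \<Rightarrow> 'a \<Rightarrow> complex"
  assumes F: "continuous_on UNIV (\<lambda>z. F (fst z) (snd z))"
  shows "(\<integral>y. \<integral>x. F y x \<partial>m \<partial>m) = (\<integral>x. \<integral>y. F y x \<partial>m \<partial>m)"
proof -
  note F' = continuous_on_slices(1)[OF F]
    and c1 = continuous_on_slices(2)[OF F] and c2 = continuous_on_slices(3)[OF F]
  note i1 = continuous_integrable[OF c1] and i2 = continuous_integrable[OF c2]
  have I1: "integrable m (\<lambda>y. \<integral>x. F y x \<partial>m)"
    by (intro continuous_integrable continuous_on_parameter_integral F)
  have I2: "integrable m (\<lambda>x. \<integral>y. F y x \<partial>m)"
    by (intro continuous_integrable continuous_on_parameter_integral[of "\<lambda>x y. F y x"] F')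
  have "dist (\<integral>y. \<integral>x. F y x \<partial>m \<partial>m) (\<integral>x. \<integral>y. F y x \<partial>m \<partial>m) \<le> e" if "e > 0" for e
  proof -
    define d where "d = e / 2"
    have d: "d > 0" using that by (simp add: d_def)
    have "\<forall>y0. \<exists>U. open U \<and> y0 \<in> U \<and> (\<forall>y x. y \<in> U \<longrightarrow> dist (F y x) (F y0 x) \<le> d)"
      using uniformly_close_slices[OF F d] by metis
    then obtain U where U: "\<And>y0. open (U y0)" "\<And>y0. y0 \<in> U y0"
      "\<And>y0 y x. y \<in> U y0 \<Longrightarrow> dist (F y x) (F y0 x) \<le> d"
      by metis
    obtain D where D: "finite D" "UNIV = (\<Union>y\<in>D. U y)"
    proof (rule compactE_image[OF compact_UNIV, of UNIV U])
    qed (use U in auto)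
    obtain ys where ys: "set ys = D" using finite_list[OF D(1)] by blast
    (* s y is the first entry of ys whose neighbourhood contains y *)
    define s where "s y = hd (filter (\<lambda>c. y \<in> U c) ys)" for y
    have s_in: "s y \<in> D \<and> y \<in> U (s y)" for y
    proof -
      have "filter (\<lambda>c. y \<in> U c) ys \<noteq> []"
        using D(2) ys by (auto simp: filter_empty_conv)
      then have "s y \<in> set (filter (\<lambda>c. y \<in> U c) ys)"
        unfolding s_def by (rule hd_in_set)
      then show ?thesis using ys by auto
    qed
    have U_sets [measurable]: "U c \<in> sets m" for c
      using U(1) by simp
    have s_meas: "s -` {c} \<in> sets m" for c
    proof -
      have "{y \<in> space m. hd (filter (\<lambda>c. y \<in> U c) zs) = c} \<in> sets m" for zs
      proof (induction zs)
        case (Cons z zs)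
        have "{y \<in> space m. hd (filter (\<lambda>c. y \<in> U c) (z # zs)) = c}
           = (if z = c then U z else {}) \<union>
             ({y \<in> space m. hd (filter (\<lambda>c. y \<in> U c) zs) = c} - U z)"
          by auto
        also have "\<dots> \<in> sets m"
          using Cons by (intro sets.Un sets.Diff U_sets) (simp_all add: U(1))
        finally show ?case .
      qed auto
      then show ?thesis by (simp add: s_def vimage_def)
    qed
    define w where "w c = measure m (s -` {c})" for c
    have s1: "integrable m (\<lambda>y. g (s y))"
      and s2: "(\<integral>y. g (s y) \<partial>m) = (\<Sum>c\<in>D. w c *\<^sub>R g c)"
      for g :: "'a \<Rightarrow> complex"
    proof -
      have g: "g (s y) = (\<Sum>c\<in>D. indicator (s -` {c}) y *\<^sub>R g c)" for y
      proof -
        have "(\<Sum>c\<in>D. indicator (s -` {c}) y *\<^sub>R g c) = (\<Sum>c\<in>D. if c = s y then g c else 0)"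
          by (intro sum.cong) (auto simp: indicator_def)
        then show ?thesis using D(1) s_in by simp
      qed
      have ind: "integrable m (indicat_real (s -` {c}))" for c
        using s_meas by (intro integrable_real_indicator) (auto simp: emeasure_eq_measure)
      have i: "integrable m (\<lambda>y. indicator (s -` {c}) y *\<^sub>R g c)" for c
        using ind by (rule integrable_scaleR_left)
      have v: "(\<integral>y. indicator (s -` {c}) y *\<^sub>R g c \<partial>m) = w c *\<^sub>R g c" for c
        using ind[of c] by (simp add: w_def)
      show "integrable m (\<lambda>y. g (s y))"
        unfolding g by (intro Bochner_Integration.integrable_sum i)
      show "(\<integral>y. g (s y) \<partial>m) = (\<Sum>c\<in>D. w c *\<^sub>R g c)"
        unfolding g by (simp add: Bochner_Integration.integral_sum i v)
    qed
    have I4: "integrable m (\<lambda>y. \<integral>x. F (s y) x \<partial>m)"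
      by (rule s1)
    have "dist (\<integral>x. F y x \<partial>m) (\<integral>x. F (s y) x \<partial>m) \<le> d" for y
      using U(3) s_in by (intro integral_dist_le[OF i1 i1]) blast
    then have 1: "dist (\<integral>y. \<integral>x. F y x \<partial>m \<partial>m) (\<integral>y. \<integral>x. F (s y) x \<partial>m \<partial>m) \<le> d"
      by (rule integral_dist_le[OF I1 I4])
    have 2: "(\<integral>y. \<integral>x. F (s y) x \<partial>m \<partial>m) = (\<integral>x. \<integral>y. F (s y) x \<partial>m \<partial>m)"
      unfolding s2[of "\<lambda>y. \<integral>x. F y x \<partial>m"] s2[of "\<lambda>y. F y x" for x]
      by (subst Bochner_Integration.integral_sum) (simp_all add: i1)
    have I3: "integrable m (\<lambda>x. \<integral>y. F (s y) x \<partial>m)"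
      unfolding s2[of "\<lambda>y. F y x" for x] by (simp add: i1)
    have 3: "dist (\<integral>x. \<integral>y. F (s y) x \<partial>m \<partial>m) (\<integral>x. \<integral>y. F y x \<partial>m \<partial>m) \<le> d"
    proof (rule integral_dist_le[OF I3 I2])
      fix x
      have i3: "integrable m (\<lambda>y. F (s y) x)" by (rule s1)
      show "dist (\<integral>y. F (s y) x \<partial>m) (\<integral>y. F y x \<partial>m) \<le> d"
        using U(3) s_in by (intro integral_dist_le[OF i3 i2]) (metis dist_commute)
    qed
    show ?thesis
      using 1 3 dist_triangle[of "\<integral>y. \<integral>x. F y x \<partial>m \<partial>m" "\<integral>x. \<integral>y. F y x \<partial>m \<partial>m"
        "\<integral>x. \<integral>y. F (s y) x \<partial>m \<partial>m"] unfolding 2 d_def by linarith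
  qed
  then have "dist (\<integral>y. \<integral>x. F y x \<partial>m \<partial>m) (\<integral>x. \<integral>y. F y x \<partial>m \<partial>m) \<le> 0"
    by (rule field_le_epsilon) simp
  then show ?thesis by simp
qed

end

section \<open>Convolution of continuous functions\<close>

text \<open>
  For the mean of \<open>(t f - g)\<^sup>2\<close> as a polynomial in \<open>t\<close>, this is the Cauchy-Schwarz inequality.
\<close>

lemma discriminant_le:
  fixes A B D :: real
  assumes "\<And>t. A * t\<^sup>2 - 2 * B * t + D \<ge> 0" and "A \<ge> 0"
  shows "B\<^sup>2 \<le> A * D"
proof (cases "A = 0")
  case True
  have "B = 0"
  proof (rule ccontr)
    assume "B \<noteq> 0"
    then show False
      using assms(1)[of "(D + 1) / (2 * B)"] True by simp
  qed
  then show ?thesis using True by simp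
next
  case False
  have "A * (B / A)\<^sup>2 - 2 * B * (B / A) + D = D - B\<^sup>2 / A"
    using False by (simp add: power2_eq_square field_simps)
  then have "B\<^sup>2 / A \<le> D"
    using assms(1)[of "B / A"] by simp
  then show ?thesis
    using False assms(2) by (simp add: field_simps)
qed

lemma continuous_on_apply:
  assumes "continuous_on UNIV u" "continuous_on S f"
  shows "continuous_on S (\<lambda>x. u (f x))"
  using continuous_on_compose2[OF assms] by simp

context compact_haar
begin

definition conv :: "('a \<Rightarrow> complex) \<Rightarrow> ('a \<Rightarrow> complex) \<Rightarrow> 'a \<Rightarrow> complex" where
  "conv u v = (\<lambda>x. \<integral>y. u (x - y) * v y \<partial>m)"

text \<open>
  The involution for which \<open>conv u (adj v) 0\<close> is the inner product of \<open>u\<close> and \<open>v\<close>.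
\<close>

definition adj :: "('a \<Rightarrow> complex) \<Rightarrow> 'a \<Rightarrow> complex" where
  "adj u = (\<lambda>x. cnj (u (- x)))"

definition sqnorm :: "('a \<Rightarrow> complex) \<Rightarrow> real" where
  "sqnorm u = (\<integral>x. (cmod (u x))\<^sup>2 \<partial>m)"

abbreviation cont :: "('a \<Rightarrow> complex) \<Rightarrow> bool" where
  "cont u \<equiv> continuous_on UNIV u"

lemma conv_integrand_continuous:
  assumes "cont u" "cont v"
  shows "continuous_on UNIV (\<lambda>y. u (x - y) * v y)"
  by (intro continuous_on_mult continuous_on_apply[OF assms(1)] assms continuous_on_diff
      continuous_on_const continuous_on_id)

lemmas conv_integrable = continuous_integrable[OF conv_integrand_continuous]

lemma continuous_on_kernel:
  assumes "cont u"
  shows "continuous_on UNIV (\<lambda>z. u (fst z - snd z))"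
proof -
  have "continuous_on UNIV (\<lambda>z :: 'a \<times> 'a. fst z - snd z)"
    by (intro continuous_intros)
  from continuous_on_apply[OF assms this] show ?thesis .
qed

lemma conv_kernel_continuous:
  assumes "cont u" "cont v"
  shows "continuous_on UNIV (\<lambda>z. u (fst z - snd z) * v (snd z))"
  by (intro continuous_on_mult continuous_on_kernel[OF assms(1)] continuous_on_apply[OF assms(2)]
      continuous_intros)

lemma cont_conv:
  assumes "cont u" "cont v"
  shows "cont (conv u v)"
  unfolding conv_def
  by (rule continuous_on_parameter_integral[OF conv_kernel_continuous[OF assms]])

lemma cont_adj: "cont u \<Longrightarrow> cont (adj u)"
  unfolding adj_def
  by (rule continuous_on_cnj, erule continuous_on_apply) (intro continuous_intros)

text \<open>
  Reflection invariance follows from translation invariance: averaging \<open>f (x - y)\<close> over both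
  variables gives the mean of \<open>f\<close> or of its reflection, according to the order of integration.
\<close>

lemma integral_reflect:
  fixes f :: "'a \<Rightarrow> complex"
  assumes "cont f"
  shows "(\<integral>x. f (- x) \<partial>m) = (\<integral>x. f x \<partial>m)"
proof -
  have c: "continuous_on UNIV (\<lambda>y. f (x - y))" for x
    by (intro continuous_on_apply[OF assms] continuous_on_diff continuous_on_const continuous_on_id)
  have "(\<integral>x. f (- x) \<partial>m) = (\<integral>x. \<integral>y. f (- y) \<partial>m \<partial>m)"
    by simp
  also have "\<dots> = (\<integral>x. \<integral>y. f (x - y) \<partial>m \<partial>m)"
    using integral_translate[OF c, of x x for x] by simp
  also have "\<dots> = (\<integral>y. \<integral>x. f (x - y) \<partial>m \<partial>m)"
    by (rule Fubini_continuous[OF continuous_on_kernel[OF assms]])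
  also have "\<dots> = (\<integral>y. \<integral>x. f x \<partial>m \<partial>m)"
    using integral_translate[OF assms, of "- y" for y] by simp
  finally show ?thesis by simp
qed

lemma integral_reflect_translate:
  fixes f :: "'a \<Rightarrow> complex"
  assumes "cont f"
  shows "(\<integral>y. f (x - y) \<partial>m) = (\<integral>y. f y \<partial>m)"
proof -
  have "(\<integral>y. f (x - y) \<partial>m) = (\<integral>y. f (x + y) \<partial>m)"
    using integral_reflect[of "\<lambda>y. f (x + y)"] continuous_on_apply[OF assms, of UNIV "\<lambda>y. x + y"]
    by (simp add: continuous_on_add)
  then show ?thesis using integral_translate[OF assms] by simp
qed

lemma conv_commute:
  assumes "cont u" "cont v"
  shows "conv u v = conv v u"
proof
  fix x
  have "(\<integral>y. u (x - y) * v y \<partial>m) = (\<integral>y. u (x - (x - y)) * v (x - y) \<partial>m)"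
    by (rule integral_reflect_translate[symmetric, OF conv_integrand_continuous[OF assms]])
  then show "conv u v x = conv v u x"
    by (simp add: conv_def mult.commute)
qed

lemma conv_assoc:
  assumes "cont u" "cont v" "cont w"
  shows "conv (conv u v) w = conv u (conv v w)"
proof
  fix x
  have "conv u (conv v w) x = (\<integral>a. \<integral>b. u (x - a) * (v (a - b) * w b) \<partial>m \<partial>m)"
    by (simp add: conv_def)
  also have "\<dots> = (\<integral>b. \<integral>a. u (x - a) * (v (a - b) * w b) \<partial>m \<partial>m)"
  proof (rule Fubini_continuous)
    have "continuous_on UNIV (\<lambda>z :: 'a \<times> 'a. u (x - fst z))" "continuous_on UNIV (\<lambda>z :: 'a \<times> 'a. w (snd z))"
      by (intro continuous_on_apply[OF assms(1)] continuous_on_apply[OF assms(3)] continuous_intros)+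
    then show "continuous_on UNIV (\<lambda>z. u (x - fst z) * (v (fst z - snd z) * w (snd z)))"
      by (intro continuous_on_mult continuous_on_kernel[OF assms(2)])
  qed
  also have "\<dots> = (\<integral>b. conv u v (x - b) * w b \<partial>m)"
  proof (rule Bochner_Integration.integral_cong[OF refl])
    fix b
    have "(\<integral>a. u (x - a) * (v (a - b) * w b) \<partial>m) = (\<integral>a. (u (x - a) * v (a - b)) * w b \<partial>m)"
      by (simp add: mult.assoc)
    also have "\<dots> = (\<integral>a. u (x - a) * v (a - b) \<partial>m) * w b"
      by simp
    also have "(\<integral>a. u (x - a) * v (a - b) \<partial>m) = (\<integral>a. u (x - (b + a)) * v (b + a - b) \<partial>m)"
      by (rule integral_translate[symmetric], intro continuous_on_mult continuous_on_apply[OF assms(1)]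
        continuous_on_apply[OF assms(2)] continuous_on_diff continuous_on_id continuous_on_const)
    also have "\<dots> = conv u v (x - b)"
      by (simp add: conv_def diff_diff_eq)
    finally show "(\<integral>a. u (x - a) * (v (a - b) * w b) \<partial>m) = conv u v (x - b) * w b" .
  qed
  finally show "conv (conv u v) w x = conv u (conv v w) x"
    by (simp add: conv_def)
qed

lemma conv_add_left:
  assumes "cont u" "cont v" "cont w"
  shows "conv (\<lambda>x. u x + v x) w = (\<lambda>x. conv u w x + conv v w x)"
  unfolding conv_def using conv_integrable[OF assms(1,3)] conv_integrable[OF assms(2,3)]
  by (simp add: distrib_right)

lemma conv_scale_left: "conv (\<lambda>x. c * u x) v = (\<lambda>x. c * conv u v x)"
  unfolding conv_def by (simp add: mult.assoc)

lemma conv_scale_right: "conv u (\<lambda>x. c * v x) = (\<lambda>x. c * conv u v x)"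
  unfolding conv_def by (simp add: mult.left_commute)

lemma conv_add_right:
  assumes "cont u" "cont v" "cont w"
  shows "conv w (\<lambda>x. u x + v x) = (\<lambda>x. conv w u x + conv w v x)"
  unfolding conv_def using conv_integrable[OF assms(3,1)] conv_integrable[OF assms(3,2)]
  by (simp add: distrib_left)

lemma conv_diff_left:
  assumes "cont u" "cont v" "cont w"
  shows "conv (\<lambda>x. u x - v x) w = (\<lambda>x. conv u w x - conv v w x)"
  unfolding conv_def using conv_integrable[OF assms(1,3)] conv_integrable[OF assms(2,3)]
  by (simp add: left_diff_distrib)

lemma conv_diff_right:
  assumes "cont u" "cont v" "cont w"
  shows "conv w (\<lambda>x. u x - v x) = (\<lambda>x. conv w u x - conv w v x)"
  unfolding conv_def using conv_integrable[OF assms(3,1)] conv_integrable[OF assms(3,2)]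
  by (simp add: right_diff_distrib)

lemma conv_shift_left: "conv (\<lambda>x. u (x + a)) v = (\<lambda>x. conv u v (x + a))"
  unfolding conv_def by (simp add: algebra_simps)

lemma adj_conv:
  assumes "cont u" "cont v"
  shows "adj (conv u v) = conv (adj u) (adj v)"
proof
  fix x
  have "adj (conv u v) x = (\<integral>y. cnj (u (- x - y)) * cnj (v y) \<partial>m)"
    by (simp add: adj_def conv_def flip: integral_cnj complex_cnj_mult)
  also have "\<dots> = (\<integral>y. cnj (u (- x - (- y))) * cnj (v (- y)) \<partial>m)"
    by (rule integral_reflect[symmetric], intro continuous_on_mult continuous_on_cnj
      continuous_on_apply[OF assms(1)] continuous_on_diff continuous_on_const continuous_on_id assms)
  finally show "adj (conv u v) x = conv (adj u) (adj v) x"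
    by (simp add: adj_def conv_def)
qed

text \<open>
  Together with \<open>adj k = k\<close> this turns values of convolution powers at 0 into squared norms,
  which is how positivity enters below.
\<close>

lemma conv_adj_self_0: "cont u \<Longrightarrow> conv u (adj u) 0 = of_real (sqnorm u)"
proof -
  assume u: "cont u"
  have "conv u (adj u) 0 = (\<integral>y. u (- y) * cnj (u (- y)) \<partial>m)"
    by (simp add: conv_def adj_def)
  also have "\<dots> = (\<integral>y. u y * cnj (u y) \<partial>m)"
    using integral_reflect[of "\<lambda>y. u y * cnj (u y)"] u by (simp add: continuous_on_mult continuous_on_cnj)
  also have "\<dots> = (\<integral>y. of_real ((cmod (u y))\<^sup>2) \<partial>m)"
    by (simp only: complex_norm_square)
  also have "\<dots> = of_real (sqnorm u)"
    unfolding sqnorm_def by (rule integral_complex_of_real)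
  finally show ?thesis .
qed

lemma sqnorm_nonneg: "sqnorm u \<ge> 0"
  by (simp add: sqnorm_def)

lemma norm_conv_le:
  assumes "cont u" "cont v"
  shows "cmod (conv u v x) \<le> (\<integral>y. cmod (u (x - y)) * cmod (v y) \<partial>m)"
  using integral_norm_bound[of m "\<lambda>y. u (x - y) * v y"] by (simp add: conv_def norm_mult)

text \<open>
  The right-hand side does not depend on \<open>x\<close>: convergence in the mean becomes uniform
  convergence after a convolution.
\<close>

lemma Cauchy_Schwarz_conv:
  assumes u: "cont u" and v: "cont v"
  shows "(cmod (conv u v x))\<^sup>2 \<le> sqnorm u * sqnorm v"
proof -
  define f g where "f y = cmod (u (x - y))" and "g y = cmod (v y)" for y
  have f: "continuous_on UNIV f" and g: "continuous_on UNIV g"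
    unfolding f_def g_def
    by (intro continuous_on_norm continuous_on_apply[OF u] continuous_on_diff continuous_on_const
        continuous_on_id v)+
  have i: "integrable m (\<lambda>y. (f y)\<^sup>2)" "integrable m (\<lambda>y. f y * g y)" "integrable m (\<lambda>y. (g y)\<^sup>2)"
    by (intro continuous_integrable continuous_on_mult continuous_on_power f g)+
  have "(\<integral>y. (f y)\<^sup>2 \<partial>m) = sqnorm u"
  proof -
    have "complex_of_real (\<integral>y. (f y)\<^sup>2 \<partial>m) = (\<integral>y. of_real ((f y)\<^sup>2) \<partial>m)"
      by (rule integral_complex_of_real[symmetric])
    also have "\<dots> = (\<integral>y. of_real ((cmod (u y))\<^sup>2) \<partial>m)"
      unfolding f_def by (rule integral_reflect_translate[where f = "\<lambda>y. of_real ((cmod (u y))\<^sup>2)"])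
        (intro continuous_on_of_real continuous_on_power continuous_on_norm u)
    also have "\<dots> = of_real (sqnorm u)"
      unfolding sqnorm_def by (rule integral_complex_of_real)
    finally show ?thesis by (simp only: of_real_eq_iff)
  qed
  moreover have "(\<integral>y. (g y)\<^sup>2 \<partial>m) = sqnorm v"
    by (simp add: g_def sqnorm_def)
  moreover have "(\<integral>y. (f y)\<^sup>2 \<partial>m) * t\<^sup>2 - 2 * (\<integral>y. f y * g y \<partial>m) * t + (\<integral>y. (g y)\<^sup>2 \<partial>m) \<ge> 0" for t
  proof -
    have "(\<integral>y. (f y)\<^sup>2 \<partial>m) * t\<^sup>2 - 2 * (\<integral>y. f y * g y \<partial>m) * t + (\<integral>y. (g y)\<^sup>2 \<partial>m)
        = (\<integral>y. (f y)\<^sup>2 * t\<^sup>2 - 2 * t * (f y * g y) + (g y)\<^sup>2 \<partial>m)"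
      using i by simp
    also have "(\<lambda>y. (f y)\<^sup>2 * t\<^sup>2 - 2 * t * (f y * g y) + (g y)\<^sup>2) = (\<lambda>y. (f y * t - g y)\<^sup>2)"
      by (auto simp: power2_eq_square algebra_simps)
    finally show ?thesis by simp
  qed
  ultimately have "(\<integral>y. f y * g y \<partial>m)\<^sup>2 \<le> sqnorm u * sqnorm v"
    using discriminant_le[of "sqnorm u" "\<integral>y. f y * g y \<partial>m" "sqnorm v"] sqnorm_nonneg by simp
  moreover have "(cmod (conv u v x))\<^sup>2 \<le> (\<integral>y. f y * g y \<partial>m)\<^sup>2"
    using norm_conv_le[OF u v, of x] by (intro power_mono) (simp_all add: f_def g_def)
  ultimately show ?thesis by linarith
qed

text \<open>
  Finitely many translates of a nonempty open set cover the group, and all have the same measure.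
\<close>

lemma measure_open_pos:
  assumes "open U" "U \<noteq> {}"
  shows "measure m U > 0"
proof (rule ccontr)
  assume "\<not> measure m U > 0"
  then have 0: "measure m U = 0"
    by (simp add: zero_less_measure_iff)
  obtain x0 where x0: "x0 \<in> U" using assms by blast
  have op: "open ((\<lambda>x. a + x) -` U)" for a
    using assms(1) by (intro open_vimage continuous_intros)
  have "UNIV \<subseteq> (\<Union>a\<in>UNIV. (\<lambda>x. a + x) -` U)"
  proof
    fix x :: 'a
    have "(x0 - x) + x \<in> U" using x0 by simp
    then show "x \<in> (\<Union>a\<in>UNIV. (\<lambda>x. a + x) -` U)" by blast
  qed
  then obtain D where D: "finite D" "UNIV \<subseteq> (\<Union>a\<in>D. (\<lambda>x. a + x) -` U)"
    by (rule compactE_image[OF compact_UNIV, of UNIV "\<lambda>a. (\<lambda>x. a + x) -` U", rotated]) (use op in auto)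
  have meas: "measure m ((\<lambda>x. a + x) -` U) = 0" for a
  proof -
    have t: "(\<lambda>x. a + x) \<in> measurable m borel"
      by (intro continuous_measurable continuous_intros)
    have "distr m borel (\<lambda>x. a + x) = m"
      using haar by (simp add: normalized_haar_def)
    then have "measure m U = measure (distr m borel (\<lambda>x. a + x)) U" by simp
    also have "\<dots> = measure m ((\<lambda>x. a + x) -` U)"
      using measure_distr[OF t, of U] assms(1) by simp
    finally show ?thesis using 0 by simp
  qed
  have "1 = measure m (\<Union>a\<in>D. (\<lambda>x. a + x) -` U)"
    using D(2) prob_space by (simp add: top.extremum_unique)
  also have "\<dots> \<le> (\<Sum>a\<in>D. measure m ((\<lambda>x. a + x) -` U))"
    using D(1) op by (intro finite_measure_subadditive_finite) auto
  also have "\<dots> = 0" using meas by simp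
  finally show False by simp
qed

lemma sqnorm_eq_0D:
  assumes u: "cont u" and "sqnorm u = 0"
  shows "u = (\<lambda>_. 0)"
proof -
  have c: "continuous_on UNIV (\<lambda>x. (cmod (u x))\<^sup>2)"
    by (intro continuous_on_power continuous_on_norm u)
  have "AE x in m. (cmod (u x))\<^sup>2 = 0"
    using integral_nonneg_eq_0_iff_AE[OF continuous_integrable[OF c]] assms(2)
    by (simp add: sqnorm_def)
  then have "AE x in m. x \<notin> {x. u x \<noteq> 0}" by simp
  moreover have op: "open {x. u x \<noteq> 0}"
    using u by (intro open_Collect_neq) auto
  ultimately have "measure m {x. u x \<noteq> 0} = 0"
    by (subst prob_eq_0) auto
  then have "{x. u x \<noteq> 0} = {}"
    using measure_open_pos[OF op] by fastforce
  then show ?thesis by auto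
qed

end

section \<open>Characters separate points\<close>

context compact_haar
begin

text \<open>
  The exponent is shifted: \<open>conv_power k n\<close> has \<open>n + 1\<close> factors, since the convolution of continuous
  functions has no unit in general.
\<close>

primrec conv_power :: "('a \<Rightarrow> complex) \<Rightarrow> nat \<Rightarrow> 'a \<Rightarrow> complex" where
  "conv_power k 0 = k"
| "conv_power k (Suc n) = conv k (conv_power k n)"

lemma cont_conv_power: "cont k \<Longrightarrow> cont (conv_power k n)"
  by (induction n) (auto intro: cont_conv)

lemma conv_conv_power:
  assumes "cont k"
  shows "conv (conv_power k i) (conv_power k j) = conv_power k (Suc (i + j))"
  using assms by (induction i) (auto simp: conv_assoc cont_conv_power)

lemma adj_conv_power:
  assumes "cont k" "adj k = k"
  shows "adj (conv_power k n) = conv_power k n"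
  using assms by (induction n) (auto simp: adj_conv cont_conv_power)

lemma conv_tendsto:
  assumes g: "\<And>n. cont (g n)" and w: "cont w" and u: "uniform_limit UNIV g e sequentially"
  shows "(\<lambda>n. conv w (g n) x) \<longlonglongrightarrow> conv w e x"
proof -
  have e: "cont e"
    by (rule uniform_limit_theorem[OF _ u]) (auto simp: g)
  obtain B where B: "B > 0" "\<And>x. cmod (w x) \<le> B"
    using continuous_bounded[OF w] by blast
  show ?thesis
  proof (rule metric_LIMSEQ_I)
    fix r :: real assume "r > 0"
    define d where "d = r / (2 * B)"
    have "d > 0" using B \<open>r > 0\<close> by (simp add: d_def)
    then obtain N where N: "\<And>n x. n \<ge> N \<Longrightarrow> dist (g n x) (e x) < d"
      using u unfolding uniform_limit_sequentially_iff by blast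
    have "dist (conv w (g n) x) (conv w e x) < r" if "n \<ge> N" for n
    proof -
      have "dist (w (x - y) * g n y) (w (x - y) * e y) \<le> B * d" for y
      proof -
        have "dist (w (x - y) * g n y) (w (x - y) * e y) = cmod (w (x - y)) * dist (g n y) (e y)"
          by (simp add: dist_norm norm_mult flip: right_diff_distrib)
        also have "\<dots> \<le> B * d"
          using B N[OF that, of y] by (intro mult_mono) auto
        finally show ?thesis .
      qed
      then have "dist (conv w (g n) x) (conv w e x) \<le> B * d"
        unfolding conv_def by (intro integral_dist_le conv_integrable w g e)
      also have "\<dots> < r" using B \<open>r > 0\<close> by (simp add: d_def)
      finally show ?thesis .
    qed
    then show "\<exists>N. \<forall>n\<ge>N. dist (conv w (g n) x) (conv w e x) < r" by blast
  qed
qed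

text \<open>
  If \<open>c n\<close> denotes the squared norm of the convolution power \<open>k\<^sup>n\<^sup>+\<^sup>1\<close>, then the power \<open>k\<^sup>2\<^sup>n\<^sup>+\<^sup>2\<close> has the
  value \<open>c n\<close> at 0, and this is its greatest absolute value. The sequence \<open>c\<close> is logarithmically
  convex and submultiplicative; so the ratios increase to a limit \<open>l\<close>, and the normalized
  sequence \<open>b n = c n / l\<^sup>n\<^sup>+\<^sup>1\<close> decreases. The distances between normalized powers are expressed by \<open>b\<close>,
  so they form a Cauchy sequence. The limit is not zero because \<open>b\<close> is bounded below by 1.

  In Fourier terms, \<open>l\<close> is the greatest squared coefficient of \<open>k\<close>, and the limit \<open>e\<close> is the sum of
  the characters at which it is attained.
\<close>

lemma eigen_idempotent:
  assumes k: "cont k" and herm: "adj k = k" and nz: "k \<noteq> (\<lambda>_. 0)"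
  obtains l :: real and e where "l > 0" "cont e" "adj e = e" "conv e e = e" "e \<noteq> (\<lambda>_. 0)"
    "conv (conv k k) e = (\<lambda>x. of_real l * e x)"
proof -
  note ck = cont_conv_power[OF k] and hk = adj_conv_power[OF k herm]
    and kk = conv_conv_power[OF k]
  define c where "c n = sqnorm (conv_power k n)" for n
  have c_nonneg: "c n \<ge> 0" for n by (simp add: c_def sqnorm_nonneg)
  have k0: "conv_power k (Suc (2 * n)) 0 = of_real (c n)" for n
    using conv_adj_self_0[OF ck, of n] by (simp add: hk kk c_def mult_2 del: conv_power.simps)
  have bd: "cmod (conv_power k (Suc (2 * n)) x) \<le> c n" for n x
  proof -
    have "(cmod (conv (conv_power k n) (conv_power k n) x))\<^sup>2 \<le> c n * c n"
      unfolding c_def by (rule Cauchy_Schwarz_conv[OF ck ck])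
    then have "(cmod (conv_power k (Suc (2 * n)) x))\<^sup>2 \<le> (c n)\<^sup>2"
      by (simp only: kk mult_2 power2_eq_square)
    then show ?thesis
      using c_nonneg by (rule power2_le_imp_le)
  qed
  (* If one power vanished, so would all later ones; but a nonzero power has a nonzero square. *)
  have c_pos: "c n > 0" for n
  proof -
    have pos: "c j > 0" if "conv_power k j \<noteq> (\<lambda>_. 0)" for j
      using that sqnorm_eq_0D[OF ck] c_nonneg[of j] by (metis c_def less_eq_real_def)
    have ex: "\<exists>j\<ge>n. conv_power k j \<noteq> (\<lambda>_. 0)" for n
    proof (induction n)
      case 0
      then show ?case using nz by (intro exI[of _ 0]) simp
    next
      case (Suc n)
      then obtain j where "j \<ge> n" "conv_power k j \<noteq> (\<lambda>_. 0)" by blast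
      then have "conv_power k (Suc (2 * j)) 0 \<noteq> 0" "Suc (2 * j) \<ge> Suc n"
        using pos[of j] k0[of j] by (auto simp del: conv_power.simps)
      then show ?case by (metis (no_types, lifting))
    qed
    have "conv_power k n \<noteq> (\<lambda>_. 0)"
    proof
      assume 0: "conv_power k n = (\<lambda>_. 0)"
      have "conv_power k (n + i) = (\<lambda>_. 0)" for i
        by (induction i) (simp_all add: 0 conv_def)
      then show False using ex[of n] by (metis le_Suc_ex)
    qed
    then show ?thesis by (rule pos)
  qed
  have logconvex: "(c (Suc n))\<^sup>2 \<le> c n * c (Suc (Suc n))" for n
  proof -
    have "conv (conv_power k n) (conv_power k (Suc (Suc n))) 0 = conv_power k (Suc (2 * Suc n)) 0"
      unfolding kk by (simp add: mult_2)
    then show ?thesis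
      using Cauchy_Schwarz_conv[OF ck ck, of n "Suc (Suc n)" 0] c_nonneg[of "Suc n"]
      unfolding k0 c_def by simp
  qed
  have submult: "c (Suc (i + j)) \<le> c i * c j" for i j
  proof -
    let ?u = "conv_power k (Suc (2 * i))" and ?v = "conv_power k (Suc (2 * j))"
    have "conv ?u ?v = conv_power k (Suc (2 * Suc (i + j)))"
      unfolding kk by (simp add: algebra_simps)
    then have "c (Suc (i + j)) = cmod (conv ?u ?v 0)"
      using k0[of "Suc (i + j)"] c_nonneg[of "Suc (i + j)"] by simp
    also have "\<dots> \<le> (\<integral>y. cmod (?u (0 - y)) * cmod (?v y) \<partial>m)"
      by (rule norm_conv_le[OF ck ck])
    also have "\<dots> \<le> (\<integral>y. c i * c j \<partial>m)"
    proof (rule integral_mono)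
      show "integrable m (\<lambda>y. cmod (?u (0 - y)) * cmod (?v y))"
        unfolding norm_mult[symmetric] by (rule integrable_norm[OF conv_integrable[OF ck ck]])
      show "cmod (?u (0 - y)) * cmod (?v y) \<le> c i * c j" for y
        using bd c_nonneg by (intro mult_mono) auto
    qed simp
    finally show ?thesis by simp
  qed
  define r where "r n = c (Suc n) / c n" for n
  have "incseq r"
  proof (rule incseq_SucI)
    fix n show "r n \<le> r (Suc n)"
      using logconvex[of n] c_pos[of n] c_pos[of "Suc n"]
      by (simp add: r_def field_simps power2_eq_square)
  qed
  moreover have "r n \<le> c 0" for n
    using submult[of n 0] c_pos[of n] by (simp add: r_def field_simps)
  ultimately obtain l where l: "r \<longlonglongrightarrow> l" "\<And>n. r n \<le> l"
    using incseq_convergent[of r "c 0"] by blast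
  have "l > 0"
    using l(2)[of 0] divide_pos_pos[OF c_pos[of "Suc 0"] c_pos[of 0]] unfolding r_def by linarith
  define b where "b n = c n / l ^ Suc n" for n
  have b_pos: "b n > 0" for n using c_pos \<open>l > 0\<close> by (simp add: b_def)
  have b_Suc: "b (Suc n) = b n * (r n / l)" for n
    using c_pos[of n] \<open>l > 0\<close> by (simp add: b_def r_def field_simps)
  have "decseq b"
  proof (rule decseq_SucI)
    fix n show "b (Suc n) \<le> b n"
      using l(2)[of n] b_pos[of n] \<open>l > 0\<close> unfolding b_Suc
      by (intro mult_left_le) (auto simp: divide_le_eq)
  qed
  have b_submult: "b (Suc (i + j)) \<le> b i * b j" for i j
  proof -
    have "b (Suc (i + j)) = c (Suc (i + j)) / (l ^ Suc i * l ^ Suc j)"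
      by (simp add: b_def power_add)
    also have "\<dots> \<le> c i * c j / (l ^ Suc i * l ^ Suc j)"
      using submult[of i j] \<open>l > 0\<close> by (intro divide_right_mono) simp_all
    finally show ?thesis by (simp add: b_def)
  qed
  (* By submultiplicativity b (i + Suc n) / b i is at most b n, while for i tending to
     infinity this quotient tends to 1, since consecutive quotients do. *)
  have b_ge_1: "b n \<ge> 1" for n
  proof (rule ccontr)
    assume "\<not> b n \<ge> 1"
    have rl: "(\<lambda>i. r i / l) \<longlonglongrightarrow> 1"
      using tendsto_divide[OF l(1) tendsto_const, of l] \<open>l > 0\<close> by simp
    have "(\<lambda>i. b (i + j) / b i) \<longlonglongrightarrow> 1" for j
    proof (induction j)
      case 0
      then show ?case using b_pos by (simp add: less_imp_neq[symmetric])
    next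
      case (Suc j)
      have "(\<lambda>i. b (i + j) / b i * (r (i + j) / l)) \<longlonglongrightarrow> 1 * 1"
        by (intro tendsto_mult Suc LIMSEQ_ignore_initial_segment[OF rl])
      then show ?case by (simp add: b_Suc mult_ac)
    qed
    moreover have "b (i + Suc n) / b i \<le> b n" for i
      using b_submult[of i n] b_pos[of i] by (simp add: divide_le_eq mult.commute)
    ultimately have "1 \<le> b n"
      using LIMSEQ_le_const2[of "\<lambda>i. b (i + Suc n) / b i" 1 "b n"] by blast
    then show False using \<open>\<not> b n \<ge> 1\<close> by simp
  qed
  obtain \<beta> where \<beta>: "b \<longlonglongrightarrow> \<beta>"
    using decseq_convergent[OF \<open>decseq b\<close>, of 1] b_ge_1 by blast
  have "\<beta> \<ge> 1"
    using LIMSEQ_le_const[OF \<beta>] b_ge_1 by blast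
  define g where "g n = (\<lambda>x. of_real (1 / l ^ Suc n) * conv_power k (Suc (2 * n)) x)" for n
  have cg: "cont (g n)" for n
    unfolding g_def by (intro continuous_on_mult continuous_on_const ck)
  have hg: "adj (g n) = g n" for n
    using fun_cong[OF hk[of "Suc (2 * n)"]] by (simp add: g_def adj_def del: conv_power.simps)
  have g0: "g n 0 = of_real (b n)" for n
    by (simp add: g_def b_def k0 del: conv_power.simps)
  have gg0: "conv (g i) (g j) 0 = of_real (b (Suc (i + j)))" for i j
  proof -
    have "Suc (Suc (2 * i) + Suc (2 * j)) = Suc (2 * Suc (i + j))" by simp
    then show ?thesis
      unfolding g_def conv_scale_left conv_scale_right kk using k0[of "Suc (i + j)"]
      by (simp add: b_def power_add del: conv_power.simps)
  qed
  have kg: "conv (conv k k) (g n) = (\<lambda>x. of_real l * g (Suc n) x)" for n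
  proof -
    have "conv (conv k k) (conv_power k (Suc (2 * n))) = conv_power k (Suc (2 * Suc n))"
      using kk[of 1 "Suc (2 * n)"] by simp
    then show ?thesis
      unfolding g_def conv_scale_right using \<open>l > 0\<close> by (simp del: conv_power.simps)
  qed
  have sq: "sqnorm (\<lambda>x. g i x - g j x) = b (Suc (2 * i)) - 2 * b (Suc (i + j)) + b (Suc (2 * j))" for i j
  proof -
    have cd: "cont (\<lambda>x. g i x - g j x)" by (intro continuous_on_diff cg)
    have "adj (\<lambda>x. g i x - g j x) = (\<lambda>x. g i x - g j x)"
      using fun_cong[OF hg[of i]] fun_cong[OF hg[of j]] by (simp add: adj_def)
    then have "of_real (sqnorm (\<lambda>x. g i x - g j x)) = conv (\<lambda>x. g i x - g j x) (\<lambda>x. g i x - g j x) 0"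
      using conv_adj_self_0[OF cd] by simp
    also have "\<dots> = conv (g i) (g i) 0 - conv (g i) (g j) 0 - (conv (g j) (g i) 0 - conv (g j) (g j) 0)"
      by (simp only: conv_diff_left[OF cg cg cd] conv_diff_right[OF cg cg cg])
    also have "\<dots> = complex_of_real (b (Suc (2 * i)) - 2 * b (Suc (i + j)) + b (Suc (2 * j)))"
      unfolding gg0 mult_2[of i] mult_2[of j] add.commute[of j i] by simp
    finally show ?thesis by (simp only: of_real_eq_iff)
  qed
  (* The identity sq gives the Cauchy property in the mean; one more convolution with
     k * k turns it into uniform convergence. *)
  have "uniformly_Cauchy_on UNIV (\<lambda>n. g (Suc n))"
    unfolding uniformly_Cauchy_on_def
  proof (intro allI impI)
    fix \<epsilon> :: real assume "\<epsilon> > 0"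
    define S where "S = sqnorm (conv k k)"
    have "S \<ge> 0" by (simp add: S_def sqnorm_nonneg)
    define d where "d = \<epsilon>\<^sup>2 * l\<^sup>2 / (2 * (S + 1))"
    have "d > 0" using \<open>\<epsilon> > 0\<close> \<open>l > 0\<close> \<open>S \<ge> 0\<close> by (simp add: d_def)
    obtain N where N: "\<And>i j. i \<ge> N \<Longrightarrow> j \<ge> N \<Longrightarrow> \<bar>b i - b j\<bar> < d"
      using metric_CauchyD[OF LIMSEQ_imp_Cauchy[OF \<beta>] \<open>d > 0\<close>]
      unfolding dist_real_def by blast
    have "dist (g (Suc i) x) (g (Suc j) x) < \<epsilon>" if "i \<ge> N" "j \<ge> N" for i j x
    proof -
      let ?d = "\<lambda>x. g i x - g j x"
      have cd: "cont ?d" by (intro continuous_on_diff cg)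
      have "conv (conv k k) ?d x = of_real l * (g (Suc i) x - g (Suc j) x)"
        by (simp only: conv_diff_right[OF cg cg cont_conv[OF k k]] kg right_diff_distrib)
      then have "l\<^sup>2 * (dist (g (Suc i) x) (g (Suc j) x))\<^sup>2 = (cmod (conv (conv k k) ?d x))\<^sup>2"
        using \<open>l > 0\<close> by (simp add: dist_norm norm_mult power_mult_distrib)
      also have "\<dots> \<le> S * sqnorm ?d"
        unfolding S_def by (rule Cauchy_Schwarz_conv[OF cont_conv[OF k k] cd])
      also have "\<dots> \<le> S * (2 * d)"
      proof (rule mult_left_mono[OF _ \<open>S \<ge> 0\<close>])
        show "sqnorm ?d \<le> 2 * d"
          using N[of "Suc (2 * i)" "Suc (i + j)"] N[of "Suc (2 * j)" "Suc (i + j)"] that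
          unfolding sq by simp
      qed
      also have "\<dots> < (S + 1) * (2 * d)"
        using \<open>d > 0\<close> by simp
      also have "\<dots> = l\<^sup>2 * \<epsilon>\<^sup>2"
        using \<open>S \<ge> 0\<close> by (simp add: d_def field_simps)
      finally have "(dist (g (Suc i) x) (g (Suc j) x))\<^sup>2 < \<epsilon>\<^sup>2"
        using \<open>l > 0\<close> by (simp only: mult_less_cancel_left_pos zero_less_power)
      then show ?thesis
        using power2_less_imp_less[of _ \<epsilon>] \<open>\<epsilon> > 0\<close> by (metis less_imp_le)
    qed
    then show "\<exists>M. \<forall>x\<in>UNIV. \<forall>i\<ge>M. \<forall>j\<ge>M. dist (g (Suc i) x) (g (Suc j) x) < \<epsilon>"
      by blast
  qed
  then obtain e where u: "uniform_limit UNIV (\<lambda>n. g (Suc n)) e sequentially"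
    using Cauchy_uniformly_convergent uniformly_convergent_on_def by blast
  have pt: "(\<lambda>n. g (Suc n) x) \<longlonglongrightarrow> e x" for x
    using tendsto_uniform_limitI[OF u] by simp
  have ce: "cont e"
    by (rule uniform_limit_theorem[OF _ u]) (auto simp: cg)
  have he: "adj e = e"
  proof
    fix x
    have "(\<lambda>n. adj (g (Suc n)) x) \<longlonglongrightarrow> adj e x"
      unfolding adj_def by (intro tendsto_cnj pt)
    then show "adj e x = e x"
      using LIMSEQ_unique[OF _ pt] by (simp add: hg)
  qed
  have "(\<lambda>n. complex_of_real (b (Suc n))) \<longlonglongrightarrow> of_real \<beta>"
    using LIMSEQ_Suc[OF \<beta>] by (rule tendsto_of_real)
  then have "e 0 = of_real \<beta>"
    using LIMSEQ_unique[OF pt[of 0]] by (simp add: g0)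
  then have "e \<noteq> (\<lambda>_. 0)" using \<open>\<beta> \<ge> 1\<close> by auto
  have ke: "conv (conv k k) e = (\<lambda>x. of_real l * e x)"
  proof
    fix x
    have "(\<lambda>n. conv (conv k k) (g (Suc n)) x) \<longlonglongrightarrow> conv (conv k k) e x"
      by (rule conv_tendsto[OF cg cont_conv[OF k k] u])
    moreover have "(\<lambda>n. of_real l * g (Suc (Suc n)) x) \<longlonglongrightarrow> of_real l * e x"
      by (intro tendsto_mult tendsto_const LIMSEQ_Suc[OF pt])
    ultimately show "conv (conv k k) e x = of_real l * e x"
      using LIMSEQ_unique by (simp add: kg)
  qed
  have pe: "conv (conv_power k (Suc (2 * n))) e = (\<lambda>x. of_real (l ^ Suc n) * e x)" for n
  proof (induction n)
    case 0
    then show ?case using ke by simp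
  next
    case (Suc n)
    have "conv_power k (Suc (2 * Suc n)) = conv (conv k k) (conv_power k (Suc (2 * n)))"
      using kk[of 1 "Suc (2 * n)"] by simp
    then have "conv (conv_power k (Suc (2 * Suc n))) e = conv (conv k k) (conv (conv_power k (Suc (2 * n))) e)"
      by (simp only: conv_assoc[OF cont_conv[OF k k] ck ce])
    then show ?case
      unfolding Suc conv_scale_right ke by (simp add: mult_ac)
  qed
  have ge: "conv (g n) e = e" for n
    unfolding g_def conv_scale_left pe using \<open>l > 0\<close> by simp
  have "conv e e = e"
  proof
    fix x
    have "(\<lambda>n. conv e (g (Suc n)) x) \<longlonglongrightarrow> conv e e x"
      by (rule conv_tendsto[OF cg ce u])
    then show "conv e e x = e x"
      by (simp add: conv_commute[OF ce cg] ge LIMSEQ_const_iff)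
  qed
  then show ?thesis
    using that[OF \<open>l > 0\<close> ce he _ \<open>e \<noteq> (\<lambda>_. 0)\<close> ke] by simp
qed

end

context compact_haar
begin

lemma idempotent_0:
  assumes "cont e" "adj e = e" "conv e e = e"
  shows "e 0 = of_real (sqnorm e)"
  using conv_adj_self_0[OF assms(1)] unfolding assms(2,3) .

lemma norm_idempotent_le:
  assumes "cont e" "conv e e = e"
  shows "cmod (e x) \<le> sqnorm e"
proof (rule power2_le_imp_le[OF _ sqnorm_nonneg])
  show "(cmod (e x))\<^sup>2 \<le> (sqnorm e)\<^sup>2"
    using Cauchy_Schwarz_conv[OF assms(1,1), of x] unfolding assms(2) power2_eq_square[of "sqnorm e"] .
qed

text \<open>
  An idempotent is bounded by its squared norm, so its squared norm \<open>s\<close> satisfies \<open>s \<le> s\<^sup>2\<close>. This gap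
  makes the splitting of idempotents terminate.
\<close>

lemma sqnorm_idempotent_ge_1:
  assumes e: "cont e" "conv e e = e" and nz: "e \<noteq> (\<lambda>_. 0)"
  shows "sqnorm e \<ge> 1"
proof -
  have pos: "sqnorm e > 0"
    using sqnorm_nonneg[of e] sqnorm_eq_0D[OF e(1)] nz by (auto simp: less_le)
  have "sqnorm e = (\<integral>x. (cmod (e x))\<^sup>2 \<partial>m)"
    by (rule sqnorm_def)
  also have "\<dots> \<le> (\<integral>x. (sqnorm e)\<^sup>2 \<partial>m)"
  proof (rule integral_mono)
    show "integrable m (\<lambda>x. (cmod (e x))\<^sup>2)"
      by (intro continuous_integrable continuous_on_power continuous_on_norm e)
    show "(cmod (e x))\<^sup>2 \<le> (sqnorm e)\<^sup>2" for x
      by (intro power_mono norm_idempotent_le e) simp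
  qed simp
  finally have "sqnorm e * 1 \<le> sqnorm e * sqnorm e"
    by (simp add: power2_eq_square)
  then show ?thesis
    using pos by (simp only: mult_le_cancel_left_pos)
qed

text \<open>
  If \<open>e (x + a) = \<xi> a * e x\<close>, then \<open>\<xi>\<close> is multiplicative, and it is bounded by 1 because \<open>e\<close> attains its
  greatest absolute value at 0.
\<close>

lemma character_of_one_dimensional:
  assumes e: "cont e" "adj e = e" "conv e e = e" "e \<noteq> (\<lambda>_. 0)"
    and shift: "\<And>a. \<exists>c. (\<lambda>x. e (x + a)) = (\<lambda>x. c * e x)"
  shows "\<exists>\<xi>\<in>characters. conv e \<xi> = \<xi>"
proof -
  have s: "sqnorm e \<ge> 1" by (rule sqnorm_idempotent_ge_1[OF e(1,3,4)])
  have e0: "e 0 = of_real (sqnorm e)" by (rule idempotent_0[OF e(1-3)])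
  define \<xi> where "\<xi> a = e a / e 0" for a
  have sh: "e (x + a) = \<xi> a * e x" for a x
  proof -
    obtain c where c: "\<And>x. e (x + a) = c * e x" using shift[of a] by metis
    from c[of 0] have "c = \<xi> a" using s e0 by (simp add: \<xi>_def)
    then show ?thesis using c by simp
  qed
  have mult: "\<xi> (x + y) = \<xi> x * \<xi> y" for x y
    using sh[of x y] by (simp add: \<xi>_def)
  have le: "cmod (\<xi> x) \<le> 1" for x
    using norm_idempotent_le[OF e(1,3), of x] s e0 by (simp add: \<xi>_def norm_divide)
  have "cmod (\<xi> x) = 1" for x
  proof -
    have "\<xi> x * \<xi> (- x) = 1"
      using mult[of x "- x"] s e0 by (auto simp: \<xi>_def)
    then have "1 = cmod (\<xi> x) * cmod (\<xi> (- x))"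
      by (metis norm_mult norm_one)
    also have "\<dots> \<le> cmod (\<xi> x) * 1"
      by (intro mult_left_mono le) simp
    finally show ?thesis using le[of x] by simp
  qed
  moreover have "cont \<xi>"
    unfolding \<xi>_def using s e0 by (intro continuous_on_divide e continuous_on_const) auto
  ultimately have "\<xi> \<in> characters"
    using mult by (auto simp: characters_def)
  moreover have "conv e \<xi> = \<xi>"
  proof -
    have \<xi>: "\<xi> = (\<lambda>a. inverse (e 0) * e a)" by (simp add: \<xi>_def fun_eq_iff field_simps)
    show ?thesis unfolding \<xi> conv_scale_right e(3) ..
  qed
  ultimately show ?thesis by blast
qed

text \<open>
  The translates of \<open>e\<close> by \<open>a\<close> and \<open>-a\<close> are combinations of two functions \<open>h1\<close> and \<open>h2\<close> with
  \<open>adj h = h\<close>. One of them, called \<open>h\<close>, is not a multiple of \<open>e\<close>. Then \<open>h * h\<close> and \<open>(h + e) * (h + e)\<close> cannot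
  both be multiples of \<open>e\<close>, since their difference is \<open>2 h + e\<close>. So \<open>eigen_idempotent\<close>, applied to \<open>h\<close> or
  \<open>h + e\<close>, gives an idempotent different from \<open>e\<close>.
\<close>

lemma idempotent_split:
  assumes e: "cont e" "adj e = e" "conv e e = e" "e \<noteq> (\<lambda>_. 0)"
    and shift: "\<And>c. (\<lambda>x. e (x + a)) \<noteq> (\<lambda>x. c * e x)"
  obtains e' where "cont e'" "adj e' = e'" "conv e' e' = e'" "e' \<noteq> (\<lambda>_. 0)" "conv e e' = e'"
    "sqnorm e' \<le> sqnorm e - 1"
proof -
  define s s' where "s x = e (x + a)" and "s' x = e (x - a)" for x
  have cs: "cont s" "cont s'"
    unfolding s_def s'_def by (intro continuous_on_apply[OF e(1)] continuous_intros)+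
  have es: "conv s e = s" "conv s' e = s'"
    using conv_shift_left[of e a e] conv_shift_left[of e "- a" e]
    unfolding e(3) s_def s'_def by simp_all
  have adj_s: "adj s = s'" "adj s' = s"
    using fun_cong[OF e(2)]
    by (auto simp: adj_def s_def s'_def fun_eq_iff) (metis add.commute add.inverse_inverse diff_conv_add_uminus minus_diff_eq)+
  define h1 h2 where "h1 x = s x + s' x" and "h2 x = \<i> * (s x - s' x)" for x
  have h1: "cont h1" "adj h1 = h1" "conv h1 e = h1"
  proof -
    show "cont h1" unfolding h1_def by (intro continuous_on_add cs)
    show "adj h1 = h1"
      using adj_s[THEN fun_cong] by (simp add: h1_def adj_def fun_eq_iff add.commute)
    show "conv h1 e = h1"
      unfolding h1_def conv_add_left[OF cs e(1)] es ..
  qed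
  have h2: "cont h2" "adj h2 = h2" "conv h2 e = h2"
  proof -
    have c: "cont (\<lambda>x. s x - s' x)" by (intro continuous_on_diff cs)
    then show "cont h2" unfolding h2_def by (intro continuous_on_mult continuous_on_const)
    show "adj h2 = h2"
      using adj_s[THEN fun_cong] by (simp add: h2_def adj_def fun_eq_iff algebra_simps)
    show "conv h2 e = h2"
      unfolding h2_def conv_scale_left conv_diff_left[OF cs e(1)] es ..
  qed
  obtain h where h: "cont h" "adj h = h" "conv h e = h" "\<And>c. h \<noteq> (\<lambda>x. c * e x)"
  proof (cases "\<exists>\<alpha>. h1 = (\<lambda>x. \<alpha> * e x)")
    case True
    then obtain \<alpha> where \<alpha>: "h1 = (\<lambda>x. \<alpha> * e x)" by blast
    have "h2 \<noteq> (\<lambda>x. \<beta> * e x)" for \<beta>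
    proof
      assume \<beta>: "h2 = (\<lambda>x. \<beta> * e x)"
      have "s x = (\<alpha> - \<i> * \<beta>) / 2 * e x" for x
      proof -
        have "2 * s x = h1 x - \<i> * h2 x" by (simp add: h1_def h2_def algebra_simps)
        then show ?thesis unfolding \<alpha> \<beta> by (simp add: algebra_simps)
      qed
      then show False using shift unfolding s_def by blast
    qed
    then show ?thesis using that h2 by blast
  next
    case False
    then show ?thesis using that h1 by blast
  qed
  define h' where "h' x = h x + e x" for x
  have h': "cont h'" "adj h' = h'" "conv h' e = h'"
  proof -
    show "cont h'" unfolding h'_def by (intro continuous_on_add h e)
    show "adj h' = h'"
      using h(2)[THEN fun_cong] e(2)[THEN fun_cong] by (simp add: h'_def adj_def fun_eq_iff)
    show "conv h' e = h'"
      unfolding h'_def conv_add_left[OF h(1) e(1) e(1)] h(3) e(3) ..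
  qed
  (* Squares are needed because eigen_idempotent speaks of k * k, not of k. *)
  obtain k where k: "cont k" "adj k = k" "conv k e = k" "\<And>c. conv k k \<noteq> (\<lambda>x. c * e x)"
  proof (cases "\<exists>\<alpha>. conv h h = (\<lambda>x. \<alpha> * e x)")
    case True
    then obtain \<alpha> where \<alpha>: "conv h h = (\<lambda>x. \<alpha> * e x)" by blast
    have "conv h' h' \<noteq> (\<lambda>x. \<beta> * e x)" for \<beta>
    proof
      assume \<beta>: "conv h' h' = (\<lambda>x. \<beta> * e x)"
      have "conv h' h' = (\<lambda>x. conv h h x + h x + (h x + e x))"
      proof -
        have h'_eq: "h' = (\<lambda>x. h x + e x)" by (simp add: h'_def fun_eq_iff)
        have "conv h h' = (\<lambda>x. conv h h x + h x)"
          unfolding h'_eq conv_add_right[OF h(1) e(1) h(1)] h(3) ..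
        moreover have "conv e h' = h'"
          using conv_commute[OF e(1) h'(1)] h'(3) by simp
        ultimately show ?thesis
          using conv_add_left[OF h(1) e(1) h'(1)] by (simp add: h'_eq)
      qed
      then have "h x = (\<beta> - \<alpha> - 1) / 2 * e x" for x
        using fun_cong[OF \<beta>, of x] unfolding \<alpha> by (simp add: field_simps)
      then show False using h(4) by blast
    qed
    then show ?thesis using that h' by blast
  next
    case False
    then show ?thesis using that h by blast
  qed
  have ckk: "cont (conv k k)" by (intro cont_conv k)
  have ekk: "conv e (conv k k) = conv k k"
    using conv_assoc[OF e(1) k(1) k(1)] conv_commute[OF e(1) k(1)] k(3) by simp
  have "k \<noteq> (\<lambda>_. 0)"
    using k(4)[of 0] by (auto simp: conv_def)
  from eigen_idempotent[OF k(1,2) this] obtain l :: real and e' where l: "l > 0"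
    and e': "cont e'" "adj e' = e'" "conv e' e' = e'" "e' \<noteq> (\<lambda>_. 0)"
    and ke': "conv (conv k k) e' = (\<lambda>x. of_real l * e' x)" by blast
  have "(\<lambda>x. of_real l * conv e e' x) = (\<lambda>x. of_real l * e' x)"
    using conv_assoc[OF e(1) ckk e'(1)] unfolding ekk ke' conv_scale_right by simp
  then have ee': "conv e e' = e'"
    using l by (simp add: fun_eq_iff)
  define d where "d x = e x - e' x" for x
  have cd: "cont d" unfolding d_def by (intro continuous_on_diff e e')
  (* Otherwise conv k k = conv (conv k k) e would be a multiple of e. *)
  have "e' \<noteq> e"
    using k(4)[of "of_real l"] ke' conv_commute[OF ckk e(1)] ekk by auto
  then have "d \<noteq> (\<lambda>_. 0)" by (auto simp: d_def fun_eq_iff dest: sym)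
  moreover have dd: "conv d d = d"
  proof -
    have d: "d = (\<lambda>x. e x - e' x)" by (simp add: d_def fun_eq_iff)
    have "conv e' e = e'"
      using conv_commute[OF e(1) e'(1)] ee' by simp
    then have "conv e' d = (\<lambda>_. 0)"
      unfolding d conv_diff_right[OF e(1) e'(1) e'(1)] e'(3) by simp
    moreover have "conv e d = d"
      unfolding d conv_diff_right[OF e(1) e'(1) e(1)] e(3) ee' ..
    ultimately show ?thesis
      using conv_diff_left[OF e(1) e'(1) cd] by (simp flip: d)
  qed
  ultimately have "sqnorm d \<ge> 1"
    using sqnorm_idempotent_ge_1[OF cd] by blast
  moreover have "adj d = d"
    using e(2)[THEN fun_cong] e'(2)[THEN fun_cong] by (simp add: d_def adj_def fun_eq_iff)
  then have "d 0 = of_real (sqnorm d)"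
    using idempotent_0[OF cd _ dd] by blast
  then have "sqnorm d = sqnorm e - sqnorm e'"
    unfolding d_def using idempotent_0[OF e(1-3)] idempotent_0[OF e'(1-3)]
    by (simp add: fun_eq_iff flip: of_real_diff)
  ultimately show ?thesis
    using that[OF e' ee'] by simp
qed

lemma idempotent_character:
  assumes e: "cont e" "adj e = e" "conv e e = e" "e \<noteq> (\<lambda>_. 0)"
  shows "\<exists>\<xi>\<in>characters. conv e \<xi> = \<xi>"
proof -
  obtain n :: nat where "sqnorm e < real n" using reals_Archimedean2 by blast
  then show ?thesis using e
  proof (induction n arbitrary: e)
    case 0
    then show ?case using sqnorm_nonneg[of e] by simp
  next
    case (Suc n)
    show ?case
    proof (cases "\<forall>a. \<exists>c. (\<lambda>x. e (x + a)) = (\<lambda>x. c * e x)")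
      case True
      then show ?thesis using character_of_one_dimensional[OF Suc.prems(2-5)] by blast
    next
      case False
      then obtain a where "\<And>c. (\<lambda>x. e (x + a)) \<noteq> (\<lambda>x. c * e x)" by blast
      from idempotent_split[OF Suc.prems(2-5) this] obtain e' where
        e': "cont e'" "adj e' = e'" "conv e' e' = e'" "e' \<noteq> (\<lambda>_. 0)" "conv e e' = e'"
          "sqnorm e' \<le> sqnorm e - 1" by blast
      then obtain \<xi> where \<xi>: "\<xi> \<in> characters" "conv e' \<xi> = \<xi>"
        using Suc.IH[of e'] Suc.prems(1) by auto
      then have "conv e \<xi> = \<xi>"
        using conv_assoc[OF Suc.prems(2) e'(1), of \<xi>] e'(5) by (simp add: characters_def)
      then show ?thesis using \<xi>(1) by blast
    qed
  qed
qed

lemma normal_space_euclidean: "normal_space (euclidean :: 'a topology)"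
proof (rule compact_Hausdorff_or_regular_imp_normal_space)
  show "compact_space (euclidean :: 'a topology)"
    using compact_UNIV by (simp add: compact_space_def)
  have "Hausdorff_space (euclidean :: 'a topology)"
    using hausdorff by (auto simp: Hausdorff_space_def disjnt_def)
  then show "Hausdorff_space (euclidean :: 'a topology) \<or> regular_space (euclidean :: 'a topology)" ..
qed

lemma Urysohn_compact:
  fixes S T :: "'a set"
  assumes "closed S" "closed T" "S \<inter> T = {}"
  obtains f :: "'a \<Rightarrow> real" where "continuous_on UNIV f" "\<And>x. 0 \<le> f x \<and> f x \<le> 1"
    "\<And>x. x \<in> S \<Longrightarrow> f x = 0" "\<And>x. x \<in> T \<Longrightarrow> f x = 1"
proof -
  have *: "closedin euclidean S" "closedin euclidean T" "disjnt S T" "(0::real) \<le> 1"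
    using assms by (simp_all add: disjnt_def)
  obtain f :: "'a \<Rightarrow> real"
    where f: "continuous_map euclidean (top_of_set {0..1}) f" "f ` S \<subseteq> {0}" "f ` T \<subseteq> {1}"
    by (rule Urysohn_lemma[OF normal_space_euclidean *])
  have f': "continuous_on UNIV f" "\<And>x. 0 \<le> f x \<and> f x \<le> 1"
    using f(1) by (auto simp: continuous_map_in_subtopology image_subset_iff)
  show ?thesis
    by (rule that[OF f']) (use f(2,3) in auto)
qed

text \<open>
  Let \<open>v\<close> be the difference between a function and its translate by \<open>d = b - a\<close>. If a character \<open>\<xi>\<close>
  satisfies \<open>\<xi> d = 1\<close>, then \<open>v * \<xi> = 0\<close>. So the character that belongs to an eigenidempotent of
  \<open>v * adj v\<close> is not 1 at \<open>d\<close>.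
\<close>

theorem characters_separate_points:
  fixes a b :: 'a
  assumes "a \<noteq> b"
  shows "\<exists>\<xi>\<in>characters. \<xi> a \<noteq> \<xi> b"
proof -
  obtain f :: "'a \<Rightarrow> real" where f: "continuous_on UNIV f" "f a = 0" "f b = 1"
    by (rule Urysohn_compact[of "{a}" "{b}"]) (use assms in auto)
  define d where "d = b - a"
  define u where "u x = complex_of_real (f x)" for x
  define v where "v x = u x - u (x + d)" for x
  have cu: "cont u" unfolding u_def by (intro continuous_on_of_real f)
  have cu': "cont (\<lambda>x. u (x + d))" by (intro continuous_on_apply[OF cu] continuous_intros)
  have cv: "cont v" unfolding v_def by (intro continuous_on_diff cu cu')
  have "v a \<noteq> 0" by (simp add: v_def u_def d_def f)
  define k where "k = conv v (adj v)"
  have ck: "cont k" unfolding k_def by (intro cont_conv cont_adj cv)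
  have "adj (adj v) = v" by (simp add: adj_def)
  then have "adj k = k"
    unfolding k_def adj_conv[OF cv cont_adj[OF cv]] by (simp add: conv_commute cont_adj cv)
  moreover have "k 0 \<noteq> 0"
    unfolding k_def conv_adj_self_0[OF cv] using sqnorm_eq_0D[OF cv] \<open>v a \<noteq> 0\<close> by auto
  then have "k \<noteq> (\<lambda>_. 0)" by auto
  ultimately obtain l :: real and e where l: "l > 0"
    and e: "cont e" "adj e = e" "conv e e = e" "e \<noteq> (\<lambda>_. 0)"
    and ke: "conv (conv k k) e = (\<lambda>x. of_real l * e x)"
    using eigen_idempotent[OF ck] by metis
  obtain \<xi> where \<xi>: "\<xi> \<in> characters" "conv e \<xi> = \<xi>"
    using idempotent_character[OF e] by blast
  have c\<xi>: "cont \<xi>" and \<xi>_mult: "\<xi> (x + y) = \<xi> x * \<xi> y" and \<xi>_norm: "cmod (\<xi> x) = 1" for x y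
    using \<xi>(1) by (auto simp: characters_def)
  have "\<xi> d \<noteq> 1"
  proof
    assume "\<xi> d = 1"
    then have per: "\<xi> (x + d) = \<xi> x" for x by (simp add: \<xi>_mult)
    have "conv u \<xi> (x + d) = conv u \<xi> x" for x
      using fun_cong[OF conv_shift_left[of \<xi> d u], of x] unfolding per
      by (simp add: conv_commute[OF cu c\<xi>])
    then have "conv v \<xi> = (\<lambda>_. 0)"
      unfolding v_def conv_diff_left[OF cu cu' c\<xi>] conv_shift_left by simp
    then have "conv k \<xi> = (\<lambda>_. 0)"
      unfolding k_def conv_commute[OF cv cont_adj[OF cv]] conv_assoc[OF cont_adj[OF cv] cv c\<xi>]
      by (simp add: conv_def)
    then have "conv (conv k k) \<xi> = (\<lambda>_. 0)"
      unfolding conv_assoc[OF ck ck c\<xi>] by (simp add: conv_def)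
    moreover have "conv (conv k k) \<xi> = (\<lambda>x. of_real l * \<xi> x)"
      using conv_assoc[OF cont_conv[OF ck ck] e(1) c\<xi>] unfolding \<xi>(2) ke conv_scale_left by simp
    ultimately have "of_real l * \<xi> 0 = 0" by (metis)
    then show False using l \<xi>_norm[of 0] by auto
  qed
  moreover have "\<xi> b = \<xi> d * \<xi> a"
    using \<xi>_mult[of d a] by (simp add: d_def)
  moreover have "\<xi> a \<noteq> 0" using \<xi>_norm[of a] by auto
  ultimately show ?thesis using \<xi>(1) by (intro bexI[of _ \<xi>]) auto
qed

end

section \<open>Characters and trigonometric polynomials\<close>

lemma char_one: "(\<lambda>_. 1) \<in> characters"
  by (simp add: characters_def)

lemma char_conj: "\<xi> \<in> characters \<Longrightarrow> conj_fun \<xi> \<in> characters"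
  by (auto simp: characters_def conj_fun_def intro: continuous_on_cnj)

lemma char_char_mult: "\<xi> \<in> characters \<Longrightarrow> \<psi> \<in> characters \<Longrightarrow> char_mult \<xi> \<psi> \<in> characters"
  unfolding characters_def char_mult_def
  by (auto simp: norm_mult mult_ac intro: continuous_on_mult)

lemma char_norm [simp]: "\<xi> \<in> characters \<Longrightarrow> cmod (\<xi> x) = 1"
  unfolding characters_def by blast

lemma char_continuous: "\<xi> \<in> characters \<Longrightarrow> continuous_on UNIV \<xi>"
  unfolding characters_def by blast

lemma char_add: "\<xi> \<in> characters \<Longrightarrow> \<xi> (x + y) = \<xi> x * \<xi> y"
  unfolding characters_def by blast

lemma char_cnj_mult: "\<xi> \<in> characters \<Longrightarrow> cnj (\<xi> x) * \<xi> x = 1" "\<xi> \<in> characters \<Longrightarrow> \<xi> x * cnj (\<xi> x) = 1"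
  by (simp_all add: complex_norm_square[symmetric] mult.commute)

lemma conj_fun_conj_fun [simp]: "conj_fun (conj_fun \<xi>) = \<xi>"
  by (simp add: conj_fun_def)

definition trig_polys :: "('a::topological_ab_group_add \<Rightarrow> complex) set" where
  "trig_polys = {trig_poly M c | M c. finite M \<and> M \<subseteq> characters}"

lemma trig_poly_in: "finite M \<Longrightarrow> M \<subseteq> characters \<Longrightarrow> trig_poly M c \<in> trig_polys"
  by (auto simp: trig_polys_def)

lemma trig_polys_zero: "(\<lambda>_. 0) \<in> trig_polys"
  using trig_poly_in[of "{}"] by (simp add: trig_poly_def)

lemma trig_polys_scaled_char: "\<xi> \<in> characters \<Longrightarrow> (\<lambda>x. c * \<xi> x) \<in> trig_polys"
  using trig_poly_in[of "{\<xi>}" "\<lambda>_. c"] by (simp add: trig_poly_def)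

lemma trig_polys_add:
  assumes "f \<in> trig_polys" "g \<in> trig_polys"
  shows "(\<lambda>x. f x + g x) \<in> trig_polys"
proof -
  obtain M c N d where f: "f = trig_poly M c" "finite M" "M \<subseteq> characters"
    and g: "g = trig_poly N d" "finite N" "N \<subseteq> characters"
    using assms by (auto simp: trig_polys_def)
  define b where "b \<xi> = (if \<xi> \<in> M then c \<xi> else 0) + (if \<xi> \<in> N then d \<xi> else 0)" for \<xi>
  have "f x + g x = trig_poly (M \<union> N) b x" for x
  proof -
    have "(\<Sum>\<xi>\<in>M. c \<xi> * \<xi> x) = (\<Sum>\<xi>\<in>M \<union> N. (if \<xi> \<in> M then c \<xi> else 0) * \<xi> x)"
      using f(2) g(2) by (intro sum.mono_neutral_cong_left) auto
    moreover have "(\<Sum>\<xi>\<in>N. d \<xi> * \<xi> x) = (\<Sum>\<xi>\<in>M \<union> N. (if \<xi> \<in> N then d \<xi> else 0) * \<xi> x)"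
      using f(2) g(2) by (intro sum.mono_neutral_cong_left) auto
    ultimately show ?thesis
      by (simp add: f(1) g(1) trig_poly_def b_def distrib_right sum.distrib)
  qed
  then have "(\<lambda>x. f x + g x) = trig_poly (M \<union> N) b" by auto
  then show ?thesis
    using trig_poly_in[of "M \<union> N" b] f g by simp
qed

lemma trig_polys_sum:
  "finite I \<Longrightarrow> (\<And>i. i \<in> I \<Longrightarrow> f i \<in> trig_polys) \<Longrightarrow> (\<lambda>x. \<Sum>i\<in>I. f i x) \<in> trig_polys"
  by (induction I rule: finite_induct) (simp_all add: trig_polys_zero trig_polys_add)

lemma trig_polys_scale:
  assumes "f \<in> trig_polys"
  shows "(\<lambda>x. a * f x) \<in> trig_polys"
proof -
  obtain M c where f: "f = trig_poly M c" "finite M" "M \<subseteq> characters"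
    using assms by (auto simp: trig_polys_def)
  have "(\<lambda>x. a * f x) = trig_poly M (\<lambda>\<xi>. a * c \<xi>)"
    by (simp add: f(1) trig_poly_def sum_distrib_left mult.assoc)
  then show ?thesis using trig_poly_in f by metis
qed

lemma trig_polys_const: "(\<lambda>_. c) \<in> trig_polys"
  using trig_polys_scaled_char[OF char_one, of c] by simp

lemma trig_polys_diff: "f \<in> trig_polys \<Longrightarrow> g \<in> trig_polys \<Longrightarrow> (\<lambda>x. f x - g x) \<in> trig_polys"
  using trig_polys_add[of f "\<lambda>x. -1 * g x"] trig_polys_scale[of g "-1"] by simp

lemma trig_polys_mult:
  assumes "f \<in> trig_polys" "g \<in> trig_polys"
  shows "(\<lambda>x. f x * g x) \<in> trig_polys"
proof -
  obtain M c N d where f: "f = trig_poly M c" "finite M" "M \<subseteq> characters"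
    and g: "g = trig_poly N d" "finite N" "N \<subseteq> characters"
    using assms by (auto simp: trig_polys_def)
  have "(\<lambda>x. f x * g x) = (\<lambda>x. \<Sum>\<xi>\<in>M. \<Sum>\<psi>\<in>N. c \<xi> * d \<psi> * char_mult \<xi> \<psi> x)"
    by (simp add: f(1) g(1) trig_poly_def sum_product char_mult_def mult_ac)
  also have "\<dots> \<in> trig_polys"
    using f g by (intro trig_polys_sum trig_polys_scaled_char char_char_mult) auto
  finally show ?thesis .
qed

lemma trig_polys_cnj:
  assumes "f \<in> trig_polys"
  shows "(\<lambda>x. cnj (f x)) \<in> trig_polys"
proof -
  obtain M c where f: "f = trig_poly M c" "finite M" "M \<subseteq> characters"
    using assms by (auto simp: trig_polys_def)
  have "(\<lambda>x. cnj (f x)) = (\<lambda>x. \<Sum>\<xi>\<in>M. cnj (c \<xi>) * conj_fun \<xi> x)"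
    by (simp add: f(1) trig_poly_def conj_fun_def)
  also have "\<dots> \<in> trig_polys"
    using f by (intro trig_polys_sum trig_polys_scaled_char char_conj) auto
  finally show ?thesis .
qed

lemma trig_polys_Re: "f \<in> trig_polys \<Longrightarrow> (\<lambda>x. complex_of_real (Re (f x))) \<in> trig_polys"
  using trig_polys_scale[OF trig_polys_add[OF _ trig_polys_cnj], of f f "1 / 2"]
  by (simp add: complex_add_cnj)

lemma trig_polys_Im: "f \<in> trig_polys \<Longrightarrow> (\<lambda>x. complex_of_real (Im (f x))) \<in> trig_polys"
  using trig_polys_Re[OF trig_polys_scale[of f "- \<i>"]] by simp

lemma trig_polys_continuous:
  assumes "f \<in> trig_polys"
  shows "continuous_on UNIV f"
proof -
  obtain M c where f: "f = trig_poly M c" "finite M" "M \<subseteq> characters"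
    using assms by (auto simp: trig_polys_def)
  show ?thesis
    unfolding f(1) trig_poly_def using f(3)
    by (intro continuous_on_sum continuous_on_mult continuous_on_const char_continuous) blast
qed

section \<open>Fourier coefficients\<close>

context compact_haar
begin

lemma integral_char:
  assumes "\<xi> \<in> characters"
  shows "(\<integral>x. \<xi> x \<partial>m) = (if \<xi> = (\<lambda>_. 1) then 1 else 0)"
proof (cases "\<xi> = (\<lambda>_. 1)")
  case False
  then obtain a where a: "\<xi> a \<noteq> 1" by auto
  have "(\<integral>x. \<xi> x \<partial>m) = (\<integral>x. \<xi> (a + x) \<partial>m)"
    using integral_translate[OF char_continuous[OF assms], of a] by simp
  also have "\<dots> = \<xi> a * (\<integral>x. \<xi> x \<partial>m)"
    by (simp add: char_add[OF assms])
  finally show ?thesis using a False by auto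
qed simp

lemma fourier_char:
  assumes "\<psi> \<in> characters" "\<xi> \<in> characters"
  shows "fourier m \<psi> \<xi> = (if \<psi> = \<xi> then 1 else 0)"
proof -
  have "fourier m \<psi> \<xi> = (if char_mult \<psi> (conj_fun \<xi>) = (\<lambda>_. 1) then 1 else 0)"
    using integral_char[OF char_char_mult[OF assms(1) char_conj[OF assms(2)]]]
    by (simp add: fourier_def char_mult_def conj_fun_def)
  also have "char_mult \<psi> (conj_fun \<xi>) = (\<lambda>_. 1) \<longleftrightarrow> \<psi> = \<xi>"
  proof
    assume "char_mult \<psi> (conj_fun \<xi>) = (\<lambda>_. 1)"
    then have "\<psi> x * cnj (\<xi> x) * \<xi> x = \<xi> x" for x
      by (metis char_mult_def conj_fun_def mult_1)
    then show "\<psi> = \<xi>" using char_cnj_mult[OF assms(2)] by (auto simp: mult.assoc)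
  qed (use char_cnj_mult[OF assms(2)] in \<open>auto simp: char_mult_def conj_fun_def\<close>)
  finally show ?thesis .
qed

lemma integrable_mult_bounded:
  fixes f g :: "'a \<Rightarrow> complex"
  assumes "integrable m f" "g \<in> borel_measurable m" "\<And>x. cmod (g x) \<le> B"
  shows "integrable m (\<lambda>x. f x * g x)"
proof (rule Bochner_Integration.integrable_bound)
  show "integrable m (\<lambda>x. B * cmod (f x))" using assms by simp
  show "(\<lambda>x. f x * g x) \<in> borel_measurable m" using assms by measurable
  have "cmod (f x * g x) \<le> norm (B * cmod (f x))" for x
  proof -
    have "cmod (f x * g x) \<le> cmod (f x) * B"
      unfolding norm_mult using assms(3)[of x] by (intro mult_left_mono) auto
    also have "\<dots> \<le> norm (B * cmod (f x))" by (simp add: mult.commute)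
    finally show ?thesis .
  qed
  then show "AE x in m. cmod (f x * g x) \<le> norm (B * cmod (f x))" by simp
qed

lemma char_measurable: "\<xi> \<in> characters \<Longrightarrow> \<xi> \<in> borel_measurable m"
  by (intro continuous_measurable char_continuous)

lemma integrable_mult_cnj_char:
  assumes "integrable m f" "\<xi> \<in> characters"
  shows "integrable m (\<lambda>x. f x * cnj (\<xi> x))"
  using integrable_mult_bounded[OF assms(1) char_measurable[OF char_conj[OF assms(2)]], of 1] assms(2)
  by (simp add: conj_fun_def)

lemma fourier_add:
  "integrable m f \<Longrightarrow> integrable m g \<Longrightarrow> \<xi> \<in> characters \<Longrightarrow>
     fourier m (\<lambda>x. f x + g x) \<xi> = fourier m f \<xi> + fourier m g \<xi>"
  by (simp add: fourier_def distrib_right integrable_mult_cnj_char)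

lemma fourier_diff:
  "integrable m f \<Longrightarrow> integrable m g \<Longrightarrow> \<xi> \<in> characters \<Longrightarrow>
     fourier m (\<lambda>x. f x - g x) \<xi> = fourier m f \<xi> - fourier m g \<xi>"
  by (simp add: fourier_def left_diff_distrib integrable_mult_cnj_char)

lemma fourier_scale: "fourier m (\<lambda>x. a * f x) \<xi> = a * fourier m f \<xi>"
  by (simp add: fourier_def mult.assoc)

lemma fourier_cnj: "fourier m (\<lambda>x. cnj (f x)) \<xi> = cnj (fourier m f (conj_fun \<xi>))"
  by (simp add: fourier_def conj_fun_def flip: integral_cnj complex_cnj_mult)

lemma fourier_mult_conj: "fourier m (\<lambda>x. cnj (\<psi> x) * f x) \<xi> = fourier m f (char_mult \<psi> \<xi>)"
  by (simp add: fourier_def char_mult_def mult_ac)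

lemma fourier_const:
  assumes "\<xi> \<in> characters"
  shows "fourier m (\<lambda>_. a) \<xi> = (if \<xi> = (\<lambda>_. 1) then a else 0)"
  using fourier_scale[of a "\<lambda>_. 1" \<xi>] fourier_char[OF char_one assms] by auto

lemma norm_fourier_le:
  assumes "\<xi> \<in> characters"
  shows "cmod (fourier m f \<xi>) \<le> (\<integral>x. cmod (f x) \<partial>m)"
  unfolding fourier_def using integral_norm_bound[of m "\<lambda>x. f x * cnj (\<xi> x)"] assms
  by (simp add: norm_mult)

lemma trig_polys_integrable: "f \<in> trig_polys \<Longrightarrow> integrable m f"
  by (intro continuous_integrable trig_polys_continuous)

lemma fourier_trig_poly:
  assumes "finite M" "M \<subseteq> characters" "\<xi> \<in> characters"
  shows "fourier m (trig_poly M c) \<xi> = (if \<xi> \<in> M then c \<xi> else 0)"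
proof -
  have "fourier m (trig_poly M c) \<xi> = (\<integral>x. (\<Sum>\<psi>\<in>M. c \<psi> * \<psi> x * cnj (\<xi> x)) \<partial>m)"
    by (simp add: fourier_def trig_poly_def sum_distrib_right)
  also have "\<dots> = (\<Sum>\<psi>\<in>M. \<integral>x. c \<psi> * \<psi> x * cnj (\<xi> x) \<partial>m)"
    using assms by (intro Bochner_Integration.integral_sum integrable_mult_cnj_char trig_polys_integrable
        trig_polys_scaled_char) auto
  also have "\<dots> = (\<Sum>\<psi>\<in>M. c \<psi> * fourier m \<psi> \<xi>)"
    by (simp add: fourier_def mult.assoc)
  also have "\<dots> = (\<Sum>\<psi>\<in>M. if \<psi> = \<xi> then c \<psi> else 0)"
    using assms by (intro sum.cong refl) (auto simp: fourier_char)
  finally show ?thesis using assms by simp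
qed

definition spectrum :: "('a \<Rightarrow> complex) \<Rightarrow> ('a \<Rightarrow> complex) set" where
  "spectrum f = {\<xi> \<in> characters. fourier m f \<xi> \<noteq> 0}"

text \<open>
  The superset \<open>N\<close> of the spectrum is arbitrary, so that several polynomials can be expanded over
  the same set of characters.
\<close>

lemma trig_polys_expand:
  assumes "f \<in> trig_polys" "finite N" "spectrum f \<subseteq> N" "N \<subseteq> characters"
  shows "f = trig_poly N (fourier m f)"
proof -
  obtain M c where f: "f = trig_poly M c" "finite M" "M \<subseteq> characters"
    using assms by (auto simp: trig_polys_def)
  have fo: "fourier m f \<xi> = (if \<xi> \<in> M then c \<xi> else 0)" if "\<xi> \<in> characters" for \<xi>
    unfolding f(1) by (rule fourier_trig_poly[OF f(2,3) that])
  show ?thesis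
  proof
    fix x
    have "(\<Sum>\<xi>\<in>M. c \<xi> * \<xi> x) = (\<Sum>\<xi>\<in>M \<union> N. fourier m f \<xi> * \<xi> x)"
      using f assms fo by (intro sum.mono_neutral_cong_left) auto
    also have "\<dots> = (\<Sum>\<xi>\<in>N. fourier m f \<xi> * \<xi> x)"
      using f assms by (intro sum.mono_neutral_right) (auto simp: spectrum_def)
    finally show "f x = trig_poly N (fourier m f) x"
      by (simp add: f(1) trig_poly_def)
  qed
qed

lemma finite_spectrum:
  assumes "f \<in> trig_polys"
  shows "finite (spectrum f)"
proof -
  obtain M c where f: "f = trig_poly M c" "finite M" "M \<subseteq> characters"
    using assms by (auto simp: trig_polys_def)
  have "spectrum f \<subseteq> M"
    unfolding spectrum_def f(1) using fourier_trig_poly[OF f(2,3)] by (auto split: if_splits)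
  then show ?thesis by (rule finite_subset[OF _ f(2)])
qed

lemma trig_polys_eqI:
  assumes "f \<in> trig_polys" "g \<in> trig_polys" "\<And>\<xi>. \<xi> \<in> characters \<Longrightarrow> fourier m f \<xi> = fourier m g \<xi>"
  shows "f = g"
proof -
  have s: "spectrum f = spectrum g" using assms(3) by (auto simp: spectrum_def)
  have "f = trig_poly (spectrum f) (fourier m f)"
    by (rule trig_polys_expand[OF assms(1) finite_spectrum[OF assms(1)]]) (auto simp: spectrum_def)
  also have "\<dots> = trig_poly (spectrum f) (fourier m g)"
    using assms(3) by (auto simp: trig_poly_def spectrum_def intro!: sum.cong)
  also have "\<dots> = g"
    using trig_polys_expand[OF assms(2) finite_spectrum[OF assms(2)]] s by (auto simp: spectrum_def)
  finally show ?thesis .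
qed

section \<open>Density of the trigonometric polynomials\<close>

theorem trig_polys_uniformly_dense:
  fixes f :: "'a \<Rightarrow> real"
  assumes "continuous_on UNIV f" "e > 0"
  obtains g :: "'a \<Rightarrow> real" where "(\<lambda>x. complex_of_real (g x)) \<in> trig_polys" "\<And>x. \<bar>f x - g x\<bar> < e"
proof -
  interpret R: function_ring_on "{g. (\<lambda>x. complex_of_real (g x)) \<in> trig_polys}" "UNIV :: 'a set"
  proof
    show "compact (UNIV :: 'a set)" by (rule compact_UNIV)
  next
    fix f :: "'a \<Rightarrow> real" assume "f \<in> {g. (\<lambda>x. complex_of_real (g x)) \<in> trig_polys}"
    then have "continuous_on UNIV (\<lambda>x. Re (complex_of_real (f x)))"
      by (intro continuous_on_Re trig_polys_continuous) simp
    then show "continuous_on UNIV f" by simp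
  next
    fix x y :: 'a assume "x \<noteq> y"
    then obtain \<xi> where \<xi>: "\<xi> \<in> characters" "\<xi> x \<noteq> \<xi> y"
      using characters_separate_points by blast
    then have "\<xi> \<in> trig_polys" using trig_polys_scaled_char[of \<xi> 1] by simp
    from trig_polys_Re[OF this] trig_polys_Im[OF this] \<xi>(2)
    show "\<exists>f\<in>{g. (\<lambda>x. complex_of_real (g x)) \<in> trig_polys}. f x \<noteq> f y"
      by (metis complex_eqI mem_Collect_eq)
  qed (auto intro: trig_polys_add trig_polys_mult trig_polys_const)
  show ?thesis
    using R.Stone_Weierstrass_basic[OF assms] that by auto
qed

text \<open>
  Regularity gives compact sets inside \<open>A\<close> and its complement that fill up almost all of
  the group, and a Urysohn function between them is close to the indicator in the mean. The uniform bound
  makes dominated convergence applicable.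
\<close>

lemma indicator_trig_approx:
  assumes A: "A \<in> sets m"
  obtains q :: "nat \<Rightarrow> 'a \<Rightarrow> complex" where "\<And>n. q n \<in> trig_polys" "\<And>n x. cmod (q n x) \<le> 2"
    "AE x in m. (\<lambda>n. q n x) \<longlonglongrightarrow> indicator A x"
proof -
  have reg: "\<exists>K. compact K \<and> K \<subseteq> B \<and> measure m (B - K) < e" if B: "B \<in> sets m" and e: "e > 0" for B e
  proof -
    have sup: "emeasure m B = (\<Squnion>K\<in>{K. compact K \<and> K \<subseteq> B}. emeasure m K)"
      using haar B by (simp add: normalized_haar_def)
    show ?thesis
    proof (cases "measure m B < e")
      case True
      then show ?thesis by (intro exI[of _ "{}"]) simp
    next
      case False
      then have "ennreal (measure m B - e) < emeasure m B"
        using e by (simp add: emeasure_eq_measure ennreal_less_iff)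
      then obtain K where K: "compact K" "K \<subseteq> B" "ennreal (measure m B - e) < emeasure m K"
        unfolding sup less_SUP_iff by blast
      then have "measure m B - e < measure m K"
        using False by (simp add: emeasure_eq_measure ennreal_less_iff)
      moreover have "K \<in> sets m"
        using compact_imp_closed[OF K(1)] by simp
      then have "measure m (B - K) = measure m B - measure m K"
        using B K(2) by (intro finite_measure_Diff)
      ultimately show ?thesis using K by (intro exI[of _ K]) simp
    qed
  qed
  have "\<exists>f :: 'a \<Rightarrow> real. continuous_on UNIV f \<and> (\<forall>x. 0 \<le> f x \<and> f x \<le> 1) \<and>
      (\<integral>x. norm (f x - indicator A x) \<partial>m) \<le> 2 / real (Suc n)" for n
  proof -
    have "1 / real (Suc n) > 0" by simp
    then obtain K L where K: "compact K" "K \<subseteq> A" "measure m (A - K) < 1 / real (Suc n)"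
      and L: "compact L" "L \<subseteq> - A" "measure m (- A - L) < 1 / real (Suc n)"
      using reg[OF A] reg[of "- A"] A by (metis sets.compl_sets space_m Compl_eq_Diff_UNIV)
    obtain f :: "'a \<Rightarrow> real" where f: "continuous_on UNIV f" "\<And>x. 0 \<le> f x \<and> f x \<le> 1"
      "\<And>x. x \<in> L \<Longrightarrow> f x = 0" "\<And>x. x \<in> K \<Longrightarrow> f x = 1"
      by (rule Urysohn_compact[of L K]) (use K L compact_imp_closed in auto)
    have s: "A - K \<in> sets m" "- A - L \<in> sets m"
      using A compact_imp_closed[OF K(1)] compact_imp_closed[OF L(1)] by auto
    have i: "integrable m (indicat_real (A - K))" "integrable m (indicat_real (- A - L))"
      using s by (auto intro!: integrable_real_indicator simp: emeasure_eq_measure)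
    have "(\<integral>x. norm (f x - indicator A x) \<partial>m) \<le> (\<integral>x. indicator (A - K) x + indicator (- A - L) x \<partial>m)"
    proof (rule integral_mono)
      show "integrable m (\<lambda>x. norm (f x - indicator A x))"
        using A by (intro integrable_norm Bochner_Integration.integrable_diff continuous_integrable f
            integrable_real_indicator) (auto simp: emeasure_eq_measure)
      show "norm (f x - indicator A x) \<le> indicator (A - K) x + indicator (- A - L) x" for x
        using f(2)[of x] f(3)[of x] f(4)[of x] by (auto simp: indicator_def)
    qed (use i in simp)
    also have "\<dots> = measure m (A - K) + measure m (- A - L)"
      using i by simp
    also have "\<dots> \<le> 2 / real (Suc n)"
      using K(3) L(3) by simp
    finally show ?thesis using f by blast
  qed
  then obtain f :: "nat \<Rightarrow> 'a \<Rightarrow> real" where f: "\<And>n. continuous_on UNIV (f n)"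
    "\<And>n x. 0 \<le> f n x \<and> f n x \<le> 1"
    "\<And>n. (\<integral>x. norm (f n x - indicator A x) \<partial>m) \<le> 2 / real (Suc n)"
    by metis
  have "\<exists>r. strict_mono r \<and> (AE x in m. (\<lambda>n. f (r n) x - indicator A x) \<longlonglongrightarrow> 0)"
  proof (rule tendsto_L1_AE_subseq)
    show "integrable m (\<lambda>x. f n x - indicator A x)" for n
      using A by (intro Bochner_Integration.integrable_diff continuous_integrable f
            integrable_real_indicator) (auto simp: emeasure_eq_measure)
    show "(\<lambda>n. \<integral>x. norm (f n x - indicator A x) \<partial>m) \<longlonglongrightarrow> 0"
    proof (rule tendsto_sandwich[OF _ _ tendsto_const])
      show "(\<lambda>n. 2 / real (Suc n)) \<longlonglongrightarrow> 0"
        using LIMSEQ_Suc[OF lim_const_over_n[of 2]] by simp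
    qed (use f(3) in auto)
  qed
  then obtain r where r: "strict_mono r" "AE x in m. (\<lambda>n. f (r n) x - indicator A x) \<longlonglongrightarrow> 0"
    by blast
  have "\<exists>g :: 'a \<Rightarrow> real. (\<lambda>x. complex_of_real (g x)) \<in> trig_polys \<and> (\<forall>x. \<bar>f (r n) x - g x\<bar> < 1 / real (Suc n))" for n
    using trig_polys_uniformly_dense[OF f(1), of "1 / real (Suc n)" "r n"] by (metis of_nat_0_less_iff zero_less_Suc zero_less_divide_1_iff)
  then obtain g :: "nat \<Rightarrow> 'a \<Rightarrow> real" where g: "\<And>n. (\<lambda>x. complex_of_real (g n x)) \<in> trig_polys"
    "\<And>n x. \<bar>f (r n) x - g n x\<bar> < 1 / real (Suc n)" by metis
  show ?thesis
  proof (rule that[of "\<lambda>n x. complex_of_real (g n x)"])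
    show "cmod (complex_of_real (g n x)) \<le> 2" for n x
    proof -
      have "1 / real (Suc n) \<le> 1" by simp
      then show ?thesis using g(2)[of n x] f(2)[of "r n" x] by (simp only: norm_of_real) linarith
    qed
    have d: "(\<lambda>n. f (r n) x - g n x) \<longlonglongrightarrow> 0" for x
    proof (rule Lim_null_comparison)
      show "\<forall>\<^sub>F n in sequentially. norm (f (r n) x - g n x) \<le> 1 / real (Suc n)"
        using g(2) by (auto intro!: always_eventually less_imp_le)
      show "(\<lambda>n. 1 / real (Suc n)) \<longlonglongrightarrow> 0"
        using LIMSEQ_Suc[OF lim_const_over_n[of 1]] by simp
    qed
    show "AE x in m. (\<lambda>n. complex_of_real (g n x)) \<longlonglongrightarrow> indicator A x"
      using r(2)
    proof eventually_elim
      case (elim x)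
      have "(\<lambda>n. (f (r n) x - indicator A x) - (f (r n) x - g n x) + indicator A x) \<longlonglongrightarrow> 0 - 0 + indicator A x"
        by (intro tendsto_intros elim d)
      then have "(\<lambda>n. g n x) \<longlonglongrightarrow> indicator A x" by simp
      then have "(\<lambda>n. complex_of_real (g n x)) \<longlonglongrightarrow> of_real (indicator A x)"
        by (rule tendsto_of_real)
      then show ?case by (cases "x \<in> A") simp_all
    qed
  qed (rule g)
qed

text \<open>
  A function with vanishing Fourier coefficients is orthogonal to all trigonometric
  polynomials, hence by bounded convergence to the indicators of all measurable sets.
\<close>

theorem fourier_unique:
  assumes u: "integrable m u" and 0: "\<And>\<xi>. \<xi> \<in> characters \<Longrightarrow> fourier m u \<xi> = 0"
  shows "AE x in m. u x = 0"
proof (rule density_zero[OF u])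
  fix A assume A: "A \<in> sets m"
  have orth: "(\<integral>x. u x * q x \<partial>m) = 0" if q: "q \<in> trig_polys" for q
  proof -
    obtain M c where f: "q = trig_poly M c" "finite M" "M \<subseteq> characters"
      using q by (auto simp: trig_polys_def)
    have "(\<integral>x. u x * q x \<partial>m) = (\<integral>x. (\<Sum>\<xi>\<in>M. c \<xi> * (u x * cnj (conj_fun \<xi> x))) \<partial>m)"
      by (simp add: f(1) trig_poly_def sum_distrib_left conj_fun_def mult_ac)
    also have "\<dots> = (\<Sum>\<xi>\<in>M. \<integral>x. c \<xi> * (u x * cnj (conj_fun \<xi> x)) \<partial>m)"
      using f u by (intro Bochner_Integration.integral_sum integrable_mult_right integrable_mult_cnj_char char_conj) auto
    also have "\<dots> = (\<Sum>\<xi>\<in>M. c \<xi> * fourier m u (conj_fun \<xi>))"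
      by (simp add: fourier_def)
    also have "\<dots> = 0"
      using f(3) 0 char_conj by (intro sum.neutral) auto
    finally show ?thesis .
  qed
  obtain q :: "nat \<Rightarrow> 'a \<Rightarrow> complex"
    where q: "\<And>n. q n \<in> trig_polys" "\<And>n x. cmod (q n x) \<le> 2"
    "AE x in m. (\<lambda>n. q n x) \<longlonglongrightarrow> indicator A x"
    using indicator_trig_approx[OF A] by blast
  have "(\<lambda>n. \<integral>x. u x * q n x \<partial>m) \<longlonglongrightarrow> (\<integral>x. u x * indicator A x \<partial>m)"
  proof (rule integral_dominated_convergence[where w = "\<lambda>x. 2 * cmod (u x)"])
    have [measurable]: "u \<in> borel_measurable m" using u by simp
    have [measurable]: "q n \<in> borel_measurable m" for n
      using q(1) by (intro continuous_measurable trig_polys_continuous)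
    show "(\<lambda>x. u x * indicator A x) \<in> borel_measurable m" using A by measurable
    show "(\<lambda>x. u x * q n x) \<in> borel_measurable m" for n by measurable
    show "integrable m (\<lambda>x. 2 * cmod (u x))" using u by simp
    show "AE x in m. (\<lambda>n. u x * q n x) \<longlonglongrightarrow> u x * indicator A x"
      using q(3) by eventually_elim (intro tendsto_intros)
    have "cmod (u x * q n x) \<le> 2 * cmod (u x)" for n x
      using mult_left_mono[OF q(2)[of n x], of "cmod (u x)"] by (simp add: norm_mult mult.commute)
    then show "AE x in m. cmod (u x * q n x) \<le> 2 * cmod (u x)" for n by simp
  qed
  then have "(\<integral>x. u x * indicator A x \<partial>m) = 0"
    using orth[OF q(1)] by (simp add: LIMSEQ_const_iff)
  moreover have "(\<lambda>x. indicator A x *\<^sub>R u x) = (\<lambda>x. u x * indicator A x)"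
    by (auto simp: indicator_def)
  ultimately show "set_lebesgue_integral m A u = 0"
    by (simp add: set_lebesgue_integral_def)
qed

end

section \<open>Moments\<close>

lemma powr_add_le:
  fixes a b p :: real
  assumes "a \<ge> 0" "b \<ge> 0" "p \<ge> 0"
  shows "(a + b) powr p \<le> 2 powr p * (a powr p + b powr p)"
proof -
  have "(a + b) powr p \<le> (2 * max a b) powr p"
    using assms by (intro powr_mono2) auto
  also have "\<dots> = 2 powr p * max a b powr p"
    by (rule powr_mult)
  also have "max a b powr p \<le> a powr p + b powr p"
    by (auto simp: max_def)
  finally show ?thesis by simp
qed

lemma powr_le_1_plus:
  fixes t p :: real
  assumes "t \<ge> 0" "p \<ge> 1"
  shows "t \<le> 1 + t powr p"
proof (cases "t \<le> 1")
  case True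
  then show ?thesis using powr_ge_zero[of t p] by linarith
next
  case False
  then have "t powr 1 \<le> t powr p" using assms by (intro powr_mono) auto
  then show ?thesis using assms False by simp
qed

context compact_haar
begin

definition moment :: "real \<Rightarrow> ('a \<Rightarrow> complex) \<Rightarrow> real" where
  "moment p f = (\<integral>x. cmod (f x) powr p \<partial>m)"

lemma moment_nonneg: "moment p f \<ge> 0"
  by (simp add: moment_def)

lemma Lp_measurable: "f \<in> Lp_space m p \<Longrightarrow> f \<in> borel_measurable m"
  by (simp add: Lp_space_def)

lemma Lp_integrable_powr: "f \<in> Lp_space m p \<Longrightarrow> integrable m (\<lambda>x. cmod (f x) powr p)"
  by (simp add: Lp_space_def)

lemma Lp_mono:
  assumes g: "g \<in> Lp_space m p" and f: "f \<in> borel_measurable m" and p: "p \<ge> 0"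
    and le: "\<And>x. cmod (f x) \<le> cmod (g x)"
  shows "f \<in> Lp_space m p" "moment p f \<le> moment p g"
proof -
  have le': "cmod (f x) powr p \<le> cmod (g x) powr p" for x
    using le p by (intro powr_mono2) auto
  have i: "integrable m (\<lambda>x. cmod (f x) powr p)"
    by (rule Bochner_Integration.integrable_bound[OF Lp_integrable_powr[OF g]]) (use f le' in auto)
  then show "f \<in> Lp_space m p" using f by (simp add: Lp_space_def)
  show "moment p f \<le> moment p g"
    unfolding moment_def using i Lp_integrable_powr[OF g] le' by (intro integral_mono)
qed

lemma Lp_add:
  assumes f: "f \<in> Lp_space m p" and g: "g \<in> Lp_space m p" and p: "p \<ge> 0"
  shows "(\<lambda>x. f x + g x) \<in> Lp_space m p"
    "moment p (\<lambda>x. f x + g x) \<le> 2 powr p * (moment p f + moment p g)"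
proof -
  have [measurable]: "f \<in> borel_measurable m" "g \<in> borel_measurable m"
    using f g by (auto simp: Lp_space_def)
  note i = Lp_integrable_powr[OF f] Lp_integrable_powr[OF g]
  have le: "cmod (f x + g x) powr p \<le> 2 powr p * (cmod (f x) powr p + cmod (g x) powr p)" for x
  proof -
    have "cmod (f x + g x) powr p \<le> (cmod (f x) + cmod (g x)) powr p"
      using p by (intro powr_mono2 norm_triangle_ineq) auto
    also have "\<dots> \<le> 2 powr p * (cmod (f x) powr p + cmod (g x) powr p)"
      using p by (intro powr_add_le) auto
    finally show ?thesis .
  qed
  have I: "integrable m (\<lambda>x. 2 powr p * (cmod (f x) powr p + cmod (g x) powr p))"
    using i by simp
  have i': "integrable m (\<lambda>x. cmod (f x + g x) powr p)"
    by (rule Bochner_Integration.integrable_bound[OF I]) (use le in \<open>auto intro!: order_trans[OF le]\<close>)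
  then show "(\<lambda>x. f x + g x) \<in> Lp_space m p"
    by (simp add: Lp_space_def)
  have "moment p (\<lambda>x. f x + g x) \<le> (\<integral>x. 2 powr p * (cmod (f x) powr p + cmod (g x) powr p) \<partial>m)"
    unfolding moment_def using i' I le by (intro integral_mono)
  then show "moment p (\<lambda>x. f x + g x) \<le> 2 powr p * (moment p f + moment p g)"
    using i by (simp add: moment_def)
qed

lemma Lp_scale:
  assumes f: "f \<in> Lp_space m p"
  shows "(\<lambda>x. a * f x) \<in> Lp_space m p" "moment p (\<lambda>x. a * f x) = cmod a powr p * moment p f"
proof -
  have [measurable]: "f \<in> borel_measurable m" using f by (simp add: Lp_space_def)
  show "(\<lambda>x. a * f x) \<in> Lp_space m p"
    using Lp_integrable_powr[OF f] by (simp add: Lp_space_def norm_mult powr_mult)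
  show "moment p (\<lambda>x. a * f x) = cmod a powr p * moment p f"
    by (simp add: moment_def norm_mult powr_mult)
qed

lemma Lp_diff:
  assumes f: "f \<in> Lp_space m p" and g: "g \<in> Lp_space m p" and p: "p \<ge> 0"
  shows "(\<lambda>x. f x - g x) \<in> Lp_space m p"
    "moment p (\<lambda>x. f x - g x) \<le> 2 powr p * (moment p f + moment p g)"
  using Lp_add[OF f Lp_scale(1)[OF g, of "-1"] p] Lp_scale(2)[OF g, of "-1"] by simp_all

lemma continuous_Lp:
  assumes "cont f" "p > 0"
  shows "f \<in> Lp_space m p"
proof -
  have "continuous_on UNIV (\<lambda>x. cmod (f x) powr p)"
    using assms by (intro continuous_on_powr' continuous_on_norm continuous_on_const) auto
  then show ?thesis
    using continuous_measurable[OF assms(1)] continuous_integrable by (simp add: Lp_space_def)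
qed

lemma trig_polys_Lp: "f \<in> trig_polys \<Longrightarrow> p > 0 \<Longrightarrow> f \<in> Lp_space m p"
  by (intro continuous_Lp trig_polys_continuous)

lemma moment_const [simp]: "moment p (\<lambda>_. c) = cmod c powr p"
  by (simp add: moment_def)

lemma Lp_integrable:
  assumes f: "f \<in> Lp_space m p" and p: "p \<ge> 1"
  shows "integrable m f"
proof (rule Bochner_Integration.integrable_bound)
  show "integrable m (\<lambda>x. 1 + cmod (f x) powr p)" using Lp_integrable_powr[OF f] by simp
  show "f \<in> borel_measurable m" by (rule Lp_measurable[OF f])
  have "norm (f x) \<le> norm (1 + cmod (f x) powr p)" for x
    using powr_le_1_plus[of "cmod (f x)" p] p by simp
  then show "AE x in m. norm (f x) \<le> norm (1 + cmod (f x) powr p)" by simp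
qed

text \<open>
  Young's inequality for the product of \<open>\<bar>f\<bar>\<close> and the constant \<open>a\<^sup>p\<^sup>-\<^sup>1\<close>, where \<open>a\<close> is the mean of \<open>\<bar>f\<bar>\<close>.
\<close>

lemma moment_Jensen:
  assumes f: "f \<in> Lp_space m p" and p: "p > 1"
  shows "(\<integral>x. cmod (f x) \<partial>m) powr p \<le> moment p f"
proof -
  define a where "a = (\<integral>x. cmod (f x) \<partial>m)"
  have "a \<ge> 0" by (simp add: a_def)
  define q where "q = p / (p - 1)"
  have q: "q > 1" "1 / p + 1 / q = 1" "(p - 1) * q = p"
    using p by (auto simp: q_def field_simps)
  have i: "integrable m (\<lambda>x. cmod (f x))"
    using Lp_integrable[OF f] p by simp
  have "a powr (p - 1) * a = (\<integral>x. cmod (f x) * a powr (p - 1) \<partial>m)"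
    by (simp add: a_def)
  also have "\<dots> \<le> (\<integral>x. cmod (f x) powr p / p + (a powr (p - 1)) powr q / q \<partial>m)"
  proof (rule integral_mono)
    show "cmod (f x) * a powr (p - 1) \<le> cmod (f x) powr p / p + (a powr (p - 1)) powr q / q" for x
      using p q by (intro Youngs_inequality) auto
  qed (use i Lp_integrable_powr[OF f] in auto)
  also have "\<dots> = moment p f / p + a powr p / q"
    using Lp_integrable_powr[OF f] q(3) by (simp add: moment_def powr_powr)
  also have "a powr (p - 1) * a = a powr p"
    using \<open>a \<ge> 0\<close> p by (cases "a = 0") (auto simp: powr_mult_base mult.commute)
  also have "a powr p / q = a powr p - a powr p / p"
  proof -
    have "1 / q = 1 - 1 / p" using q(2) by simp
    then have "a powr p * (1 / q) = a powr p * (1 - 1 / p)" by simp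
    then show ?thesis by (simp add: algebra_simps)
  qed
  finally show ?thesis
    using p by (simp add: a_def field_simps)
qed

lemma norm_fourier_powr_le:
  assumes "f \<in> Lp_space m p" "p > 1" "\<xi> \<in> characters"
  shows "cmod (fourier m f \<xi>) powr p \<le> moment p f"
  using powr_mono2[OF _ _ norm_fourier_le[OF assms(3), of f], of p] moment_Jensen[OF assms(1,2)] assms(2)
  by simp

end

section \<open>The conjugate function inequality\<close>

text \<open>
  At \<open>\<phi> = \<plusminus> pi / 2\<close> the term with \<open>A\<close> vanishes, but \<open>cos (p * \<phi>)\<close> is negative there because
  \<open>pi / 2 < p * pi / 2 \<le> pi\<close>. So a large \<open>B\<close> takes care of a neighbourhood of these points, and
  then a large \<open>A\<close> of the rest of the interval.
\<close>

lemma sin_powr_le: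
  fixes p :: real
  assumes p: "1 < p" "p \<le> 2"
  obtains A B :: real where "A \<ge> 0" "B \<ge> 0"
    "\<And>\<phi>. \<bar>\<phi>\<bar> < pi / 2 \<Longrightarrow> \<bar>sin \<phi>\<bar> powr p \<le> A * cos \<phi> powr p - B * cos (p * \<phi>)"
proof -
  (* p * \<delta> is the midpoint of pi / 2 and p * pi / 2. *)
  define \<delta> where "\<delta> = pi * (1 + p) / (4 * p)"
  have p\<delta>: "p * \<delta> = pi * (1 + p) / 4" using p by (simp add: \<delta>_def)
  have "\<delta> > 0" using p by (simp add: \<delta>_def)
  have "pi * (1 + p) < pi * (2 * p)" using p by (intro mult_strict_left_mono) auto
  then have "\<delta> < pi / 2" using p by (simp add: \<delta>_def field_simps)
  have "pi * (1 + p) > pi * 2" "pi * (1 + p) \<le> pi * 3"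
    using p by (intro mult_strict_left_mono mult_left_mono; simp)+
  then have r: "p * \<delta> > pi / 2" "p * \<delta> \<le> pi" unfolding p\<delta> using pi_gt_zero by linarith+
  define \<gamma> where "\<gamma> = - cos (p * \<delta>)"
  have "cos (p * \<delta>) < cos (pi / 2)"
    using r by (intro cos_monotone_0_pi) auto
  then have \<gamma>: "\<gamma> > 0" by (simp add: \<gamma>_def)
  have cd: "cos \<delta> > 0" using \<open>\<delta> > 0\<close> \<open>\<delta> < pi / 2\<close> by (intro cos_gt_zero_pi) auto
  define B where "B = 1 / \<gamma>"
  define A where "A = (1 + B) / cos \<delta> powr p"
  have B: "B \<ge> 0" using \<gamma> by (simp add: B_def)
  have A: "A \<ge> 0" using B by (simp add: A_def)
  have main: "1 \<le> A * cos \<phi> powr p - B * cos (p * \<phi>)" if \<phi>: "0 \<le> \<phi>" "\<phi> < pi / 2" for \<phi>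
  proof (cases "\<phi> \<ge> \<delta>")
    case True
    have "p * \<delta> \<le> p * \<phi>" "p * \<phi> \<le> 2 * (pi / 2)"
      using True p \<phi> by (intro mult_left_mono mult_mono; simp)+
    then have "cos (p * \<phi>) \<le> cos (p * \<delta>)"
      using r pi_gt_zero by (intro cos_monotone_0_pi_le) auto
    then have "B * cos (p * \<phi>) \<le> B * (- \<gamma>)"
      using B by (intro mult_left_mono) (auto simp: \<gamma>_def)
    also have "\<dots> = -1" using \<gamma> by (simp add: B_def)
    moreover have "0 \<le> A * cos \<phi> powr p" using A by simp
    ultimately show ?thesis by linarith
  next
    case False
    have "cos \<delta> \<le> cos \<phi>"
      using False \<phi> \<open>\<delta> < pi / 2\<close> by (intro cos_monotone_0_pi_le) auto
    then have "A * cos \<delta> powr p \<le> A * cos \<phi> powr p"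
      using A cd p by (intro mult_left_mono powr_mono2) auto
    moreover have "A * cos \<delta> powr p = 1 + B" using cd by (simp add: A_def)
    moreover have "B * cos (p * \<phi>) \<le> B * 1" using B by (intro mult_left_mono) auto
    ultimately show ?thesis by linarith
  qed
  have "\<bar>sin \<phi>\<bar> powr p \<le> A * cos \<phi> powr p - B * cos (p * \<phi>)" if "\<bar>\<phi>\<bar> < pi / 2" for \<phi>
  proof -
    have "\<bar>sin \<phi>\<bar> powr p \<le> 1 powr p"
      using p by (intro powr_mono2) auto
    also have "\<dots> \<le> A * cos \<bar>\<phi>\<bar> powr p - B * cos (p * \<bar>\<phi>\<bar>)"
      using main[of "\<bar>\<phi>\<bar>"] that by simp
    also have "p * \<bar>\<phi>\<bar> = \<bar>p * \<phi>\<bar>" using p by (simp add: abs_mult)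
    finally show ?thesis by simp
  qed
  then show ?thesis using that A B by blast
qed

text \<open>
  The inequality \<open>sin_powr_le\<close> in polar coordinates: both sides are homogeneous of degree \<open>p\<close>.
\<close>

lemma abs_Im_powr_le:
  fixes p :: real
  assumes p: "1 < p" "p \<le> 2"
  obtains A B :: real where "A \<ge> 0" "B \<ge> 0"
    "\<And>w. Re w > 0 \<Longrightarrow> \<bar>Im w\<bar> powr p \<le> A * Re w powr p - B * Re (w powr of_real p)"
proof -
  obtain A B :: real where AB: "A \<ge> 0" "B \<ge> 0"
    "\<And>\<phi>. \<bar>\<phi>\<bar> < pi / 2 \<Longrightarrow> \<bar>sin \<phi>\<bar> powr p \<le> A * cos \<phi> powr p - B * cos (p * \<phi>)"
    using sin_powr_le[OF p] by blast
  show ?thesis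
  proof (rule that[OF AB(1,2)])
    fix w :: complex assume w: "Re w > 0"
    then have w0: "w \<noteq> 0" by auto
    define r \<phi> where "r = cmod w" and "\<phi> = Arg w"
    have r: "r > 0" using w0 by (simp add: r_def)
    have \<phi>: "\<bar>\<phi>\<bar> < pi / 2" unfolding \<phi>_def using Arg_Re_pos w by blast
    have ReIm: "Re w = r * cos \<phi>" "Im w = r * sin \<phi>"
      using rcis_cmod_Arg[of w] unfolding r_def \<phi>_def by (metis Re_rcis, metis Im_rcis)
    have cos: "cos \<phi> > 0" using \<phi> by (intro cos_gt_zero_pi) auto
    have "w powr of_real p = exp (of_real p * Ln w)"
      using w0 by (simp add: powr_def)
    then have "Re (w powr of_real p) = exp (p * ln r) * cos (p * \<phi>)"
      using w0 by (simp add: Re_exp Arg_eq_Im_Ln r_def \<phi>_def)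
    also have "exp (p * ln r) = r powr p" using r by (simp add: powr_def)
    finally have Re_powr: "Re (w powr of_real p) = r powr p * cos (p * \<phi>)" .
    have "\<bar>Im w\<bar> powr p = r powr p * \<bar>sin \<phi>\<bar> powr p"
      using r by (simp add: ReIm abs_mult powr_mult)
    also have "\<dots> \<le> r powr p * (A * cos \<phi> powr p - B * cos (p * \<phi>))"
      using AB(3)[OF \<phi>] by (intro mult_left_mono) auto
    also have "\<dots> = A * Re w powr p - B * Re (w powr of_real p)"
      unfolding Re_powr ReIm by (simp add: powr_mult algebra_simps)
    finally show "\<bar>Im w\<bar> powr p \<le> A * Re w powr p - B * Re (w powr of_real p)" .
  qed
qed

section \<open>The Riesz projection on trigonometric polynomials\<close>

locale ordered_haar = compact_haar m
  for m :: "'a::{topological_ab_group_add, t2_space} measure" +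
  fixes T :: "('a \<Rightarrow> complex) set"
  assumes cone: "positive_cone T" and linear: "linearly_ordered_by T"
begin

lemma T_char: "\<xi> \<in> T \<Longrightarrow> \<xi> \<in> characters"
  using cone by (auto simp: positive_cone_def)

lemma T_one: "(\<lambda>_. 1) \<in> T"
  using cone by (simp add: positive_cone_def)

lemma T_mult: "\<xi> \<in> T \<Longrightarrow> \<psi> \<in> T \<Longrightarrow> char_mult \<xi> \<psi> \<in> T"
  using cone by (simp add: positive_cone_def)

lemma T_antisym: "\<xi> \<in> T \<Longrightarrow> conj_fun \<xi> \<in> T \<Longrightarrow> \<xi> = (\<lambda>_. 1)"
proof -
  assume "\<xi> \<in> T" "conj_fun \<xi> \<in> T"
  then have "\<xi> \<in> T \<inter> conj_fun ` T"
    by (auto simp: image_iff intro!: bexI[of _ "conj_fun \<xi>"])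
  then show ?thesis using cone by (auto simp: positive_cone_def)
qed

lemma T_total:
  assumes "\<xi> \<in> characters"
  shows "\<xi> \<in> T \<or> conj_fun \<xi> \<in> T"
proof -
  have "\<xi> \<in> T \<union> conj_fun ` T"
    using assms linear by (simp add: linearly_ordered_by_def)
  then show ?thesis by auto
qed

definition analytic_polys :: "('a \<Rightarrow> complex) set" where
  "analytic_polys = {f \<in> trig_polys. spectrum f \<subseteq> T}"

definition riesz_poly :: "('a \<Rightarrow> complex) \<Rightarrow> 'a \<Rightarrow> complex" where
  "riesz_poly f = trig_poly (spectrum f \<inter> T) (fourier m f)"

lemma analytic_iff:
  "f \<in> analytic_polys \<longleftrightarrow> f \<in> trig_polys \<and> (\<forall>\<xi>\<in>characters - T. fourier m f \<xi> = 0)"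
  by (auto simp: analytic_polys_def spectrum_def)

lemma analytic_trig: "f \<in> analytic_polys \<Longrightarrow> f \<in> trig_polys"
  by (simp add: analytic_polys_def)

lemma analytic_add: "f \<in> analytic_polys \<Longrightarrow> g \<in> analytic_polys \<Longrightarrow> (\<lambda>x. f x + g x) \<in> analytic_polys"
  by (auto simp: analytic_iff trig_polys_add fourier_add trig_polys_integrable)

lemma analytic_scale: "f \<in> analytic_polys \<Longrightarrow> (\<lambda>x. a * f x) \<in> analytic_polys"
  by (auto simp: analytic_iff trig_polys_scale fourier_scale)

lemma analytic_char: "\<xi> \<in> T \<Longrightarrow> \<xi> \<in> analytic_polys"
  using trig_polys_scaled_char[of \<xi> 1] by (auto simp: analytic_iff T_char fourier_char)

lemma analytic_const: "(\<lambda>_. c) \<in> analytic_polys"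
  using analytic_scale[OF analytic_char[OF T_one], of c] by simp

lemma analytic_sum:
  "finite I \<Longrightarrow> (\<And>i. i \<in> I \<Longrightarrow> f i \<in> analytic_polys) \<Longrightarrow> (\<lambda>x. \<Sum>i\<in>I. f i x) \<in> analytic_polys"
  by (induction I rule: finite_induct) (simp_all add: analytic_add analytic_const)

lemma analytic_expand:
  assumes "f \<in> analytic_polys"
  obtains M where "finite M" "M \<subseteq> T" "f = (\<lambda>x. \<Sum>\<xi>\<in>M. fourier m f \<xi> * \<xi> x)" "(\<lambda>_. 1) \<in> M"
proof -
  let ?M = "insert (\<lambda>_. 1) (spectrum f)"
  have f: "f \<in> trig_polys" "spectrum f \<subseteq> T" using assms by (auto simp: analytic_polys_def)
  have M: "finite ?M" "?M \<subseteq> T" using finite_spectrum[OF f(1)] f(2) T_one by auto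
  have "?M \<subseteq> characters" using M(2) T_char by blast
  then have "f = trig_poly ?M (fourier m f)"
    using trig_polys_expand[OF f(1) M(1)] by blast
  then show ?thesis using that M unfolding trig_poly_def by blast
qed

lemma mean_eq_fourier: "(\<integral>x. f x \<partial>m) = fourier m f (\<lambda>_. 1)"
  by (simp add: fourier_def)

text \<open>
  The mean of \<open>\<xi> g\<close> is the Fourier coefficient of \<open>g\<close> at the conjugate of \<open>\<xi>\<close>, which is outside \<open>T\<close>
  unless \<open>\<xi>\<close> is the unit character, because \<open>T \<inter> T\<^sup>-\<^sup>1 = {1}\<close>.
\<close>

lemma analytic_mult:
  assumes f: "f \<in> analytic_polys" and g: "g \<in> analytic_polys"
  shows "(\<lambda>x. f x * g x) \<in> analytic_polys"
    "(\<integral>x. f x * g x \<partial>m) = (\<integral>x. f x \<partial>m) * (\<integral>x. g x \<partial>m)"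
proof -
  obtain M where M: "finite M" "M \<subseteq> T" "f = (\<lambda>x. \<Sum>\<xi>\<in>M. fourier m f \<xi> * \<xi> x)" "(\<lambda>_. 1) \<in> M"
    by (rule analytic_expand[OF f])
  obtain N where N: "finite N" "N \<subseteq> T" "g = (\<lambda>x. \<Sum>\<xi>\<in>N. fourier m g \<xi> * \<xi> x)"
    by (rule analytic_expand[OF g])
  have char_g: "(\<lambda>x. \<xi> x * g x) \<in> analytic_polys" if \<xi>: "\<xi> \<in> T" for \<xi>
  proof -
    have "(\<lambda>x. \<xi> x * g x) = (\<lambda>x. \<Sum>\<psi>\<in>N. fourier m g \<psi> * char_mult \<xi> \<psi> x)"
      by (subst N(3)) (simp add: sum_distrib_left char_mult_def mult_ac)
    also have "\<dots> \<in> analytic_polys"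
      using N \<xi> by (intro analytic_sum analytic_scale analytic_char T_mult) auto
    finally show ?thesis .
  qed
  have fg: "(\<lambda>x. f x * g x) = (\<lambda>x. \<Sum>\<xi>\<in>M. fourier m f \<xi> * (\<xi> x * g x))"
    by (subst M(3)) (simp add: sum_distrib_right mult.assoc)
  also have "\<dots> \<in> analytic_polys"
    using M(1,2) by (intro analytic_sum analytic_scale char_g) auto
  finally show "(\<lambda>x. f x * g x) \<in> analytic_polys" .
  have mean: "(\<integral>x. \<xi> x * g x \<partial>m) = (if \<xi> = (\<lambda>_. 1) then \<integral>x. g x \<partial>m else 0)" if \<xi>: "\<xi> \<in> T" for \<xi>
  proof (cases "\<xi> = (\<lambda>_. 1)")
    case False
    then have "conj_fun \<xi> \<in> characters - T"
      using T_antisym \<xi> T_char char_conj by blast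
    then have "fourier m g (conj_fun \<xi>) = 0" using g by (auto simp: analytic_iff)
    then show ?thesis using False by (simp add: fourier_def conj_fun_def mult.commute)
  qed simp
  have "(\<integral>x. f x * g x \<partial>m) = (\<Sum>\<xi>\<in>M. \<integral>x. fourier m f \<xi> * (\<xi> x * g x) \<partial>m)"
    unfolding fg using M(2) by (intro Bochner_Integration.integral_sum trig_polys_integrable
        analytic_trig analytic_scale char_g) auto
  also have "\<dots> = (\<Sum>\<xi>\<in>M. if \<xi> = (\<lambda>_. 1) then fourier m f \<xi> * (\<integral>x. g x \<partial>m) else 0)"
    using M(2) by (intro sum.cong refl) (auto simp: mean)
  also have "\<dots> = (\<integral>x. f x \<partial>m) * (\<integral>x. g x \<partial>m)"
    using M(1,4) by (simp add: mean_eq_fourier)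
  finally show "(\<integral>x. f x * g x \<partial>m) = (\<integral>x. f x \<partial>m) * (\<integral>x. g x \<partial>m)" .
qed

lemma analytic_power:
  assumes "f \<in> analytic_polys"
  shows "(\<lambda>x. f x ^ n) \<in> analytic_polys \<and> (\<integral>x. f x ^ n \<partial>m) = (\<integral>x. f x \<partial>m) ^ n"
  by (induction n) (auto simp: analytic_const analytic_mult[OF assms])

text \<open>
  The binomial series of \<open>(1 + u)\<^sup>a\<close> converges uniformly, and the mean value is multiplicative on
  each of its terms.
\<close>

lemma analytic_powr_mean:
  fixes a :: complex
  assumes u: "u \<in> analytic_polys" and \<rho>: "\<rho> < 1" "\<And>x. cmod (u x) \<le> \<rho>"
  shows "integrable m (\<lambda>x. (1 + u x) powr a)"
    "(\<integral>x. (1 + u x) powr a \<partial>m) = (1 + (\<integral>x. u x \<partial>m)) powr a"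
proof -
  have \<rho>0: "0 \<le> \<rho>" using \<rho>(2)[of 0] norm_ge_zero order_trans by blast
  define t where "t = (1 + \<rho>) / 2"
  have t: "\<rho> < t" "t < 1" "0 < t" using \<rho> \<rho>0 by (auto simp: t_def)
  have "summable (\<lambda>n. (a gchoose n) * complex_of_real t ^ n)"
    using gen_binomial_complex[of "of_real t" a] t by (simp add: sums_iff)
  from powser_insidea[OF this, of "of_real \<rho>"] t \<rho>0
  have sm: "summable (\<lambda>n. cmod (a gchoose n) * \<rho> ^ n)"
    by (simp add: norm_mult norm_power)
  have int: "integrable m (\<lambda>x. (a gchoose n) * u x ^ n)" for n
    using analytic_power[OF u, of n] by (intro trig_polys_integrable analytic_trig analytic_scale) simp
  have le: "cmod ((a gchoose n) * u x ^ n) \<le> cmod (a gchoose n) * \<rho> ^ n" for n x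
    unfolding norm_mult norm_power by (intro mult_left_mono power_mono \<rho>) auto
  have s1: "AE x in m. summable (\<lambda>n. norm ((a gchoose n) * u x ^ n))"
  proof (rule AE_I2)
    fix x
    show "summable (\<lambda>n. norm ((a gchoose n) * u x ^ n))"
      by (rule summable_comparison_test'[OF sm, of 0]) (simp only: real_norm_def abs_norm_cancel le)
  qed
  have s2: "summable (\<lambda>n. \<integral>x. norm ((a gchoose n) * u x ^ n) \<partial>m)"
  proof (rule summable_comparison_test'[OF sm, of 0])
    fix n :: nat
    have "(\<integral>x. norm ((a gchoose n) * u x ^ n) \<partial>m) \<le> (\<integral>x. cmod (a gchoose n) * \<rho> ^ n \<partial>m)"
      using le int by (intro integral_mono) auto
    then show "norm (\<integral>x. norm ((a gchoose n) * u x ^ n) \<partial>m) \<le> cmod (a gchoose n) * \<rho> ^ n"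
      by simp
  qed
  have bin: "(\<Sum>n. (a gchoose n) * u x ^ n) = (1 + u x) powr a" for x
    using gen_binomial_complex[of "u x" a] \<rho>(1) \<rho>(2)[of x] by (simp add: sums_iff)
  show "integrable m (\<lambda>x. (1 + u x) powr a)"
    using integrable_suminf[OF int s1 s2] by (simp only: bin)
  have "(\<lambda>n. \<integral>x. (a gchoose n) * u x ^ n \<partial>m) sums (\<integral>x. (1 + u x) powr a \<partial>m)"
    using sums_integral[OF int s1 s2] by (simp only: bin)
  then have "(\<lambda>n. (a gchoose n) * (\<integral>x. u x \<partial>m) ^ n) sums (\<integral>x. (1 + u x) powr a \<partial>m)"
    using analytic_power[OF u] by simp
  moreover have "cmod (\<integral>x. u x \<partial>m) \<le> \<rho>"
  proof -
    have "cmod (\<integral>x. u x \<partial>m) \<le> (\<integral>x. cmod (u x) \<partial>m)" by (rule integral_norm_bound)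
    also have "\<dots> \<le> (\<integral>x. \<rho> \<partial>m)"
      using u by (intro integral_mono \<rho> integrable_norm trig_polys_integrable analytic_trig) auto
    finally show ?thesis by simp
  qed
  then have "(\<lambda>n. (a gchoose n) * (\<integral>x. u x \<partial>m) ^ n) sums (1 + (\<integral>x. u x \<partial>m)) powr a"
    using \<rho>(1) by (intro gen_binomial_complex) auto
  ultimately show "(\<integral>x. (1 + u x) powr a \<partial>m) = (1 + (\<integral>x. u x \<partial>m)) powr a"
    by (rule sums_unique2)
qed

lemma riesz_poly_trig:
  assumes "f \<in> trig_polys" shows "riesz_poly f \<in> trig_polys"
  unfolding riesz_poly_def using finite_spectrum[OF assms] by (intro trig_poly_in) (auto simp: spectrum_def)

lemma fourier_riesz_poly:
  assumes "f \<in> trig_polys" "\<xi> \<in> characters"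
  shows "fourier m (riesz_poly f) \<xi> = (if \<xi> \<in> T then fourier m f \<xi> else 0)"
  unfolding riesz_poly_def using finite_spectrum[OF assms(1)] assms(2)
  by (subst fourier_trig_poly) (auto simp: spectrum_def)

lemma riesz_poly_analytic: "f \<in> trig_polys \<Longrightarrow> riesz_poly f \<in> analytic_polys"
  by (auto simp: analytic_iff riesz_poly_trig fourier_riesz_poly)

lemma riesz_poly_id: "f \<in> analytic_polys \<Longrightarrow> riesz_poly f = f"
  by (rule trig_polys_eqI) (auto simp: riesz_poly_trig fourier_riesz_poly analytic_iff)

lemma riesz_poly_add:
  assumes "f \<in> trig_polys" "g \<in> trig_polys"
  shows "riesz_poly (\<lambda>x. f x + g x) = (\<lambda>x. riesz_poly f x + riesz_poly g x)"
  using assms by (intro trig_polys_eqI)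
    (auto simp: riesz_poly_trig trig_polys_add fourier_riesz_poly fourier_add trig_polys_integrable)

lemma riesz_poly_scale:
  assumes "f \<in> trig_polys"
  shows "riesz_poly (\<lambda>x. a * f x) = (\<lambda>x. a * riesz_poly f x)"
  using assms by (intro trig_polys_eqI)
    (auto simp: riesz_poly_trig trig_polys_scale fourier_riesz_poly fourier_scale)

lemma riesz_poly_diff:
  assumes "f \<in> trig_polys" "g \<in> trig_polys"
  shows "riesz_poly (\<lambda>x. f x - g x) = (\<lambda>x. riesz_poly f x - riesz_poly g x)"
  using assms by (intro trig_polys_eqI)
    (auto simp: riesz_poly_trig trig_polys_diff fourier_riesz_poly fourier_diff trig_polys_integrable)

text \<open>
  For real \<open>f\<close> the conjugate of \<open>riesz_poly f\<close> is the part of \<open>f\<close> with spectrum in \<open>T\<^sup>-\<^sup>1\<close>; since the order is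
  linear, the two parts together give \<open>f\<close>, with the mean counted twice.
\<close>

lemma riesz_poly_real:
  assumes f: "f \<in> trig_polys" and real: "\<And>x. cnj (f x) = f x"
  shows "Re (f x) = 2 * Re (riesz_poly f x) - Re (\<integral>x. f x \<partial>m)" "Im (\<integral>x. f x \<partial>m) = 0"
proof -
  define c where "c = (\<integral>x. f x \<partial>m)"
  have "(\<integral>x. cnj (f x) \<partial>m) = (\<integral>x. f x \<partial>m)" by (simp only: real)
  then have "cnj c = c" unfolding c_def Bochner_Integration.integral_cnj .
  then show "Im (\<integral>x. f x \<partial>m) = 0" unfolding c_def by (simp add: complex_eq_iff)
  have cf: "fourier m f (\<lambda>_. 1) = c" by (simp add: c_def mean_eq_fourier)
  let ?h = "\<lambda>x. riesz_poly f x + cnj (riesz_poly f x)"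
  have ht: "?h \<in> trig_polys" by (intro trig_polys_add trig_polys_cnj riesz_poly_trig f)
  have "?h = (\<lambda>x. f x + c)"
  proof (rule trig_polys_eqI[OF ht trig_polys_add[OF f trig_polys_const]])
    fix \<xi> :: "'a \<Rightarrow> complex" assume \<xi>: "\<xi> \<in> characters"
    have sym: "cnj (fourier m f (conj_fun \<xi>)) = fourier m f \<xi>"
      using fourier_cnj[of f \<xi>] by (simp add: real)
    have "fourier m ?h \<xi> = fourier m (riesz_poly f) \<xi> + cnj (fourier m (riesz_poly f) (conj_fun \<xi>))"
      using \<xi> f by (simp add: fourier_add trig_polys_integrable riesz_poly_trig trig_polys_cnj fourier_cnj)
    also have "\<dots> = (if \<xi> \<in> T then fourier m f \<xi> else 0) + (if conj_fun \<xi> \<in> T then fourier m f \<xi> else 0)"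
      using \<xi> f by (simp add: fourier_riesz_poly char_conj sym)
    also have "\<dots> = fourier m f \<xi> + (if \<xi> = (\<lambda>_. 1) then c else 0)"
    proof (cases "\<xi> = (\<lambda>_. 1)")
      case True
      then show ?thesis using T_one cf by (simp add: conj_fun_def)
    next
      case False
      then have "\<xi> \<in> T \<longleftrightarrow> conj_fun \<xi> \<notin> T"
        using T_total[OF \<xi>] T_antisym[of \<xi>] by blast
      then show ?thesis using False by simp
    qed
    also have "\<dots> = fourier m (\<lambda>x. f x + c) \<xi>"
      using \<xi> f by (simp add: fourier_add trig_polys_integrable trig_polys_const fourier_const)
    finally show "fourier m ?h \<xi> = fourier m (\<lambda>x. f x + c) \<xi>" .
  qed
  from fun_cong[OF this, of x] have "Re (?h x) = Re (f x + c)" by (rule arg_cong)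
  then show "Re (f x) = 2 * Re (riesz_poly f x) - Re (\<integral>x. f x \<partial>m)"
    by (simp add: c_def)
qed

lemma mean_riesz_poly: "f \<in> trig_polys \<Longrightarrow> (\<integral>x. riesz_poly f x \<partial>m) = (\<integral>x. f x \<partial>m)"
  unfolding mean_eq_fourier by (simp add: fourier_riesz_poly char_one T_one)

definition riesz_bound :: "real \<Rightarrow> real \<Rightarrow> bool" where
  "riesz_bound p C \<longleftrightarrow> (\<forall>f\<in>trig_polys. moment p (riesz_poly f) \<le> C * moment p f)"

text \<open>
  The polynomial \<open>F\<close> is analytic with real part \<open>f\<close>. To define \<open>F\<^sup>p\<close> as a limit of analytic polynomials,
  \<open>F\<close> is scaled by a large \<open>R\<close> so that \<open>F / R\<close> has its values in a disc about 1 of radius less than 1;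
  then \<open>analytic_powr_mean\<close> applies to \<open>u = F / R - 1\<close>.
\<close>

lemma riesz_bound_positive:
  assumes p: "1 < p" "p \<le> 2"
  shows "\<exists>C\<ge>0. \<forall>f\<in>trig_polys. \<forall>\<epsilon>>0. (\<forall>x. cnj (f x) = f x) \<longrightarrow> (\<forall>x. Re (f x) \<ge> \<epsilon>) \<longrightarrow>
     moment p (riesz_poly f) \<le> C * moment p f"
proof -
  obtain A B :: real where AB: "A \<ge> 0" "B \<ge> 0"
    "\<And>w. Re w > 0 \<Longrightarrow> \<bar>Im w\<bar> powr p \<le> A * Re w powr p - B * Re (w powr of_real p)"
    using abs_Im_powr_le[OF p] by blast
  define C where "C = 2 powr p * (2 powr p * (1 + A) + 1)"
  show ?thesis
  proof (intro exI[of _ C] conjI ballI allI impI)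
    show "C \<ge> 0" using AB by (simp add: C_def)
    fix f :: "'a \<Rightarrow> complex" and \<epsilon> :: real
    assume f: "f \<in> trig_polys" and \<epsilon>: "\<epsilon> > 0"
      and "\<forall>x. cnj (f x) = f x" "\<forall>x. Re (f x) \<ge> \<epsilon>"
    then have real: "\<And>x. cnj (f x) = f x" and pos: "\<And>x. Re (f x) \<ge> \<epsilon>" by auto
    define c where "c = (\<integral>x. f x \<partial>m)"
    define F where "F x = 2 * riesz_poly f x + (- c)" for x
    have F: "F \<in> analytic_polys"
      unfolding F_def by (intro analytic_add analytic_scale analytic_const riesz_poly_analytic f)
    have Ft: "F \<in> trig_polys" by (rule analytic_trig[OF F])
    have ReF: "Re (F x) = Re (f x)" for x
      using riesz_poly_real(1)[OF f real, of x] by (simp add: F_def c_def)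
    have meanF: "(\<integral>x. F x \<partial>m) = c"
      unfolding F_def using mean_riesz_poly[OF f] trig_polys_integrable[OF riesz_poly_trig[OF f]]
      by (simp add: c_def)
    have Imc: "Im c = 0" using riesz_poly_real(2)[OF f real] by (simp add: c_def)
    have normf: "cmod (f x) = Re (f x)" for x
    proof -
      have "Im (f x) = 0" using real[of x] by (simp add: complex_eq_iff)
      then show ?thesis using pos[of x] \<epsilon> by (simp add: cmod_def)
    qed
    have Rec: "Re c \<ge> \<epsilon>"
    proof -
      have "(\<integral>x. \<epsilon> \<partial>m) \<le> (\<integral>x. Re (f x) \<partial>m)"
        using trig_polys_integrable[OF f] pos by (intro integral_mono) auto
      then show ?thesis using trig_polys_integrable[OF f] by (simp add: c_def)
    qed
    obtain K where K: "K > 0" "\<And>x. cmod (F x) \<le> K"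
      using continuous_bounded[OF trig_polys_continuous[OF Ft]] by blast
    (* The values of F lie in the half plane Re w \<ge> \<epsilon>, in a disc about 0, and hence in the
       disc of radius R * sqrt (1 - \<epsilon> / R) about the point R. *)
    define R where "R = K\<^sup>2 / \<epsilon> + 2 * \<epsilon>"
    have R: "R > 0" "R > \<epsilon>" using K \<epsilon> by (auto simp: R_def intro!: add_nonneg_pos add_pos_pos divide_pos_pos zero_less_power)
    have KR: "K\<^sup>2 \<le> \<epsilon> * R" using \<epsilon> by (simp add: R_def field_simps)
    define \<rho> where "\<rho> = sqrt (1 - \<epsilon> / R)"
    have \<rho>: "\<rho> < 1" using R \<epsilon> by (simp add: \<rho>_def)
    define u where "u x = of_real (1 / R) * F x + (-1)" for x
    have u: "u \<in> analytic_polys"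
      unfolding u_def by (intro analytic_add analytic_scale analytic_const F)
    have u_le: "cmod (u x) \<le> \<rho>" for x
    proof -
      have "(cmod (F x - of_real R))\<^sup>2 = (cmod (F x))\<^sup>2 - 2 * R * Re (F x) + R\<^sup>2"
        by (simp add: cmod_power2) (simp add: power2_eq_square algebra_simps)
      also have "\<dots> \<le> \<epsilon> * R - 2 * R * \<epsilon> + R\<^sup>2"
      proof -
        have "(cmod (F x))\<^sup>2 \<le> K\<^sup>2" using K by (intro power_mono) auto
        moreover have "2 * R * \<epsilon> \<le> 2 * R * Re (F x)" using pos[of x] R ReF by (intro mult_left_mono) auto
        ultimately show ?thesis using KR by linarith
      qed
      also have "\<dots> = R\<^sup>2 * (1 - \<epsilon> / R)" using R by (simp add: power2_eq_square field_simps)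
      finally have "(cmod (F x - of_real R))\<^sup>2 \<le> R\<^sup>2 * (1 - \<epsilon> / R)" .
      moreover have "u x = (F x - of_real R) / of_real R" using R by (simp add: u_def field_simps)
      ultimately have "(cmod (u x))\<^sup>2 \<le> 1 - \<epsilon> / R"
        using R by (simp add: norm_divide power_divide divide_le_eq mult.commute)
      then show ?thesis unfolding \<rho>_def by (intro real_le_rsqrt)
    qed
    note up = analytic_powr_mean[OF u \<rho> u_le, of "of_real p"]
    have u1: "1 + u x = of_real (1 / R) * F x" for x by (simp add: u_def)
    have meanu: "1 + (\<integral>x. u x \<partial>m) = of_real (1 / R) * c"
      unfolding u_def using meanF trig_polys_integrable[OF Ft] by simp
    have scale: "\<bar>Im (F x)\<bar> powr p / R powr p \<le> A * (Re (f x) powr p / R powr p) - B * Re ((1 + u x) powr of_real p)" for x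
    proof -
      have "Re (1 + u x) > 0" unfolding u1 using pos[of x] \<epsilon> R ReF[of x] by simp
      from AB(3)[OF this] show ?thesis
        unfolding u1 using R pos[of x] \<epsilon> by (simp add: ReF abs_mult powr_divide abs_divide)
    qed
    have iIm: "integrable m (\<lambda>x. \<bar>Im (F x)\<bar> powr p)"
      using p trig_polys_continuous[OF Ft]
      by (intro continuous_integrable continuous_on_powr' continuous_on_rabs continuous_on_Im continuous_on_const) auto
    have iRe: "integrable m (\<lambda>x. Re (f x) powr p)"
      using Lp_integrable_powr[OF trig_polys_Lp[OF f, of p]] p by (simp add: normf)
    have momf: "moment p f = (\<integral>x. Re (f x) powr p \<partial>m)" by (simp add: moment_def normf)
    have Rp: "R powr p > 0" using R by simp
    have "(\<integral>x. \<bar>Im (F x)\<bar> powr p \<partial>m) / R powr p = (\<integral>x. \<bar>Im (F x)\<bar> powr p / R powr p \<partial>m)"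
      using iIm by simp
    also have "\<dots> \<le> (\<integral>x. A * (Re (f x) powr p / R powr p) - B * Re ((1 + u x) powr of_real p) \<partial>m)"
      using iIm iRe up(1) scale by (intro integral_mono) auto
    also have "\<dots> = A * (moment p f / R powr p) - B * Re ((of_real (1 / R) * c) powr of_real p)"
      using iRe up by (simp add: momf meanu)
    also have "\<dots> \<le> A * (moment p f / R powr p)"
    proof -
      have eq: "complex_of_real (1 / R) * c = of_real (Re c / R)" using Imc by (simp add: complex_eq_iff)
      have "complex_of_real (Re c / R) powr of_real p = of_real ((Re c / R) powr p)"
        using Rec R \<epsilon> by (intro powr_of_real) auto
      then have re: "Re ((of_real (1 / R) * c) powr of_real p) = (Re c / R) powr p"
        unfolding eq by (simp only: Re_complex_of_real)
      show ?thesis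
        unfolding re using mult_nonneg_nonneg[OF AB(2) powr_ge_zero[of "Re c / R" p]] by linarith
    qed
    finally have Im_le: "(\<integral>x. \<bar>Im (F x)\<bar> powr p \<partial>m) \<le> A * moment p f"
      using Rp by (simp add: field_simps)
    have "moment p F \<le> (\<integral>x. 2 powr p * (Re (f x) powr p + \<bar>Im (F x)\<bar> powr p) \<partial>m)"
      unfolding moment_def
    proof (rule integral_mono)
      show "integrable m (\<lambda>x. cmod (F x) powr p)"
        using trig_polys_Lp[OF Ft, of p] p by (intro Lp_integrable_powr) auto
      show "cmod (F x) powr p \<le> 2 powr p * (Re (f x) powr p + \<bar>Im (F x)\<bar> powr p)" for x
      proof -
        have "cmod (F x) \<le> \<bar>Re (F x)\<bar> + \<bar>Im (F x)\<bar>" by (rule cmod_le)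
        then have "cmod (F x) \<le> Re (f x) + \<bar>Im (F x)\<bar>" using ReF[of x] pos[of x] \<epsilon> by simp
        then have "cmod (F x) powr p \<le> (Re (f x) + \<bar>Im (F x)\<bar>) powr p"
          using p by (intro powr_mono2) auto
        also have "\<dots> \<le> 2 powr p * (Re (f x) powr p + \<bar>Im (F x)\<bar> powr p)"
          using p pos[of x] \<epsilon> by (intro powr_add_le) auto
        finally show ?thesis .
      qed
    qed (use iRe iIm in auto)
    also have "\<dots> = 2 powr p * (moment p f + (\<integral>x. \<bar>Im (F x)\<bar> powr p \<partial>m))"
      using iRe iIm by (simp add: momf)
    also have "\<dots> \<le> 2 powr p * (moment p f + A * moment p f)"
      using Im_le by (intro mult_left_mono) auto
    finally have momF: "moment p F \<le> 2 powr p * (1 + A) * moment p f"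
      by (simp add: algebra_simps)
    have half: "riesz_poly f = (\<lambda>x. (1 / 2) * (F x + c))" by (simp add: F_def)
    have cp: "cmod c powr p \<le> moment p f"
      unfolding c_def mean_eq_fourier using p by (intro norm_fourier_powr_le trig_polys_Lp f char_one) auto
    have "(1 / 2) powr p \<le> (1::real)" using powr_mono2[of p "1/2" 1] p by simp
    have cL: "(\<lambda>_. c) \<in> Lp_space m p" "F \<in> Lp_space m p"
      using p by (auto intro: trig_polys_Lp trig_polys_const Ft)
    have "moment p (riesz_poly f) = (1 / 2) powr p * moment p (\<lambda>x. F x + c)"
      unfolding half using Lp_scale(2)[OF Lp_add(1)[OF cL(2,1)], of "1/2"] p by (simp add: norm_divide)
    also have "\<dots> \<le> 1 * moment p (\<lambda>x. F x + c)"
      using \<open>(1 / 2) powr p \<le> (1::real)\<close> by (intro mult_right_mono moment_nonneg) auto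
    also have "\<dots> \<le> 2 powr p * (moment p F + cmod c powr p)"
      using Lp_add(2)[OF cL(2,1)] p by simp
    also have "\<dots> \<le> 2 powr p * (2 powr p * (1 + A) * moment p f + moment p f)"
      using momF cp by (intro mult_left_mono add_mono) auto
    also have "\<dots> = C * moment p f" by (simp add: C_def algebra_simps)
    finally show "moment p (riesz_poly f) \<le> C * moment p f" .
  qed
qed

lemma riesz_bound_from_real:
  assumes p: "p > 0" and C: "C \<ge> 0"
    and real: "\<And>f. f \<in> trig_polys \<Longrightarrow> (\<And>x. cnj (f x) = f x) \<Longrightarrow> moment p (riesz_poly f) \<le> C * moment p f"
  shows "riesz_bound p (2 powr p * (C + C))"
  unfolding riesz_bound_def
proof
  fix f :: "'a \<Rightarrow> complex" assume f: "f \<in> trig_polys"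
  define g h where "g x = complex_of_real (Re (f x))" and "h x = complex_of_real (Im (f x))" for x
  have g: "g \<in> trig_polys" and h: "h \<in> trig_polys"
    unfolding g_def h_def by (rule trig_polys_Re[OF f], rule trig_polys_Im[OF f])
  have fgh: "f = (\<lambda>x. g x + \<i> * h x)" by (auto simp: g_def h_def complex_eq_iff)
  have "riesz_poly f = (\<lambda>x. riesz_poly g x + \<i> * riesz_poly h x)"
    unfolding fgh by (simp add: riesz_poly_add riesz_poly_scale trig_polys_scale g h)
  then have "moment p (riesz_poly f) \<le> 2 powr p * (moment p (riesz_poly g) + moment p (riesz_poly h))"
    using Lp_add(2)[OF trig_polys_Lp[OF riesz_poly_trig[OF g]] Lp_scale(1)[OF trig_polys_Lp[OF riesz_poly_trig[OF h]]], of p \<i>]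
      Lp_scale(2)[OF trig_polys_Lp[OF riesz_poly_trig[OF h]], of p \<i>] p by simp
  also have "\<dots> \<le> 2 powr p * (C * moment p g + C * moment p h)"
    by (intro mult_left_mono add_mono real g h) (auto simp: g_def h_def)
  also have "\<dots> \<le> 2 powr p * (C * moment p f + C * moment p f)"
  proof (intro mult_left_mono add_mono C)
    show "moment p g \<le> moment p f" "moment p h \<le> moment p f"
      by (rule Lp_mono(2)[OF trig_polys_Lp[OF f p]];
          use p g h in \<open>auto simp: g_def h_def abs_Re_le_cmod abs_Im_le_cmod
            intro!: continuous_measurable trig_polys_continuous[OF f] continuous_intros\<close>)+
  qed simp
  finally show "moment p (riesz_poly f) \<le> 2 powr p * (C + C) * moment p f"
    by (simp add: algebra_simps)
qed

text \<open>
  A real \<open>f\<close> is the difference of \<open>h1\<close> and \<open>h2 = h1 - f\<close>, where \<open>h1\<close> is a polynomial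
  between \<open>\<bar>f\<bar> + \<delta>\<close> and \<open>\<bar>f\<bar> + 3 \<delta>\<close>. Both are at least \<open>\<delta>\<close> and at most \<open>2 \<bar>f\<bar> + 3 \<delta>\<close>.
\<close>

lemma riesz_bound_le_2:
  assumes p: "1 < p" "p \<le> 2"
  shows "\<exists>C\<ge>0. riesz_bound p C"
proof -
  obtain C where C: "C \<ge> 0" "\<forall>f\<in>trig_polys. \<forall>\<epsilon>>0. (\<forall>x. cnj (f x) = f x) \<longrightarrow>
      (\<forall>x. Re (f x) \<ge> \<epsilon>) \<longrightarrow> moment p (riesz_poly f) \<le> C * moment p f"
    using riesz_bound_positive[OF p] by blast
  define K where "K = 2 powr p * (C + C) * 2 powr p"
  define K1 K2 where "K1 = K * 2 powr p" and "K2 = K * 3 powr p + 1"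
  have K: "K \<ge> 0" using C by (simp add: K_def)
  have "moment p (riesz_poly f) \<le> K1 * moment p f"
    if f: "f \<in> trig_polys" and real: "\<And>x. cnj (f x) = f x" for f
  proof -
    define r where "r x = Re (f x)" for x
    have fr: "f x = of_real (r x)" for x
      using real[of x] by (simp add: complex_eq_iff r_def)
    have cr: "continuous_on UNIV r"
      unfolding r_def by (intro continuous_on_Re trig_polys_continuous f)
    have *: "moment p (riesz_poly f) \<le> K1 * moment p f + K2 * \<delta> powr p" if \<delta>: "\<delta> > 0" for \<delta>
    proof -
      have cr2: "continuous_on UNIV (\<lambda>x. \<bar>r x\<bar> + 2 * \<delta>)"
        by (intro continuous_on_add continuous_on_rabs continuous_on_const cr)
      obtain g :: "'a \<Rightarrow> real" where g: "(\<lambda>x. complex_of_real (g x)) \<in> trig_polys"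
        "\<And>x. \<bar>(\<bar>r x\<bar> + 2 * \<delta>) - g x\<bar> < \<delta>"
        using trig_polys_uniformly_dense[OF cr2 \<delta>] by blast
      define h1 h2 where "h1 x = complex_of_real (g x)" and "h2 x = h1 x - f x" for x
      have h1: "h1 \<in> trig_polys" unfolding h1_def by (rule g(1))
      have h2: "h2 \<in> trig_polys" unfolding h2_def by (intro trig_polys_diff h1 f)
      have b: "g x \<ge> \<delta>" "g x \<le> \<bar>r x\<bar> + 3 * \<delta>" "g x - r x \<ge> \<delta>" "g x - r x \<le> 2 * \<bar>r x\<bar> + 3 * \<delta>" for x
        using g(2)[of x] by linarith+
      define w where "w x = 2 * complex_of_real \<bar>r x\<bar> + of_real (3 * \<delta>)" for x
      have cw: "cont w" unfolding w_def by (intro continuous_intros cr)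
      have normw: "cmod (w x) = 2 * \<bar>r x\<bar> + 3 * \<delta>" for x
      proof -
        have "w x = of_real (2 * \<bar>r x\<bar> + 3 * \<delta>)" by (simp add: w_def)
        then have "cmod (w x) = \<bar>2 * \<bar>r x\<bar> + 3 * \<delta>\<bar>" by (simp only: norm_of_real)
        then show ?thesis using \<delta> by simp
      qed
      have wL: "w \<in> Lp_space m p" using cw p by (intro continuous_Lp) auto
      have momw: "moment p w \<le> 2 powr p * (2 powr p * moment p f + 3 powr p * \<delta> powr p)"
      proof -
        have a: "(\<lambda>x. 2 * f x) \<in> Lp_space m p" "moment p (\<lambda>x. 2 * f x) = 2 powr p * moment p f"
          using Lp_scale[OF trig_polys_Lp[OF f, of p], of 2] p by simp_all
        have abs: "(\<lambda>x. 2 * complex_of_real \<bar>r x\<bar>) \<in> Lp_space m p"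
          "moment p (\<lambda>x. 2 * complex_of_real \<bar>r x\<bar>) = 2 powr p * moment p f"
          using cr p a(2) by (auto intro!: continuous_Lp continuous_intros simp: moment_def norm_mult fr)
        have "moment p w \<le> 2 powr p * (moment p (\<lambda>x. 2 * complex_of_real \<bar>r x\<bar>) + moment p (\<lambda>_. of_real (3 * \<delta>)))"
          unfolding w_def using p by (intro Lp_add(2) abs(1) trig_polys_Lp trig_polys_const) auto
        then show ?thesis
          unfolding abs(2) moment_const norm_of_real using \<delta> by (simp add: powr_mult)
      qed
      have m1: "moment p h1 \<le> moment p w" "moment p h2 \<le> moment p w"
      proof -
        show "moment p h1 \<le> moment p w"
        proof (rule Lp_mono(2)[OF wL])
          show "cmod (h1 x) \<le> cmod (w x)" for x
            unfolding normw h1_def norm_of_real using b(1,2)[of x] \<delta> by linarith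
        qed (use p h1 in \<open>auto intro: continuous_measurable trig_polys_continuous\<close>)
        show "moment p h2 \<le> moment p w"
        proof (rule Lp_mono(2)[OF wL])
          show "cmod (h2 x) \<le> cmod (w x)" for x
            unfolding normw h2_def h1_def fr of_real_diff[symmetric] norm_of_real using b(3,4)[of x] \<delta> by linarith
        qed (use p h2 in \<open>auto intro: continuous_measurable trig_polys_continuous\<close>)
      qed
      have c1: "moment p (riesz_poly h1) \<le> C * moment p h1"
        by (rule C(2)[rule_format, OF h1 \<delta>]) (use b(1) in \<open>auto simp: h1_def\<close>)
      have c2: "moment p (riesz_poly h2) \<le> C * moment p h2"
        by (rule C(2)[rule_format, OF h2 \<delta>]) (use b(3) in \<open>auto simp: h2_def h1_def fr\<close>)
      have "f = (\<lambda>x. h1 x - h2 x)" by (simp add: h2_def)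
      then have "riesz_poly f = (\<lambda>x. riesz_poly h1 x - riesz_poly h2 x)"
        using riesz_poly_diff[OF h1 h2] by simp
      then have "moment p (riesz_poly f) \<le> 2 powr p * (moment p (riesz_poly h1) + moment p (riesz_poly h2))"
        using Lp_diff(2)[OF trig_polys_Lp[OF riesz_poly_trig[OF h1]] trig_polys_Lp[OF riesz_poly_trig[OF h2]], of p] p by simp
      also have "\<dots> \<le> 2 powr p * (C * moment p w + C * moment p w)"
        using c1 c2 mult_left_mono[OF m1(1) C(1)] mult_left_mono[OF m1(2) C(1)]
        by (intro mult_left_mono add_mono) auto
      also have "\<dots> = 2 powr p * (C + C) * moment p w" by (simp add: algebra_simps)
      also have "\<dots> \<le> 2 powr p * (C + C) * (2 powr p * (2 powr p * moment p f + 3 powr p * \<delta> powr p))"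
        using C(1) momw by (intro mult_left_mono) auto
      also have "\<dots> = K1 * moment p f + K * 3 powr p * \<delta> powr p"
        by (simp add: K_def K1_def algebra_simps)
      also have "\<dots> \<le> K1 * moment p f + K2 * \<delta> powr p"
        by (intro add_left_mono mult_right_mono) (auto simp: K2_def)
      finally show ?thesis .
    qed
    show ?thesis
    proof (rule field_le_epsilon)
      fix e :: real assume e: "e > 0"
      have K2: "K2 > 0" using K by (simp add: K2_def add_nonneg_pos)
      have "((e / K2) powr (1 / p)) powr p = e / K2"
        using e K2 p by (simp add: powr_powr)
      then show "moment p (riesz_poly f) \<le> K1 * moment p f + e"
        using *[of "(e / K2) powr (1 / p)"] e K2 by simp
    qed
  qed
  moreover have "K1 \<ge> 0" using K by (simp add: K1_def)
  ultimately have "riesz_bound p (2 powr p * (K1 + K1))"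
    using p by (intro riesz_bound_from_real) auto
  then show ?thesis using \<open>K1 \<ge> 0\<close> by (intro exI[of _ "2 powr p * (K1 + K1)"]) auto
qed

end

context ordered_haar
begin

text \<open>
  After subtraction of the mean, \<open>f\<close> becomes the real part \<open>f0\<close> of an analytic polynomial \<open>F\<close> of
  mean 0. The function \<open>W = Im (F\<^sup>2) = 2 f0 Im F\<close> has the Riesz projection \<open>F\<^sup>2 / 2i\<close>. So the bound for \<open>p\<close>
  estimates the moment of order \<open>2p\<close> of \<open>F\<close> by the mean of \<open>\<bar>f0\<bar>\<^sup>p \<bar>F\<bar>\<^sup>p\<close>, and
  \<open>2 a b \<le> \<eta> a\<^sup>2 + b\<^sup>2 / \<eta>\<close> with small \<open>\<eta>\<close> allows to absorb \<open>F\<close> on the left.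
\<close>

lemma riesz_bound_double:
  assumes p: "p > 1" and C: "C \<ge> 0" and bound: "riesz_bound p C"
  shows "\<exists>C'\<ge>0. riesz_bound (2 * p) C'"
proof -
  define K where "K = 4 powr p * C + 1"
  have K: "K > 0" using C by (simp add: K_def add_nonneg_pos)
  define K' where "K' = 2 powr (2 * p) * (4 * K\<^sup>2 * (2 powr (2 * p) * 2) + 1)"
  have p2: "2 * p > 1" "2 * p > 0" using p by auto
  have "moment (2 * p) (riesz_poly f) \<le> K' * moment (2 * p) f"
    if f: "f \<in> trig_polys" and real: "\<And>x. cnj (f x) = f x" for f
  proof -
    define c where "c = (\<integral>x. f x \<partial>m)"
    have Imc: "Im c = 0" using riesz_poly_real(2)[OF f real] by (simp add: c_def)
    have cp: "cmod c powr (2 * p) \<le> moment (2 * p) f"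
      unfolding c_def mean_eq_fourier using p2 by (intro norm_fourier_powr_le trig_polys_Lp f char_one)
    define f0 where "f0 x = f x - c" for x
    have f0: "f0 \<in> trig_polys" unfolding f0_def by (intro trig_polys_diff f trig_polys_const)
    have real0: "cnj (f0 x) = f0 x" for x
      using real[of x] Imc by (simp add: f0_def complex_eq_iff)
    have mean0: "(\<integral>x. f0 x \<partial>m) = 0"
      unfolding f0_def using trig_polys_integrable[OF f] by (simp add: c_def)
    define F where "F x = 2 * riesz_poly f0 x" for x
    have F: "F \<in> analytic_polys"
      unfolding F_def by (intro analytic_scale riesz_poly_analytic f0)
    have Ft: "F \<in> trig_polys" by (rule analytic_trig[OF F])
    have ReF: "f0 x = of_real (Re (F x))" for x
      using riesz_poly_real(1)[OF f0 real0, of x] real0[of x] mean0 by (simp add: F_def complex_eq_iff)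
    have meanF: "(\<integral>x. F x \<partial>m) = 0"
      unfolding F_def using mean_riesz_poly[OF f0] mean0 by simp
    define Q where "Q x = F x * F x" for x
    have Q: "Q \<in> analytic_polys" and meanQ: "(\<integral>x. Q x \<partial>m) = 0"
      unfolding Q_def using analytic_mult[OF F F] meanF by simp_all
    have Qt: "Q \<in> trig_polys" by (rule analytic_trig[OF Q])
    define W where "W x = complex_of_real (Im (Q x))" for x
    have W: "W \<in> trig_polys" unfolding W_def by (rule trig_polys_Im[OF Qt])
    have Wexp: "W = (\<lambda>x. (1 / (2 * \<i>)) * (Q x - cnj (Q x)))"
      by (rule ext) (simp add: W_def complex_eq_iff)
    have Qc: "(\<lambda>x. cnj (Q x)) \<in> trig_polys" by (intro trig_polys_cnj Qt)
    (* The spectrum of cnj Q lies on the negative side, and the unit character is excluded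
       because Q has mean 0. *)
    have "riesz_poly (\<lambda>x. cnj (Q x)) = (\<lambda>_. 0)"
    proof (rule trig_polys_eqI[OF riesz_poly_trig[OF Qc] trig_polys_zero])
      fix \<xi> :: "'a \<Rightarrow> complex" assume \<xi>: "\<xi> \<in> characters"
      have "fourier m Q (conj_fun \<xi>) = 0" if "\<xi> \<in> T"
      proof (cases "\<xi> = (\<lambda>_. 1)")
        case True
        then show ?thesis using meanQ by (simp add: mean_eq_fourier conj_fun_def)
      next
        case False
        then have "conj_fun \<xi> \<in> characters - T" using T_antisym \<xi> that char_conj by blast
        then show ?thesis using Q unfolding analytic_iff by blast
      qed
      then show "fourier m (riesz_poly (\<lambda>x. cnj (Q x))) \<xi> = fourier m (\<lambda>_. 0) \<xi>"
        unfolding fourier_riesz_poly[OF Qc \<xi>] fourier_cnj fourier_const[OF \<xi>] by simp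
    qed
    then have "riesz_poly (\<lambda>x. Q x - cnj (Q x)) = Q"
      using riesz_poly_diff[OF Qt Qc] riesz_poly_id[OF Q] by simp
    then have "riesz_poly W = (\<lambda>x. (1 / (2 * \<i>)) * Q x)"
      unfolding Wexp riesz_poly_scale[OF trig_polys_diff[OF Qt Qc]] by (simp only:)
    moreover have "moment p (riesz_poly W) \<le> C * moment p W"
      using bound W unfolding riesz_bound_def by blast
    ultimately have "moment p (\<lambda>x. (1 / (2 * \<i>)) * Q x) \<le> C * moment p W"
      by (simp only:)
    moreover have "moment p (\<lambda>x. (1 / (2 * \<i>)) * Q x) = (1 / 2) powr p * moment (2 * p) F"
    proof -
      have "cmod (Q x) powr p = cmod (F x) powr (2 * p)" for x
        unfolding Q_def norm_mult powr_mult mult_2 powr_add ..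
      then show ?thesis
        using Lp_scale(2)[OF trig_polys_Lp[OF Qt], of p "1 / (2 * \<i>)"] p
        by (simp add: moment_def norm_divide norm_mult)
    qed
    ultimately have h: "(1 / 2) powr p * moment (2 * p) F \<le> C * moment p W"
      by (simp only:)
    have "moment (2 * p) F = 2 powr p * ((1 / 2) powr p * moment (2 * p) F)"
      by (simp flip: powr_mult mult.assoc)
    also have "\<dots> \<le> 2 powr p * (C * moment p W)"
      using h by (intro mult_left_mono) auto
    finally have 1: "moment (2 * p) F \<le> 2 powr p * C * moment p W"
      by (simp only: mult.assoc)
    (* This choice leaves half of the moment of F on the right-hand side. *)
    define \<eta> where "\<eta> = 1 / (2 * K)"
    have \<eta>: "\<eta> > 0" using K by (simp add: \<eta>_def)
    have iF: "integrable m (\<lambda>x. cmod (F x) powr (2 * p))" "integrable m (\<lambda>x. cmod (f0 x) powr (2 * p))"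
      by (intro Lp_integrable_powr trig_polys_Lp Ft f0 p2)+
    have "moment p W \<le> (\<integral>x. 2 powr p * (\<eta> * cmod (F x) powr (2 * p) + cmod (f0 x) powr (2 * p) / \<eta>) \<partial>m)"
      unfolding moment_def
    proof (rule integral_mono)
      show "integrable m (\<lambda>x. cmod (W x) powr p)"
        using p by (intro Lp_integrable_powr trig_polys_Lp W) auto
      fix x
      have "Im (Q x) = 2 * Re (F x) * Im (F x)" by (simp add: Q_def)
      then have "cmod (W x) = 2 * cmod (f0 x) * \<bar>Im (F x)\<bar>"
        unfolding W_def ReF norm_of_real by (simp add: abs_mult)
      also have "\<dots> \<le> 2 * cmod (f0 x) * cmod (F x)"
        by (intro mult_left_mono abs_Im_le_cmod) auto
      finally have "cmod (W x) powr p \<le> (2 * cmod (f0 x) * cmod (F x)) powr p"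
        using p by (intro powr_mono2) auto
      also have "\<dots> = 2 powr p * (cmod (f0 x) powr p * cmod (F x) powr p)"
        by (simp add: powr_mult)
      also have "cmod (f0 x) powr p * cmod (F x) powr p \<le>
          \<eta> * cmod (F x) powr (2 * p) + cmod (f0 x) powr (2 * p) / \<eta>"
      proof -
        define a b where "a = cmod (F x) powr p" and "b = cmod (f0 x) powr p"
        have ab: "a \<ge> 0" "b \<ge> 0" by (simp_all add: a_def b_def)
        have "2 * (a * b) \<le> \<eta> * a\<^sup>2 + b\<^sup>2 / \<eta>"
        proof -
          have "0 \<le> (\<eta> * a - b)\<^sup>2 / \<eta>" using \<eta> by simp
          also have "\<dots> = \<eta> * a\<^sup>2 + b\<^sup>2 / \<eta> - 2 * (a * b)"
            using \<eta> by (simp add: power2_eq_square field_simps)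
          finally show ?thesis by simp
        qed
        moreover have "0 \<le> a * b" using ab by simp
        ultimately have "b * a \<le> \<eta> * a\<^sup>2 + b\<^sup>2 / \<eta>" by (simp only: mult.commute[of b a])
        moreover have "a\<^sup>2 = cmod (F x) powr (2 * p)" "b\<^sup>2 = cmod (f0 x) powr (2 * p)"
          unfolding a_def b_def power2_eq_square mult_2 powr_add by (rule refl)+
        ultimately show ?thesis by (simp add: a_def b_def)
      qed
      finally show "cmod (W x) powr p \<le> 2 powr p * (\<eta> * cmod (F x) powr (2 * p) + cmod (f0 x) powr (2 * p) / \<eta>)"
        by simp
    qed (use iF in auto)
    also have "\<dots> = 2 powr p * (\<eta> * moment (2 * p) F + moment (2 * p) f0 / \<eta>)"
      using iF by (simp add: moment_def)
    finally have mW: "moment p W \<le> 2 powr p * (\<eta> * moment (2 * p) F + moment (2 * p) f0 / \<eta>)" .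
    note 1
    also have "2 powr p * C * moment p W \<le> 2 powr p * C * (2 powr p * (\<eta> * moment (2 * p) F + moment (2 * p) f0 / \<eta>))"
      using C by (intro mult_left_mono mW) simp
    also have "\<dots> = (4 powr p * C) * (\<eta> * moment (2 * p) F + moment (2 * p) f0 / \<eta>)"
      using powr_mult[of 2 2 p] by simp
    also have "\<dots> \<le> K * (\<eta> * moment (2 * p) F + moment (2 * p) f0 / \<eta>)"
      using \<eta> moment_nonneg by (intro mult_right_mono) (auto simp: K_def intro!: add_nonneg_nonneg)
    also have "\<dots> = moment (2 * p) F / 2 + 2 * K\<^sup>2 * moment (2 * p) f0"
      using K by (simp add: \<eta>_def power2_eq_square field_simps)
    finally have 2: "moment (2 * p) F \<le> 4 * K\<^sup>2 * moment (2 * p) f0" by simp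
    have "moment (2 * p) f0 \<le> 2 powr (2 * p) * (moment (2 * p) f + cmod c powr (2 * p))"
      unfolding f0_def using Lp_diff(2)[OF trig_polys_Lp[OF f] trig_polys_Lp[OF trig_polys_const], of "2 * p" c] p by simp
    also have "\<dots> \<le> 2 powr (2 * p) * 2 * moment (2 * p) f"
      using cp by simp
    finally have 3: "moment (2 * p) f0 \<le> 2 powr (2 * p) * 2 * moment (2 * p) f" .
    have "riesz_poly f = (\<lambda>x. riesz_poly f0 x + c)"
    proof -
      have "f = (\<lambda>x. f0 x + c)" by (simp add: f0_def)
      then show ?thesis
        using riesz_poly_add[OF f0 trig_polys_const[of c]] riesz_poly_id[OF analytic_const[of c]] by simp
    qed
    then have "moment (2 * p) (riesz_poly f) \<le> 2 powr (2 * p) * (moment (2 * p) (riesz_poly f0) + cmod c powr (2 * p))"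
      using Lp_add(2)[OF trig_polys_Lp[OF riesz_poly_trig[OF f0]] trig_polys_Lp[OF trig_polys_const], of "2 * p" c] p by simp
    also have "\<dots> \<le> 2 powr (2 * p) * (4 * K\<^sup>2 * (2 powr (2 * p) * 2 * moment (2 * p) f) + moment (2 * p) f)"
    proof (intro mult_left_mono add_mono cp)
      have "moment (2 * p) (riesz_poly f0) \<le> moment (2 * p) F"
        by (rule Lp_mono(2)[OF trig_polys_Lp[OF Ft]])
          (use p in \<open>auto simp: F_def norm_mult intro!: continuous_measurable trig_polys_continuous riesz_poly_trig f0\<close>)
      also have "\<dots> \<le> 4 * K\<^sup>2 * (2 powr (2 * p) * 2 * moment (2 * p) f)"
        by (rule order_trans[OF 2 mult_left_mono[OF 3]]) simp
      finally show "moment (2 * p) (riesz_poly f0) \<le> 4 * K\<^sup>2 * (2 powr (2 * p) * 2 * moment (2 * p) f)" .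
    qed simp
    also have "\<dots> = K' * moment (2 * p) f" by (simp add: K'_def algebra_simps)
    finally show ?thesis .
  qed
  moreover have "K' \<ge> 0" by (simp add: K'_def)
  ultimately have "riesz_bound (2 * p) (2 powr (2 * p) * (K' + K'))"
    using p by (intro riesz_bound_from_real) auto
  then show ?thesis using \<open>K' \<ge> 0\<close> by (intro exI[of _ "2 powr (2 * p) * (K' + K')"]) auto
qed

theorem riesz_bound_exists:
  assumes p: "p > 1"
  shows "\<exists>C\<ge>0. riesz_bound p C"
proof -
  obtain n where "p < 2 ^ n" using real_arch_pow[of 2 p] by auto
  then show ?thesis using p
  proof (induction n arbitrary: p)
    case 0
    then show ?case by simp
  next
    case (Suc n)
    show ?case
    proof (cases "p \<le> 2")
      case True
      then show ?thesis using riesz_bound_le_2 Suc.prems by blast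
    next
      case False
      then obtain C where "C \<ge> 0" "riesz_bound (p / 2) C"
        using Suc.IH[of "p / 2"] Suc.prems by auto
      then show ?thesis
        using riesz_bound_double[of "p / 2" C] False by auto
    qed
  qed
qed

end

section \<open>Density and completeness in the Lebesgue spaces\<close>

context compact_haar
begin

lemma moment_tendsto_0_dominated:
  fixes s :: "nat \<Rightarrow> 'a \<Rightarrow> complex"
  assumes p: "p > 0" and w: "integrable m w"
    and f: "f \<in> borel_measurable m" and s: "\<And>n. s n \<in> borel_measurable m"
    and lim: "AE x in m. (\<lambda>n. s n x) \<longlonglongrightarrow> f x"
    and le: "\<And>n x. cmod (f x - s n x) powr p \<le> w x"
  shows "(\<lambda>n. moment p (\<lambda>x. f x - s n x)) \<longlonglongrightarrow> 0"
proof -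
  have "(\<lambda>n. \<integral>x. cmod (f x - s n x) powr p \<partial>m) \<longlonglongrightarrow> (\<integral>x. 0 \<partial>m)"
  proof (rule integral_dominated_convergence[OF _ _ w])
    show "(\<lambda>x. cmod (f x - s n x) powr p) \<in> borel_measurable m" for n
      using f s by measurable
    show "AE x in m. (\<lambda>n. cmod (f x - s n x) powr p) \<longlonglongrightarrow> 0"
      using lim
    proof eventually_elim
      case (elim x)
      have "(\<lambda>n. cmod (f x - s n x)) \<longlonglongrightarrow> cmod (f x - f x)"
        by (intro tendsto_norm tendsto_diff tendsto_const elim)
      then have "(\<lambda>n. cmod (f x - s n x) powr p) \<longlonglongrightarrow> 0 powr p"
        using p by (intro tendsto_powr') auto
      then show ?case by simp
    qed
    show "AE x in m. norm (cmod (f x - s n x) powr p) \<le> w x" for n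
      using le by simp
  qed simp
  then show ?thesis by (simp add: moment_def)
qed

definition approximable :: "real \<Rightarrow> ('a \<Rightarrow> complex) \<Rightarrow> bool" where
  "approximable p f \<longleftrightarrow> f \<in> Lp_space m p \<and> (\<forall>e>0. \<exists>q\<in>trig_polys. moment p (\<lambda>x. f x - q x) < e)"

lemma approximableD: "approximable p f \<Longrightarrow> f \<in> Lp_space m p"
  by (simp add: approximable_def)

lemma approximable_closed:
  assumes p: "p > 0" and f: "f \<in> Lp_space m p"
    and g: "\<And>e. e > 0 \<Longrightarrow> \<exists>g. approximable p g \<and> moment p (\<lambda>x. f x - g x) < e"
  shows "approximable p f"
  unfolding approximable_def
proof (intro conjI f allI impI)
  fix e :: real assume e: "e > 0"
  define d where "d = e / (2 powr p * 2)"
  have d: "d > 0" using e by (simp add: d_def)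
  obtain g where g: "approximable p g" "moment p (\<lambda>x. f x - g x) < d" using g[OF d] by blast
  then obtain q where q: "q \<in> trig_polys" "moment p (\<lambda>x. g x - q x) < d"
    using d unfolding approximable_def by blast
  have gL: "g \<in> Lp_space m p" by (rule approximableD[OF g(1)])
  have qL: "q \<in> Lp_space m p" by (rule trig_polys_Lp[OF q(1) p])
  have "moment p (\<lambda>x. f x - q x) = moment p (\<lambda>x. (f x - g x) + (g x - q x))" by simp
  also have "\<dots> \<le> 2 powr p * (moment p (\<lambda>x. f x - g x) + moment p (\<lambda>x. g x - q x))"
    using p by (intro Lp_add(2) Lp_diff(1) f gL qL) auto
  also have "\<dots> < 2 powr p * (d + d)"
    using g(2) q(2) by (intro mult_strict_left_mono add_strict_mono) auto
  also have "\<dots> = e" by (simp add: d_def)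
  finally show "\<exists>q\<in>trig_polys. moment p (\<lambda>x. f x - q x) < e" using q(1) by blast
qed

lemma approximable_lincomb:
  assumes p: "p > 0" and f: "approximable p f" and g: "approximable p g"
  shows "approximable p (\<lambda>x. a * f x + g x)"
  unfolding approximable_def
proof (intro conjI allI impI)
  note fL = approximableD[OF f] and gL = approximableD[OF g]
  show "(\<lambda>x. a * f x + g x) \<in> Lp_space m p"
    using p by (intro Lp_add(1) Lp_scale(1) fL gL) auto
  fix e :: real assume e: "e > 0"
  define d where "d = e / (2 powr p * (cmod a powr p + 1))"
  have A: "cmod a powr p + 1 > 0" by (simp add: add_nonneg_pos)
  have d: "d > 0" using e A by (simp add: d_def)
  obtain q where q: "q \<in> trig_polys" "moment p (\<lambda>x. f x - q x) < d"
    using f d unfolding approximable_def by blast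
  obtain r where r: "r \<in> trig_polys" "moment p (\<lambda>x. g x - r x) < d"
    using g d unfolding approximable_def by blast
  have D: "(\<lambda>x. f x - q x) \<in> Lp_space m p" "(\<lambda>x. g x - r x) \<in> Lp_space m p"
    using p by (intro Lp_diff(1) fL gL trig_polys_Lp q r; simp)+
  have "moment p (\<lambda>x. a * f x + g x - (a * q x + r x)) = moment p (\<lambda>x. a * (f x - q x) + (g x - r x))"
    by (simp add: algebra_simps)
  also have "\<dots> \<le> 2 powr p * (cmod a powr p * moment p (\<lambda>x. f x - q x) + moment p (\<lambda>x. g x - r x))"
    using Lp_add(2)[OF Lp_scale(1)[OF D(1)] D(2), of a] Lp_scale(2)[OF D(1), of a] p by simp
  also have "\<dots> < 2 powr p * (cmod a powr p * d + d)"
    using q(2) r(2) by (intro mult_strict_left_mono add_le_less_mono mult_left_mono) auto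
  also have "\<dots> = e"
  proof -
    have "2 powr p * (cmod a powr p * d + d) = (2 powr p * (cmod a powr p + 1)) * d"
      by (simp add: algebra_simps)
    also have "\<dots> = e" using A by (simp add: d_def)
    finally show ?thesis .
  qed
  finally show "\<exists>q\<in>trig_polys. moment p (\<lambda>x. a * f x + g x - q x) < e"
    using trig_polys_add[OF trig_polys_scale[OF q(1)] r(1)] by (intro bexI)
qed

lemma approximable_indicator:
  assumes p: "p > 0" and A: "A \<in> sets m"
  shows "approximable p (indicator A)"
  unfolding approximable_def
proof (intro conjI allI impI)
  have [measurable]: "(indicator A :: 'a \<Rightarrow> complex) \<in> borel_measurable m" using A by simp
  have "(\<lambda>x. cmod (indicator A x) powr p) = indicat_real A"
    using p by (auto simp: indicator_def)
  then show "indicator A \<in> Lp_space m p"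
    using A by (auto simp: Lp_space_def emeasure_eq_measure intro!: integrable_real_indicator)
  obtain q :: "nat \<Rightarrow> 'a \<Rightarrow> complex"
    where q: "\<And>n. q n \<in> trig_polys" "\<And>n x. cmod (q n x) \<le> 2"
    "AE x in m. (\<lambda>n. q n x) \<longlonglongrightarrow> indicator A x"
    using indicator_trig_approx[OF A] by blast
  have "(\<lambda>n. moment p (\<lambda>x. indicator A x - q n x)) \<longlonglongrightarrow> 0"
  proof (rule moment_tendsto_0_dominated[OF p, where w = "\<lambda>_. 3 powr p"])
    show "q n \<in> borel_measurable m" for n
      by (intro continuous_measurable trig_polys_continuous q)
    fix n x
    have "cmod (indicator A x - q n x) \<le> cmod (indicator A x) + cmod (q n x)"
      by (rule norm_triangle_ineq4)
    also have "\<dots> \<le> 1 + 2" using q(2) by (intro add_mono) (auto simp: indicator_def)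
    finally show "cmod (indicator A x - q n x) powr p \<le> 3 powr p"
      using p by (intro powr_mono2) auto
  qed (use q in auto)
  then show "\<exists>q\<in>trig_polys. moment p (\<lambda>x. indicator A x - q x) < e" if "e > 0" for e
    using order_tendstoD(2)[OF _ that] q(1) by (fastforce simp: eventually_sequentially)
qed

text \<open>
  Indicators are approximable by \<open>indicator_trig_approx\<close>, hence simple functions, hence by dominated
  convergence all functions in \<open>L\<^sup>p\<close>.
\<close>

theorem trig_polys_dense:
  assumes p: "p > 0" and f: "f \<in> Lp_space m p"
  shows "approximable p f"
proof (rule approximable_closed[OF p f])
  have simple: "approximable p s" if s: "simple_function m s" for s :: "'a \<Rightarrow> complex"
  proof -
    have fin: "finite (range s)" using simple_functionD(1)[OF s] by simp
    have sets: "s -` {y} \<in> sets m" for y using simple_functionD(2)[OF s, of "{y}"] by simp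
    have "approximable p (\<lambda>x. \<Sum>y\<in>Y. y * indicator (s -` {y}) x)" if "finite Y" for Y
      using that
    proof (induction Y)
      case empty
      have "approximable p (\<lambda>_. 0)"
        unfolding approximable_def using trig_polys_Lp[OF trig_polys_zero p] p
        by (auto intro!: bexI[OF _ trig_polys_zero])
      then show ?case by simp
    next
      case (insert y Y)
      show ?case
        unfolding sum.insert[OF insert.hyps]
        by (rule approximable_lincomb[OF p approximable_indicator[OF p sets] insert.IH])
    qed
    from this[OF fin] have "approximable p (\<lambda>x. \<Sum>y\<in>range s. y * indicator (s -` {y}) x)" .
    also have "(\<lambda>x. \<Sum>y\<in>range s. y * indicator (s -` {y}) x) = s"
    proof
      fix x
      have "(\<Sum>y\<in>range s. y * indicator (s -` {y}) x) = (\<Sum>y\<in>range s. if y = s x then y else 0)"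
        by (intro sum.cong) (auto simp: indicator_def)
      then show "(\<Sum>y\<in>range s. y * indicator (s -` {y}) x) = s x" using fin by simp
    qed
    finally show ?thesis .
  qed
  have [measurable]: "f \<in> borel_measurable m" by (rule Lp_measurable[OF f])
  obtain F where F: "\<And>i. simple_function m (F i)" "\<And>x. (\<lambda>i. F i x) \<longlonglongrightarrow> f x"
    "\<And>i x. dist (F i x) 0 \<le> 2 * dist (f x) 0"
    using borel_measurable_implies_sequence_metric[of f m 0] by auto
  have "(\<lambda>n. moment p (\<lambda>x. f x - F n x)) \<longlonglongrightarrow> 0"
  proof (rule moment_tendsto_0_dominated[OF p, where w = "\<lambda>x. 3 powr p * cmod (f x) powr p"])
    show "integrable m (\<lambda>x. 3 powr p * cmod (f x) powr p)" using Lp_integrable_powr[OF f] by simp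
    show "F n \<in> borel_measurable m" for n by (intro borel_measurable_simple_function F)
    show "cmod (f x - F n x) powr p \<le> 3 powr p * cmod (f x) powr p" for n x
    proof -
      have "cmod (f x - F n x) \<le> cmod (f x) + cmod (F n x)" by (rule norm_triangle_ineq4)
      also have "\<dots> \<le> 3 * cmod (f x)" using F(3)[of n x] by simp
      finally have "cmod (f x - F n x) powr p \<le> (3 * cmod (f x)) powr p"
        using p by (intro powr_mono2) auto
      then show ?thesis by (simp add: powr_mult)
    qed
  qed (use F in auto)
  then show "\<exists>g. approximable p g \<and> moment p (\<lambda>x. f x - g x) < e" if "e > 0" for e
    using order_tendstoD(2)[OF _ that] simple[OF F(1)] by (fastforce simp: eventually_sequentially)
qed

lemma nn_integral_powr_eq_moment:
  "f \<in> Lp_space m p \<Longrightarrow> (\<integral>\<^sup>+x. ennreal (cmod (f x) powr p) \<partial>m) = ennreal (moment p f)"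
  unfolding moment_def by (intro nn_integral_eq_integral Lp_integrable_powr) auto

text \<open>
  A subsequence with geometrically decreasing increments converges almost everywhere, since the
  increments are summable in \<open>L\<^sup>1\<close>. Fatou's lemma shows that the pointwise limit is also the
  limit in \<open>L\<^sup>p\<close> of the whole sequence.
\<close>

theorem Lp_complete:
  fixes h :: "nat \<Rightarrow> 'a \<Rightarrow> complex"
  assumes p: "p > 1" and h: "\<And>n. h n \<in> Lp_space m p"
    and Cauchy: "\<And>e. e > 0 \<Longrightarrow> \<exists>N. \<forall>i\<ge>N. \<forall>j\<ge>N. moment p (\<lambda>x. h i x - h j x) < e"
  obtains H where "H \<in> Lp_space m p" "(\<lambda>n. moment p (\<lambda>x. H x - h n x)) \<longlonglongrightarrow> 0"
proof -
  have [measurable]: "h n \<in> borel_measurable m" for n by (rule Lp_measurable[OF h])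
  have D: "(\<lambda>x. h i x - h j x) \<in> Lp_space m p" for i j
    using p by (intro Lp_diff(1) h) auto
  have "\<forall>k. \<exists>N. \<forall>i\<ge>N. \<forall>j\<ge>N. moment p (\<lambda>x. h i x - h j x) < ((1/2) ^ k) powr p"
    using Cauchy by simp
  then obtain N where N: "\<And>k i j. i \<ge> N k \<Longrightarrow> j \<ge> N k \<Longrightarrow> moment p (\<lambda>x. h i x - h j x) < ((1/2) ^ k) powr p"
    by metis
  (* The sum makes r increasing and at least N. *)
  define r where "r k = (\<Sum>i\<le>k. N i) + k" for k
  have rN: "r k \<ge> N k" "r (Suc k) \<ge> N k" for k
    unfolding r_def using member_le_sum[of k "{..k}" N] by auto
  have rk: "r k \<ge> k" for k by (simp add: r_def)
  define d where "d k x = h (r (Suc k)) x - h (r k) x" for k x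
  have [measurable]: "d k \<in> borel_measurable m" for k unfolding d_def by measurable
  have dL: "d k \<in> Lp_space m p" for k unfolding d_def by (rule D)
  have id: "integrable m (d k)" for k using p by (intro Lp_integrable[OF dL]) auto
  have L1: "(\<integral>x. cmod (d k x) \<partial>m) \<le> (1/2) ^ k" for k
  proof (rule ccontr)
    assume "\<not> ?thesis"
    then have "((1/2) ^ k) powr p \<le> (\<integral>x. cmod (d k x) \<partial>m) powr p"
      using p by (intro powr_mono2) auto
    also have "\<dots> \<le> moment p (d k)" by (rule moment_Jensen[OF dL p])
    also have "\<dots> < ((1/2) ^ k) powr p" unfolding d_def by (rule N[OF rN(2,1)])
    finally show False by simp
  qed
  have "(\<integral>\<^sup>+x. (\<Sum>k. ennreal (cmod (d k x))) \<partial>m) = (\<Sum>k. \<integral>\<^sup>+x. ennreal (cmod (d k x)) \<partial>m)"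
    by (rule nn_integral_suminf) measurable
  also have "\<dots> = (\<Sum>k. ennreal (\<integral>x. cmod (d k x) \<partial>m))"
    using id by (simp add: nn_integral_eq_integral)
  also have "\<dots> \<le> (\<Sum>k. ennreal ((1/2) ^ k))"
    using L1 by (intro suminf_le) auto
  also have "\<dots> = ennreal (\<Sum>k. (1/2) ^ k)"
    by (intro suminf_ennreal2 summable_geometric) auto
  also have "\<dots> < \<infinity>" by simp
  finally have "AE x in m. (\<Sum>k. ennreal (cmod (d k x))) \<noteq> \<infinity>"
    by (intro nn_integral_PInf_AE) (auto simp: less_top)
  then have conv: "AE x in m. convergent (\<lambda>k. h (r k) x)"
  proof eventually_elim
    case (elim x)
    then have "summable (\<lambda>k. cmod (d k x))"
      by (intro summable_suminf_not_top) auto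
    then have "summable (\<lambda>k. d k x)" by (rule summable_norm_cancel)
    then have "(\<lambda>n. \<Sum>k<n. d k x) \<longlonglongrightarrow> (\<Sum>k. d k x)" by (rule summable_LIMSEQ)
    moreover have "(\<Sum>k<n. d k x) = h (r n) x - h (r 0) x" for n
      unfolding d_def by (rule sum_lessThan_telescope)
    ultimately have "(\<lambda>n. (h (r n) x - h (r 0) x) + h (r 0) x) \<longlonglongrightarrow> (\<Sum>k. d k x) + h (r 0) x"
      by (intro tendsto_add) auto
    then show ?case by (auto simp: convergent_def)
  qed
  define H where "H x = lim (\<lambda>k. h (r k) x)" for x
  have [measurable]: "H \<in> borel_measurable m" unfolding H_def by measurable
  have lim: "AE x in m. (\<lambda>k. h (r k) x) \<longlonglongrightarrow> H x"
    using conv by eventually_elim (simp add: H_def convergent_LIMSEQ_iff)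
  have Fatou: "(\<lambda>x. H x - h n x) \<in> Lp_space m p \<and> moment p (\<lambda>x. H x - h n x) \<le> e"
    if e: "e > 0" and n: "\<And>i. i \<ge> n \<Longrightarrow> moment p (\<lambda>x. h i x - h n x) < e" for n e
  proof -
    have "(\<integral>\<^sup>+x. ennreal (cmod (H x - h n x) powr p) \<partial>m)
        = (\<integral>\<^sup>+x. liminf (\<lambda>k. ennreal (cmod (h (r k) x - h n x) powr p)) \<partial>m)"
    proof (rule nn_integral_cong_AE)
      show "AE x in m. ennreal (cmod (H x - h n x) powr p) = liminf (\<lambda>k. ennreal (cmod (h (r k) x - h n x) powr p))"
        using lim
      proof eventually_elim
        case (elim x)
        have "(\<lambda>k. cmod (h (r k) x - h n x) powr p) \<longlonglongrightarrow> cmod (H x - h n x) powr p"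
          using p by (intro tendsto_powr' tendsto_norm tendsto_diff elim tendsto_const) auto
        then have "(\<lambda>k. ennreal (cmod (h (r k) x - h n x) powr p)) \<longlonglongrightarrow> ennreal (cmod (H x - h n x) powr p)"
          by (rule tendsto_ennrealI)
        from lim_imp_Liminf[OF trivial_limit_sequentially this] show ?case by (rule sym)
      qed
    qed
    also have "\<dots> \<le> liminf (\<lambda>k. \<integral>\<^sup>+x. ennreal (cmod (h (r k) x - h n x) powr p) \<partial>m)"
      by (rule nn_integral_liminf) measurable
    also have "\<dots> = liminf (\<lambda>k. ennreal (moment p (\<lambda>x. h (r k) x - h n x)))"
      by (simp only: nn_integral_powr_eq_moment[OF D])
    also have "\<dots> \<le> liminf (\<lambda>k. ennreal e)"
    proof (rule Liminf_mono)
      show "\<forall>\<^sub>F k in sequentially. ennreal (moment p (\<lambda>x. h (r k) x - h n x)) \<le> ennreal e"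
      proof (rule eventually_sequentiallyI[of n])
        fix k assume "n \<le> k"
        then have "n \<le> r k" using rk[of k] by simp
        from n[OF this] show "ennreal (moment p (\<lambda>x. h (r k) x - h n x)) \<le> ennreal e"
          by (intro ennreal_leI) simp
      qed
    qed
    also have "\<dots> = ennreal e" by (simp add: Liminf_const)
    finally have le: "(\<integral>\<^sup>+x. ennreal (cmod (H x - h n x) powr p) \<partial>m) \<le> ennreal e" .
    have i: "integrable m (\<lambda>x. cmod (H x - h n x) powr p)"
      by (rule integrableI_bounded) (use le in \<open>auto simp: order_le_less_trans\<close>)
    then have L: "(\<lambda>x. H x - h n x) \<in> Lp_space m p" by (simp add: Lp_space_def)
    moreover have "moment p (\<lambda>x. H x - h n x) \<le> e"
      using le e unfolding nn_integral_powr_eq_moment[OF L] by simp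
    ultimately show ?thesis by blast
  qed
  obtain M where M: "\<And>i j. i \<ge> M \<Longrightarrow> j \<ge> M \<Longrightarrow> moment p (\<lambda>x. h i x - h j x) < 1"
    using Cauchy[of 1] by auto
  have "(\<lambda>x. (H x - h M x) + h M x) \<in> Lp_space m p"
    using Fatou[of 1 M] M p h by (intro Lp_add(1)) auto
  then have HL: "H \<in> Lp_space m p" by simp
  have "(\<lambda>n. moment p (\<lambda>x. H x - h n x)) \<longlonglongrightarrow> 0"
  proof (rule LIMSEQ_I)
    fix e :: real assume e: "e > 0"
    obtain K where K: "\<And>i j. i \<ge> K \<Longrightarrow> j \<ge> K \<Longrightarrow> moment p (\<lambda>x. h i x - h j x) < e / 2"
      using Cauchy[of "e / 2"] e by auto
    have "norm (moment p (\<lambda>x. H x - h n x) - 0) < e" if "n \<ge> K" for n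
      using Fatou[of "e / 2" n] K that e moment_nonneg[of p "\<lambda>x. H x - h n x"] by auto
    then show "\<exists>K. \<forall>n\<ge>K. norm (moment p (\<lambda>x. H x - h n x) - 0) < e" by blast
  qed
  then show ?thesis using that HL by blast
qed

end

section \<open>The Riesz projection on the Lebesgue spaces\<close>

context ordered_haar
begin

text \<open>
  The graph of the continuous extension: this avoids a choice of approximating sequences
  until linearity and uniqueness are proved.
\<close>

definition extends_riesz :: "real \<Rightarrow> ('a \<Rightarrow> complex) \<Rightarrow> ('a \<Rightarrow> complex) \<Rightarrow> bool" where
  "extends_riesz p f h \<longleftrightarrow> f \<in> Lp_space m p \<and> h \<in> Lp_space m p \<and>
     (\<exists>q. (\<forall>n. q n \<in> trig_polys) \<and> (\<lambda>n. moment p (\<lambda>x. f x - q n x)) \<longlonglongrightarrow> 0 \<and>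
          (\<lambda>n. moment p (\<lambda>x. h x - riesz_poly (q n) x)) \<longlonglongrightarrow> 0)"

lemma extends_riesz_trig:
  assumes p: "p > 0" and q: "q \<in> trig_polys"
  shows "extends_riesz p q (riesz_poly q)"
  unfolding extends_riesz_def
  using p trig_polys_Lp[OF q p] trig_polys_Lp[OF riesz_poly_trig[OF q] p] q
  by (auto intro!: exI[of _ "\<lambda>_. q"])

lemma extends_riesz_exists:
  assumes p: "p > 1" and f: "f \<in> Lp_space m p"
  shows "\<exists>h. extends_riesz p f h"
proof -
  obtain C where C: "C \<ge> 0" "riesz_bound p C" using riesz_bound_exists[OF p] by blast
  have "\<exists>q\<in>trig_polys. moment p (\<lambda>x. f x - q x) < 1 / real (Suc n)" for n
    using trig_polys_dense[OF _ f] p unfolding approximable_def by simp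
  then obtain q where q: "\<And>n. q n \<in> trig_polys" "\<And>n. moment p (\<lambda>x. f x - q n x) < 1 / real (Suc n)"
    by metis
  have lim: "(\<lambda>n. moment p (\<lambda>x. f x - q n x)) \<longlonglongrightarrow> 0"
  proof (rule tendsto_sandwich[OF _ _ tendsto_const])
    show "(\<lambda>n. 1 / real (Suc n)) \<longlonglongrightarrow> 0"
      using LIMSEQ_Suc[OF lim_const_over_n[of 1]] by simp
    show "\<forall>\<^sub>F n in sequentially. moment p (\<lambda>x. f x - q n x) \<le> 1 / real (Suc n)"
      by (intro always_eventually allI less_imp_le q(2))
  qed (simp add: moment_nonneg)
  have D: "(\<lambda>x. f x - q n x) \<in> Lp_space m p" for n
    using p by (intro Lp_diff(1) f trig_polys_Lp q) auto
  have "\<exists>H. H \<in> Lp_space m p \<and> (\<lambda>n. moment p (\<lambda>x. H x - riesz_poly (q n) x)) \<longlonglongrightarrow> 0"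
  proof -
    have hL: "riesz_poly (q n) \<in> Lp_space m p" for n
      using p by (intro trig_polys_Lp riesz_poly_trig q) auto
    have cauchy: "\<exists>N. \<forall>i\<ge>N. \<forall>j\<ge>N. moment p (\<lambda>x. riesz_poly (q i) x - riesz_poly (q j) x) < e"
      if e: "e > 0" for e
    proof -
      define d where "d = e / (2 * (C + 1) * 2 powr p)"
      have d: "d > 0" using e C(1) by (simp add: d_def)
      obtain N where N: "\<And>n. n \<ge> N \<Longrightarrow> moment p (\<lambda>x. f x - q n x) < d"
        using order_tendstoD(2)[OF lim d] by (auto simp: eventually_sequentially)
      have "moment p (\<lambda>x. riesz_poly (q i) x - riesz_poly (q j) x) < e" if "i \<ge> N" "j \<ge> N" for i j
      proof -
        have "moment p (\<lambda>x. riesz_poly (q i) x - riesz_poly (q j) x) \<le> C * moment p (\<lambda>x. q i x - q j x)"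
          using C(2) trig_polys_diff[OF q(1) q(1), of i j]
          unfolding riesz_bound_def riesz_poly_diff[OF q(1) q(1), symmetric] by blast
        also have "(\<lambda>x. q i x - q j x) = (\<lambda>x. (f x - q j x) - (f x - q i x))" by simp
        also have "C * moment p \<dots> \<le> C * (2 powr p * (moment p (\<lambda>x. f x - q j x) + moment p (\<lambda>x. f x - q i x)))"
          using C(1) p by (intro mult_left_mono Lp_diff(2) D) auto
        also have "\<dots> \<le> C * (2 powr p * (d + d))"
          using C(1) less_imp_le[OF N] that by (intro mult_left_mono add_mono) auto
        also have "\<dots> < (C + 1) * (2 powr p * (d + d))"
          using d by (intro mult_strict_right_mono) auto
        also have "\<dots> = d * (2 * (C + 1) * 2 powr p)" by (simp add: algebra_simps)
        also have "\<dots> = e"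
          using C(1) unfolding d_def by (subst nonzero_eq_divide_eq[symmetric]) auto
        finally show ?thesis .
      qed
      then show ?thesis by blast
    qed
    show ?thesis
      by (rule Lp_complete[OF p hL cauchy]) auto
  qed
  then show ?thesis
    unfolding extends_riesz_def using f q(1) lim by blast
qed

lemma moment_lincomb_tendsto_0:
  assumes p: "p > 0" and u: "\<And>n. u n \<in> Lp_space m p" "(\<lambda>n. moment p (u n)) \<longlonglongrightarrow> 0"
    and v: "\<And>n. v n \<in> Lp_space m p" "(\<lambda>n. moment p (v n)) \<longlonglongrightarrow> 0"
  shows "(\<lambda>n. moment p (\<lambda>x. a * u n x + b * v n x)) \<longlonglongrightarrow> 0"
proof (rule tendsto_sandwich[OF _ _ tendsto_const])
  show "\<forall>\<^sub>F n in sequentially. moment p (\<lambda>x. a * u n x + b * v n x)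
      \<le> 2 powr p * (cmod a powr p * moment p (u n) + cmod b powr p * moment p (v n))"
  proof (intro always_eventually allI)
    fix n
    show "moment p (\<lambda>x. a * u n x + b * v n x)
      \<le> 2 powr p * (cmod a powr p * moment p (u n) + cmod b powr p * moment p (v n))"
      using Lp_add(2)[OF Lp_scale(1)[OF u(1)[of n]] Lp_scale(1)[OF v(1)[of n]], of a b] p
      unfolding Lp_scale(2)[OF u(1)] Lp_scale(2)[OF v(1)] by simp
  qed
  have "(\<lambda>n. 2 powr p * (cmod a powr p * moment p (u n) + cmod b powr p * moment p (v n)))
      \<longlonglongrightarrow> 2 powr p * (cmod a powr p * 0 + cmod b powr p * 0)"
    by (intro tendsto_intros u v)
  then show "(\<lambda>n. 2 powr p * (cmod a powr p * moment p (u n) + cmod b powr p * moment p (v n))) \<longlonglongrightarrow> 0"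
    by simp
qed (auto intro!: always_eventually moment_nonneg)

lemma extends_riesz_lincomb:
  assumes p: "p > 0" and f: "extends_riesz p f h" and g: "extends_riesz p g k"
  shows "extends_riesz p (\<lambda>x. a * f x + b * g x) (\<lambda>x. a * h x + b * k x)"
proof -
  obtain q where q: "\<And>n. q n \<in> trig_polys" "(\<lambda>n. moment p (\<lambda>x. f x - q n x)) \<longlonglongrightarrow> 0"
    "(\<lambda>n. moment p (\<lambda>x. h x - riesz_poly (q n) x)) \<longlonglongrightarrow> 0" and fL: "f \<in> Lp_space m p" "h \<in> Lp_space m p"
    using f unfolding extends_riesz_def by blast
  obtain r where r: "\<And>n. r n \<in> trig_polys" "(\<lambda>n. moment p (\<lambda>x. g x - r n x)) \<longlonglongrightarrow> 0"
    "(\<lambda>n. moment p (\<lambda>x. k x - riesz_poly (r n) x)) \<longlonglongrightarrow> 0" and gL: "g \<in> Lp_space m p" "k \<in> Lp_space m p"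
    using g unfolding extends_riesz_def by blast
  have p0: "p \<ge> 0" using p by simp
  have "(\<lambda>n. moment p (\<lambda>x. a * (f x - q n x) + b * (g x - r n x))) \<longlonglongrightarrow> 0"
    by (rule moment_lincomb_tendsto_0[OF p _ q(2) _ r(2)])
      (intro Lp_diff(1) fL gL trig_polys_Lp[OF _ p] q(1) r(1) p0)+
  then have 1: "(\<lambda>n. moment p (\<lambda>x. a * f x + b * g x - (a * q n x + b * r n x))) \<longlonglongrightarrow> 0"
    by (simp add: algebra_simps)
  have "(\<lambda>n. moment p (\<lambda>x. a * (h x - riesz_poly (q n) x) + b * (k x - riesz_poly (r n) x))) \<longlonglongrightarrow> 0"
    by (rule moment_lincomb_tendsto_0[OF p _ q(3) _ r(3)])
      (intro Lp_diff(1) fL gL trig_polys_Lp[OF _ p] riesz_poly_trig q(1) r(1) p0)+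
  moreover have "riesz_poly (\<lambda>x. a * q n x + b * r n x) = (\<lambda>x. a * riesz_poly (q n) x + b * riesz_poly (r n) x)" for n
    using riesz_poly_add[OF trig_polys_scale[OF q(1)] trig_polys_scale[OF r(1)]]
      riesz_poly_scale[OF q(1)] riesz_poly_scale[OF r(1)] by simp
  ultimately have 2: "(\<lambda>n. moment p (\<lambda>x. a * h x + b * k x - riesz_poly (\<lambda>x. a * q n x + b * r n x) x)) \<longlonglongrightarrow> 0"
    by (simp add: algebra_simps)
  have "(\<lambda>x. a * f x + b * g x) \<in> Lp_space m p" "(\<lambda>x. a * h x + b * k x) \<in> Lp_space m p"
    by (intro Lp_add(1) Lp_scale(1) fL gL p0)+
  moreover have "(\<lambda>x. a * q n x + b * r n x) \<in> trig_polys" for n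
    by (intro trig_polys_add trig_polys_scale q(1) r(1))
  ultimately show ?thesis
    unfolding extends_riesz_def using 1 2 by (intro conjI exI[of _ "\<lambda>n x. a * q n x + b * r n x"]) auto
qed

lemma extends_riesz_bound:
  assumes p: "p > 0" and C: "C \<ge> 0" "riesz_bound p C" and f: "extends_riesz p f h"
  shows "moment p h \<le> 2 powr p * (C * (2 powr p * moment p f))"
proof -
  obtain q where q: "\<And>n. q n \<in> trig_polys" "(\<lambda>n. moment p (\<lambda>x. f x - q n x)) \<longlonglongrightarrow> 0"
    "(\<lambda>n. moment p (\<lambda>x. h x - riesz_poly (q n) x)) \<longlonglongrightarrow> 0" and fL: "f \<in> Lp_space m p" "h \<in> Lp_space m p"
    using f unfolding extends_riesz_def by blast
  have p0: "p \<ge> 0" using p by simp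
  note qL = trig_polys_Lp[OF q(1) p] and PqL = trig_polys_Lp[OF riesz_poly_trig[OF q(1)] p]
  have le: "moment p h \<le> 2 powr p * (moment p (\<lambda>x. h x - riesz_poly (q n) x)
      + C * (2 powr p * (moment p f + moment p (\<lambda>x. f x - q n x))))" for n
  proof -
    have "moment p h = moment p (\<lambda>x. (h x - riesz_poly (q n) x) + riesz_poly (q n) x)" by simp
    also have "\<dots> \<le> 2 powr p * (moment p (\<lambda>x. h x - riesz_poly (q n) x) + moment p (riesz_poly (q n)))"
      by (intro Lp_add(2) Lp_diff(1) fL PqL p0)
    also have "\<dots> \<le> 2 powr p * (moment p (\<lambda>x. h x - riesz_poly (q n) x) + C * moment p (q n))"
      using C(2) q(1) unfolding riesz_bound_def by (intro mult_left_mono add_left_mono) auto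
    also have "moment p (q n) = moment p (\<lambda>x. f x - (f x - q n x))" by simp
    also have "2 powr p * (moment p (\<lambda>x. h x - riesz_poly (q n) x) + C * moment p (\<lambda>x. f x - (f x - q n x)))
      \<le> 2 powr p * (moment p (\<lambda>x. h x - riesz_poly (q n) x)
      + C * (2 powr p * (moment p f + moment p (\<lambda>x. f x - q n x))))"
      using C(1) by (intro mult_left_mono add_left_mono Lp_diff(2) Lp_diff(1) fL qL p0) auto
    finally show ?thesis .
  qed
  have "(\<lambda>n. 2 powr p * (moment p (\<lambda>x. h x - riesz_poly (q n) x)
      + C * (2 powr p * (moment p f + moment p (\<lambda>x. f x - q n x)))))
      \<longlonglongrightarrow> 2 powr p * (0 + C * (2 powr p * (moment p f + 0)))"
    by (intro tendsto_intros q(2,3))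
  from LIMSEQ_le_const[OF this] le show ?thesis by auto
qed

lemma moment_eq_0_iff:
  assumes "f \<in> Lp_space m p"
  shows "moment p f = 0 \<longleftrightarrow> (AE x in m. f x = 0)"
proof -
  have "moment p f = 0 \<longleftrightarrow> (AE x in m. cmod (f x) powr p = 0)"
    unfolding moment_def by (rule integral_nonneg_eq_0_iff_AE[OF Lp_integrable_powr[OF assms]]) simp
  then show ?thesis by simp
qed

lemma extends_riesz_unique:
  assumes p: "p > 1" and "extends_riesz p f h" "extends_riesz p f k"
  shows "AE x in m. h x = k x"
proof -
  obtain C where C: "C \<ge> 0" "riesz_bound p C" using riesz_bound_exists[OF p] by blast
  have "extends_riesz p (\<lambda>x. 1 * f x + (-1) * f x) (\<lambda>x. 1 * h x + (-1) * k x)"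
    using p assms(2,3) by (intro extends_riesz_lincomb) auto
  then have e: "extends_riesz p (\<lambda>_. 0) (\<lambda>x. h x - k x)" by simp
  have "moment p (\<lambda>x. h x - k x) \<le> 2 powr p * (C * (2 powr p * moment p (\<lambda>_. 0)))"
    by (rule extends_riesz_bound[OF _ C e]) (use p in simp)
  then have "moment p (\<lambda>x. h x - k x) = 0"
    using moment_nonneg[of p "\<lambda>x. h x - k x"] p by simp
  moreover have "(\<lambda>x. h x - k x) \<in> Lp_space m p" using e by (simp add: extends_riesz_def)
  ultimately show ?thesis
    using moment_eq_0_iff by simp
qed

lemma fourier_tendsto:
  assumes p: "p > 1" and f: "f \<in> Lp_space m p" and g: "\<And>n. g n \<in> Lp_space m p"
    and lim: "(\<lambda>n. moment p (\<lambda>x. f x - g n x)) \<longlonglongrightarrow> 0" and \<xi>: "\<xi> \<in> characters"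
  shows "(\<lambda>n. fourier m (g n) \<xi>) \<longlonglongrightarrow> fourier m f \<xi>"
proof -
  have le: "cmod (fourier m f \<xi> - fourier m (g n) \<xi>) powr p \<le> moment p (\<lambda>x. f x - g n x)" for n
    using norm_fourier_powr_le[OF Lp_diff(1)[OF f g[of n]] p \<xi>] p
    by (simp add: fourier_diff Lp_integrable[OF f] Lp_integrable[OF g] \<xi>)
  have "(\<lambda>n. moment p (\<lambda>x. f x - g n x) powr (1 / p)) \<longlonglongrightarrow> 0 powr (1 / p)"
    using p moment_nonneg by (intro tendsto_powr' lim tendsto_const) (auto intro!: always_eventually)
  then have lim': "(\<lambda>n. moment p (\<lambda>x. f x - g n x) powr (1 / p)) \<longlonglongrightarrow> 0" by simp
  have "(\<lambda>n. fourier m f \<xi> - fourier m (g n) \<xi>) \<longlonglongrightarrow> 0"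
  proof (rule Lim_null_comparison[OF _ lim'], intro always_eventually allI)
    fix n
    have "(cmod (fourier m f \<xi> - fourier m (g n) \<xi>) powr p) powr (1 / p) \<le> moment p (\<lambda>x. f x - g n x) powr (1 / p)"
      using p le by (intro powr_mono2) auto
    then show "cmod (fourier m f \<xi> - fourier m (g n) \<xi>) \<le> moment p (\<lambda>x. f x - g n x) powr (1 / p)"
      using p by (simp add: powr_powr)
  qed
  then have "(\<lambda>n. fourier m f \<xi> - (fourier m f \<xi> - fourier m (g n) \<xi>)) \<longlonglongrightarrow> fourier m f \<xi> - 0"
    by (intro tendsto_diff tendsto_const)
  then show ?thesis by simp
qed

lemma fourier_extends_riesz:
  assumes p: "p > 1" and f: "extends_riesz p f h" and \<xi>: "\<xi> \<in> characters"
  shows "fourier m h \<xi> = (if \<xi> \<in> T then fourier m f \<xi> else 0)"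
proof -
  obtain q where q: "\<And>n. q n \<in> trig_polys" "(\<lambda>n. moment p (\<lambda>x. f x - q n x)) \<longlonglongrightarrow> 0"
    "(\<lambda>n. moment p (\<lambda>x. h x - riesz_poly (q n) x)) \<longlonglongrightarrow> 0" and fL: "f \<in> Lp_space m p" "h \<in> Lp_space m p"
    using f unfolding extends_riesz_def by blast
  have p0: "p > 0" using p by simp
  have 1: "(\<lambda>n. fourier m (q n) \<xi>) \<longlonglongrightarrow> fourier m f \<xi>"
    by (rule fourier_tendsto[OF p fL(1) trig_polys_Lp[OF q(1) p0] q(2) \<xi>])
  have 2: "(\<lambda>n. fourier m (riesz_poly (q n)) \<xi>) \<longlonglongrightarrow> fourier m h \<xi>"
    by (rule fourier_tendsto[OF p fL(2) trig_polys_Lp[OF riesz_poly_trig[OF q(1)] p0] q(3) \<xi>])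
  show ?thesis
  proof (cases "\<xi> \<in> T")
    case True
    then show ?thesis using 2 LIMSEQ_unique[OF 1] by (simp add: fourier_riesz_poly[OF q(1) \<xi>])
  next
    case False
    then show ?thesis using 2 by (simp add: fourier_riesz_poly[OF q(1) \<xi>] LIMSEQ_const_iff)
  qed
qed

lemma Lp_norm_eq_moment: "Lp_norm m p f = moment p f powr (1 / p)"
  by (simp add: Lp_norm_def moment_def)

text \<open>
  That the extension fixes \<open>H\<^sup>p\<close> does not follow from approximation alone, since the approximating
  polynomials need not be analytic; it follows from the Fourier coefficients by \<open>fourier_unique\<close>.
\<close>

theorem riesz_projection_exists:
  assumes p: "p > 1"
  shows "is_riesz_projection m T p (riesz_projection m T p)"
proof -
  obtain C where C: "C \<ge> 0" "riesz_bound p C" using riesz_bound_exists[OF p] by blast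
  define P where "P f = (SOME h. extends_riesz p f h)" for f
  have P: "extends_riesz p f (P f)" if "f \<in> Lp_space m p" for f
    unfolding P_def using extends_riesz_exists[OF p that] by (rule someI_ex)
  have PH: "P f \<in> Hp_space m T p" if "f \<in> Lp_space m p" for f
    using P[OF that] fourier_extends_riesz[OF p P[OF that]] by (auto simp: Hp_space_def extends_riesz_def)
  have p0: "p > 0" using p by simp
  have "is_riesz_projection m T p P"
    unfolding is_riesz_projection_def
  proof (intro conjI)
    show "P ` Lp_space m p \<subseteq> Hp_space m T p" using PH by blast
    show "linear_ae m (Lp_space m p) P"
      unfolding linear_ae_def
    proof (intro ballI allI)
      fix f g :: "'a \<Rightarrow> complex" and a b :: complex
      assume f: "f \<in> Lp_space m p" and g: "g \<in> Lp_space m p"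
      have e: "extends_riesz p (\<lambda>y. a * f y + b * g y) (\<lambda>y. a * P f y + b * P g y)"
        by (rule extends_riesz_lincomb[OF p0 P[OF f] P[OF g]])
      then have "(\<lambda>y. a * f y + b * g y) \<in> Lp_space m p" by (simp add: extends_riesz_def)
      from extends_riesz_unique[OF p P[OF this] e]
      show "AE x in m. P (\<lambda>y. a * f y + b * g y) x = a * P f x + b * P g x" .
    qed
    show "\<exists>C. \<forall>f\<in>Lp_space m p. Lp_norm m p (P f) \<le> C * Lp_norm m p f"
    proof (intro exI ballI)
      fix f :: "'a \<Rightarrow> complex" assume f: "f \<in> Lp_space m p"
      have "moment p (P f) \<le> (2 powr p * C * 2 powr p) * moment p f"
        using extends_riesz_bound[OF p0 C P[OF f]] by (simp add: mult.assoc)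
      then have "moment p (P f) powr (1 / p) \<le> ((2 powr p * C * 2 powr p) * moment p f) powr (1 / p)"
        using p moment_nonneg by (intro powr_mono2) auto
      then show "Lp_norm m p (P f) \<le> (2 powr p * C * 2 powr p) powr (1 / p) * Lp_norm m p f"
        unfolding Lp_norm_eq_moment powr_mult[of "2 powr p * C * 2 powr p"] .
    qed
    show "\<forall>f\<in>Hp_space m T p. AE x in m. P f x = f x"
    proof
      fix f assume f: "f \<in> Hp_space m T p"
      then have fL: "f \<in> Lp_space m p" by (simp add: Hp_space_def)
      have i: "integrable m f" "integrable m (P f)"
        using Lp_integrable[OF fL] Lp_integrable[of "P f" p] P[OF fL] p by (auto simp: extends_riesz_def)
      have "AE x in m. P f x - f x = 0"
      proof (rule fourier_unique)
        show "integrable m (\<lambda>x. P f x - f x)" using i by simp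
        show "fourier m (\<lambda>x. P f x - f x) \<xi> = 0" if "\<xi> \<in> characters" for \<xi>
          using fourier_extends_riesz[OF p P[OF fL] that] f that i
          by (auto simp: fourier_diff Hp_space_def)
      qed
      then show "AE x in m. P f x = f x" by simp
    qed
    show "\<forall>M c. finite M \<and> M \<subseteq> characters \<longrightarrow>
        (AE x in m. P (trig_poly M c) x = trig_poly (M \<inter> T) c x)"
    proof (intro allI impI, elim conjE)
      fix M c assume M: "finite M" "M \<subseteq> (characters :: ('a \<Rightarrow> complex) set)"
      have q: "trig_poly M c \<in> trig_polys" by (rule trig_poly_in[OF M])
      have MT: "finite (M \<inter> T)" "M \<inter> T \<subseteq> characters" using M by auto
      have "riesz_poly (trig_poly M c) = trig_poly (M \<inter> T) c"
        by (intro trig_polys_eqI riesz_poly_trig q trig_poly_in MT)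
          (simp add: fourier_riesz_poly[OF q] fourier_trig_poly[OF M] fourier_trig_poly[OF MT])
      with extends_riesz_unique[OF p P[OF trig_polys_Lp[OF q p0]] extends_riesz_trig[OF p0 q]]
      show "AE x in m. P (trig_poly M c) x = trig_poly (M \<inter> T) c x" by simp
    qed
  qed
  then show ?thesis
    unfolding riesz_projection_def by (rule someI[of "is_riesz_projection m T p"])
qed

end

section \<open>Compact semicommutators\<close>

lemma finite_family_convergent_subsequence:
  fixes a :: "nat \<Rightarrow> 'x \<Rightarrow> complex"
  assumes "finite F" "\<And>\<xi>. \<xi> \<in> F \<Longrightarrow> bounded (range (\<lambda>n. a n \<xi>))"
  shows "\<exists>r c. strict_mono r \<and> (\<forall>\<xi>\<in>F. (\<lambda>n. a (r n) \<xi>) \<longlonglongrightarrow> c \<xi>)"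
  using assms
proof (induction F)
  case empty
  show ?case by (intro exI[of _ id]) (auto simp: strict_mono_def)
next
  case (insert \<psi> F)
  then obtain r c where r: "strict_mono r" "\<And>\<xi>. \<xi> \<in> F \<Longrightarrow> (\<lambda>n. a (r n) \<xi>) \<longlonglongrightarrow> c \<xi>"
    by (metis insertCI)
  have "bounded (range (\<lambda>n. a (r n) \<psi>))"
    using insert.prems[of \<psi>] by (auto intro: bounded_subset)
  then obtain l s where s: "strict_mono s" "((\<lambda>n. a (r n) \<psi>) \<circ> s) \<longlonglongrightarrow> l"
    using bounded_imp_convergent_subsequence by blast
  have "(\<lambda>n. a ((r \<circ> s) n) \<xi>) \<longlonglongrightarrow> (c(\<psi> := l)) \<xi>" if "\<xi> \<in> insert \<psi> F" for \<xi>
  proof (cases "\<xi> = \<psi>")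
    case True
    then show ?thesis using s(2) by (simp add: o_def)
  next
    case False
    then have "(\<lambda>n. a (r n) \<xi>) \<longlonglongrightarrow> c \<xi>" using that r(2) by auto
    from LIMSEQ_subseq_LIMSEQ[OF this s(1)] False show ?thesis by (simp add: o_def)
  qed
  then show ?case using strict_mono_o[OF r(1) s(1)] by blast
qed

context ordered_haar
begin

lemma char_mult_cancel:
  assumes "\<xi> \<in> characters"
  shows "char_mult (conj_fun \<xi>) (char_mult \<xi> \<psi>) = \<psi>" "char_mult \<xi> (char_mult (conj_fun \<xi>) \<psi>) = \<psi>"
  using char_cnj_mult[OF assms] by (simp_all add: char_mult_def conj_fun_def fun_eq_iff mult.assoc[symmetric])

lemma mem_translate_iff:
  assumes "\<xi> \<in> T"
  shows "\<psi> \<in> char_mult \<xi> ` T \<longleftrightarrow> char_mult (conj_fun \<xi>) \<psi> \<in> T"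
  using char_mult_cancel[OF T_char[OF assms]] by (metis image_iff)

lemma Hp_Lp: "f \<in> Hp_space m T p \<Longrightarrow> f \<in> Lp_space m p"
  by (simp add: Hp_space_def)

lemma Lp_char_mult:
  assumes "f \<in> Lp_space m p" "\<xi> \<in> characters"
  shows "(\<lambda>x. \<xi> x * f x) \<in> Lp_space m p"
proof -
  have "(\<lambda>x. \<xi> x * f x) \<in> borel_measurable m"
    using char_measurable[OF assms(2)] Lp_measurable[OF assms(1)] by measurable
  then show ?thesis
    using assms by (simp add: Lp_space_def norm_mult)
qed

lemma fourier_char_mult:
  assumes "\<xi> \<in> characters"
  shows "fourier m (\<lambda>x. \<xi> x * f x) \<psi> = fourier m f (char_mult (conj_fun \<xi>) \<psi>)"
  using fourier_mult_conj[of "conj_fun \<xi>" f \<psi>] by (simp add: conj_fun_def)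

lemma Hp_char_mult:
  assumes f: "f \<in> Hp_space m T p" and \<xi>: "\<xi> \<in> T"
  shows "(\<lambda>x. \<xi> x * f x) \<in> Hp_space m T p"
  unfolding Hp_space_def
proof (intro CollectI conjI ballI)
  note \<xi>c = T_char[OF \<xi>]
  show "(\<lambda>x. \<xi> x * f x) \<in> Lp_space m p" by (rule Lp_char_mult[OF Hp_Lp[OF f] \<xi>c])
  fix \<psi> :: "'a \<Rightarrow> complex" assume \<psi>: "\<psi> \<in> characters - T"
  have "char_mult (conj_fun \<xi>) \<psi> \<notin> T"
    using \<psi> T_mult[OF \<xi>, of "char_mult (conj_fun \<xi>) \<psi>"] char_mult_cancel(2)[OF \<xi>c, of \<psi>] by auto
  then have "char_mult (conj_fun \<xi>) \<psi> \<in> characters - T"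
    using \<psi> \<xi>c char_conj char_char_mult by blast
  then show "fourier m (\<lambda>x. \<xi> x * f x) \<psi> = 0"
    unfolding fourier_char_mult[OF \<xi>c] using f by (auto simp: Hp_space_def)
qed

lemma Hp_lincomb:
  assumes f: "f \<in> Hp_space m T p" and g: "g \<in> Hp_space m T p" and p: "p \<ge> 1"
  shows "(\<lambda>x. a * f x + b * g x) \<in> Hp_space m T p"
proof -
  have i: "integrable m f" "integrable m g" using Lp_integrable[OF Hp_Lp] f g p by auto
  have "(\<lambda>x. a * f x + b * g x) \<in> Lp_space m p"
    using p by (intro Lp_add(1) Lp_scale(1) Hp_Lp f g) auto
  moreover have "fourier m (\<lambda>x. a * f x + b * g x) \<psi> = 0" if "\<psi> \<in> characters - T" for \<psi>
  proof -
    have "fourier m (\<lambda>x. a * f x + b * g x) \<psi> = a * fourier m f \<psi> + b * fourier m g \<psi>"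
      using i that by (simp add: fourier_add fourier_scale)
    then show ?thesis using f g that by (simp add: Hp_space_def)
  qed
  ultimately show ?thesis by (simp add: Hp_space_def)
qed

lemma Hp_diff:
  "f \<in> Hp_space m T p \<Longrightarrow> g \<in> Hp_space m T p \<Longrightarrow> p \<ge> 1 \<Longrightarrow> (\<lambda>x. f x - g x) \<in> Hp_space m T p"
  using Hp_lincomb[of f p g 1 "-1"] by simp

lemma analytic_Hp: "f \<in> analytic_polys \<Longrightarrow> p > 0 \<Longrightarrow> f \<in> Hp_space m T p"
  unfolding Hp_space_def analytic_iff by (simp add: trig_polys_Lp)

lemma norm_fourier_le_Lp_norm:
  assumes f: "f \<in> Lp_space m p" and p: "p > 1" and \<xi>: "\<xi> \<in> characters"
  shows "cmod (fourier m f \<xi>) \<le> Lp_norm m p f"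
proof -
  have "(cmod (fourier m f \<xi>) powr p) powr (1 / p) \<le> moment p f powr (1 / p)"
    using p norm_fourier_powr_le[OF f p \<xi>] by (intro powr_mono2) auto
  then show ?thesis using p by (simp add: powr_powr Lp_norm_eq_moment)
qed

lemma moment_cong_AE:
  assumes "AE x in m. f x = g x" "f \<in> borel_measurable m" "g \<in> borel_measurable m"
  shows "moment p f = moment p g"
  unfolding moment_def using assms by (intro integral_cong_AE) auto

end

locale riesz_haar = ordered_haar m T
  for m :: "'a::{topological_ab_group_add, t2_space} measure" and T +
  fixes p :: real
  assumes p: "1 < p"
begin

definition P :: "('a \<Rightarrow> complex) \<Rightarrow> 'a \<Rightarrow> complex" where
  "P = riesz_projection m T p"

lemma P_riesz: "is_riesz_projection m T p P"
  unfolding P_def by (rule riesz_projection_exists[OF p])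

lemmas P_conjuncts = P_riesz[unfolded is_riesz_projection_def]

lemma P_Hp: "f \<in> Lp_space m p \<Longrightarrow> P f \<in> Hp_space m T p"
  using P_conjuncts[THEN conjunct1] by (rule subsetD[OF _ imageI])

lemma P_linear: "linear_ae m (Lp_space m p) P"
  by (rule P_conjuncts[THEN conjunct2, THEN conjunct1])

lemma P_id: "f \<in> Hp_space m T p \<Longrightarrow> AE x in m. P f x = f x"
  using P_conjuncts[THEN conjunct2, THEN conjunct2, THEN conjunct2, THEN conjunct1] by (rule bspec)

lemma P_trig: "finite M \<Longrightarrow> M \<subseteq> characters \<Longrightarrow> AE x in m. P (trig_poly M c) x = trig_poly (M \<inter> T) c x"
  using P_conjuncts[THEN conjunct2, THEN conjunct2, THEN conjunct2, THEN conjunct2] by simp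

lemma P_add:
  assumes "f \<in> Lp_space m p" "g \<in> Lp_space m p"
  shows "AE x in m. P (\<lambda>y. f y + g y) x = P f x + P g x"
proof -
  have "AE x in m. P (\<lambda>y. 1 * f y + 1 * g y) x = 1 * P f x + 1 * P g x"
    using P_linear[unfolded linear_ae_def, rule_format, OF assms] .
  then show ?thesis by simp
qed

lemma semicommutator_eq:
  assumes "\<xi> \<in> characters"
  shows "semicommutator m T p \<xi> (conj_fun \<xi>) f =
    (\<lambda>x. P (\<lambda>x. \<xi> x * P (\<lambda>x. conj_fun \<xi> x * f x) x) x - P f x)"
  using char_cnj_mult(2)[OF assms]
  by (simp add: semicommutator_def toeplitz_def P_def conj_fun_def)

lemma conj_mult_Lp:
  assumes "f \<in> Hp_space m T p" "\<xi> \<in> T"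
  shows "(\<lambda>x. conj_fun \<xi> x * f x) \<in> Lp_space m p"
  by (rule Lp_char_mult[OF Hp_Lp[OF assms(1)] char_conj[OF T_char[OF assms(2)]]])

lemma semicommutator_Hp:
  assumes f: "f \<in> Hp_space m T p" and \<xi>: "\<xi> \<in> T"
  shows "semicommutator m T p \<xi> (conj_fun \<xi>) f \<in> Hp_space m T p"
  unfolding semicommutator_eq[OF T_char[OF \<xi>]] using p
  by (intro Hp_diff P_Hp Hp_Lp[OF f] Hp_Lp[OF Hp_char_mult[OF _ \<xi>]] conj_mult_Lp[OF f \<xi>]) auto

lemma semicommutator_AE:
  assumes f: "f \<in> Hp_space m T p" and \<xi>: "\<xi> \<in> T"
  shows "AE x in m. semicommutator m T p \<xi> (conj_fun \<xi>) f x = \<xi> x * P (\<lambda>x. conj_fun \<xi> x * f x) x - f x"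
  unfolding semicommutator_eq[OF T_char[OF \<xi>]]
  using P_id[OF Hp_char_mult[OF P_Hp[OF conj_mult_Lp[OF f \<xi>]] \<xi>]] P_id[OF f]
  by eventually_elim simp

text \<open>
  Multiplication by the conjugate of \<open>\<xi>\<close> moves every character in \<open>T - \<xi>T\<close> out of \<open>T\<close>, where the Riesz
  projection vanishes.
\<close>

lemma semicommutator_trig_poly:
  assumes \<xi>: "\<xi> \<in> T" and F: "finite F" "F \<subseteq> T - char_mult \<xi> ` T"
  shows "AE x in m. P (\<lambda>x. conj_fun \<xi> x * trig_poly F c x) x = 0"
proof -
  note \<xi>c = T_char[OF \<xi>]
  let ?M = "char_mult (conj_fun \<xi>) ` F"
  have inj: "inj_on (char_mult (conj_fun \<xi>)) F"
    by (rule inj_on_inverseI[of _ "char_mult \<xi>"]) (rule char_mult_cancel(2)[OF \<xi>c])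
  have "(\<lambda>x. conj_fun \<xi> x * trig_poly F c x) = trig_poly ?M (\<lambda>\<psi>. c (char_mult \<xi> \<psi>))"
    unfolding trig_poly_def sum.reindex[OF inj]
    by (simp add: char_mult_cancel[OF \<xi>c] sum_distrib_left) (simp add: char_mult_def mult_ac)
  moreover have "?M \<inter> T = {}"
    using F(2) mem_translate_iff[OF \<xi>] by auto
  moreover have "finite ?M" "?M \<subseteq> characters"
    using F T_char char_conj[OF \<xi>c] char_char_mult by blast+
  ultimately show ?thesis
    using P_trig[of ?M "\<lambda>\<psi>. c (char_mult \<xi> \<psi>)"] by (simp add: trig_poly_def)
qed

text \<open>
  Let \<open>g\<close> be the part of \<open>f\<close> with spectrum in \<open>T - \<xi>T\<close>. The spectrum of \<open>f - g\<close> lies in \<open>\<xi>T\<close>, so after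
  division by \<open>\<xi>\<close> this function is still in \<open>H\<^sup>p\<close> and is fixed by \<open>P\<close>, while the quotient of \<open>g\<close> by \<open>\<xi>\<close> is
  annihilated.
\<close>

lemma semicommutator_finite:
  assumes f: "f \<in> Hp_space m T p" and \<xi>: "\<xi> \<in> T" and fin: "finite (T - char_mult \<xi> ` T)"
  shows "AE x in m. semicommutator m T p \<xi> (conj_fun \<xi>) f x
    = - trig_poly (T - char_mult \<xi> ` T) (fourier m f) x"
proof -
  note \<xi>c = T_char[OF \<xi>]
  let ?F = "T - char_mult \<xi> ` T"
  define g where "g = trig_poly ?F (fourier m f)"
  have Fc: "?F \<subseteq> characters" using T_char by blast
  have gt: "g \<in> trig_polys" unfolding g_def by (rule trig_poly_in[OF fin Fc])
  have fg: "fourier m g \<psi> = (if \<psi> \<in> ?F then fourier m f \<psi> else 0)" if "\<psi> \<in> characters" for \<psi>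
    unfolding g_def by (rule fourier_trig_poly[OF fin Fc that])
  have gL: "g \<in> Lp_space m p" using p by (intro trig_polys_Lp gt) auto
  have fL: "f \<in> Lp_space m p" by (rule Hp_Lp[OF f])
  have i: "integrable m f" "integrable m g" using p by (auto intro: Lp_integrable fL gL)
  let ?d = "\<lambda>x. f x - g x"
  have dL: "?d \<in> Lp_space m p" using p by (intro Lp_diff(1) fL gL) auto
  have conjL: "(\<lambda>x. conj_fun \<xi> x * u x) \<in> Lp_space m p" if "u \<in> Lp_space m p" for u
    by (rule Lp_char_mult[OF that char_conj[OF \<xi>c]])
  have "(\<lambda>x. conj_fun \<xi> x * ?d x) \<in> Hp_space m T p"
    unfolding Hp_space_def
  proof (intro CollectI conjI ballI conjL dL)
    fix \<psi> :: "'a \<Rightarrow> complex" assume \<psi>: "\<psi> \<in> characters - T"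
    have mc: "char_mult \<xi> \<psi> \<in> characters" using \<psi> \<xi>c char_char_mult by blast
    have "fourier m (\<lambda>x. conj_fun \<xi> x * ?d x) \<psi> = fourier m f (char_mult \<xi> \<psi>) - fourier m g (char_mult \<xi> \<psi>)"
      unfolding fourier_char_mult[OF char_conj[OF \<xi>c]] conj_fun_conj_fun by (rule fourier_diff[OF i mc])
    also have "\<dots> = 0"
    proof (cases "char_mult \<xi> \<psi> \<in> T")
      case True
      then have "char_mult \<xi> \<psi> \<in> ?F"
        using \<psi> mem_translate_iff[OF \<xi>, of "char_mult \<xi> \<psi>"] char_mult_cancel(1)[OF \<xi>c, of \<psi>] by auto
      then show ?thesis by (simp add: fg[OF mc])
    next
      case False
      then have "fourier m f (char_mult \<xi> \<psi>) = 0" using f mc by (auto simp: Hp_space_def)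
      then show ?thesis by (simp add: fg[OF mc])
    qed
    finally show "fourier m (\<lambda>x. conj_fun \<xi> x * ?d x) \<psi> = 0" .
  qed
  from P_id[OF this] have 1: "AE x in m. P (\<lambda>x. conj_fun \<xi> x * ?d x) x = conj_fun \<xi> x * ?d x" .
  have 2: "AE x in m. P (\<lambda>x. conj_fun \<xi> x * g x) x = 0"
    unfolding g_def by (rule semicommutator_trig_poly[OF \<xi> fin]) simp
  have "(\<lambda>x. conj_fun \<xi> x * ?d x + conj_fun \<xi> x * g x) = (\<lambda>x. conj_fun \<xi> x * f x)"
    by (simp add: algebra_simps)
  with P_add[OF conjL[OF dL] conjL[OF gL]]
  have 3: "AE x in m. P (\<lambda>x. conj_fun \<xi> x * f x) x = P (\<lambda>x. conj_fun \<xi> x * ?d x) x + P (\<lambda>x. conj_fun \<xi> x * g x) x"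
    by simp
  show ?thesis
    using semicommutator_AE[OF f \<xi>] 1 2 3
  proof eventually_elim
    case (elim x)
    have eq: "\<xi> x * (conj_fun \<xi> x * ?d x) = ?d x"
      using char_cnj_mult(2)[OF \<xi>c, of x] by (simp add: conj_fun_def mult.assoc[symmetric])
    have "semicommutator m T p \<xi> (conj_fun \<xi>) f x = \<xi> x * (conj_fun \<xi> x * ?d x) - f x"
      using elim by (simp only: add_0_right)
    also have "\<dots> = - g x" unfolding eq by simp
    finally show ?case unfolding g_def .
  qed
qed

text \<open>
  The operator depends only on finitely many Fourier coefficients, and these are bounded by the
  norm; so a subsequence of any bounded sequence makes all of them converge.
\<close>

lemma compact_if_finite:
  assumes \<xi>: "\<xi> \<in> T" and fin: "finite (T - char_mult \<xi> ` T)"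
  shows "compact_operator_Hp m T p (semicommutator m T p \<xi> (conj_fun \<xi>))"
proof -
  let ?K = "semicommutator m T p \<xi> (conj_fun \<xi>)" and ?F = "T - char_mult \<xi> ` T"
  have Fc: "?F \<subseteq> characters" using T_char by blast
  note K = semicommutator_finite[OF _ \<xi> fin]
  have p1: "p \<ge> 1" "p > 0" using p by auto
  show ?thesis
    unfolding compact_operator_Hp_def
  proof (intro conjI allI impI)
    show "?K ` Hp_space m T p \<subseteq> Hp_space m T p"
      using semicommutator_Hp[OF _ \<xi>] by blast
    show "linear_ae m (Hp_space m T p) ?K"
      unfolding linear_ae_def
    proof (intro ballI allI)
      fix f g :: "'a \<Rightarrow> complex" and a b :: complex
      assume f: "f \<in> Hp_space m T p" and g: "g \<in> Hp_space m T p"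
      have i: "integrable m f" "integrable m g" using Lp_integrable[OF Hp_Lp] f g p1 by auto
      have four: "fourier m (\<lambda>y. a * f y + b * g y) \<psi> = a * fourier m f \<psi> + b * fourier m g \<psi>"
        if "\<psi> \<in> ?F" for \<psi>
        using i that Fc by (subst fourier_add) (auto simp: fourier_scale)
      have lin: "trig_poly ?F (fourier m (\<lambda>y. a * f y + b * g y)) x =
          a * trig_poly ?F (fourier m f) x + b * trig_poly ?F (fourier m g) x" for x
        unfolding trig_poly_def sum_distrib_left sum.distrib[symmetric]
        by (intro sum.cong refl) (simp add: four algebra_simps)
      show "AE x in m. ?K (\<lambda>y. a * f y + b * g y) x = a * ?K f x + b * ?K g x"
        using K[OF f] K[OF g] K[OF Hp_lincomb[OF f g p1(1), of a b]]
        by eventually_elim (simp add: lin)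
    qed
    fix f :: "nat \<Rightarrow> 'a \<Rightarrow> complex"
    assume "range f \<subseteq> Hp_space m T p \<and> bounded (range (\<lambda>n. Lp_norm m p (f n)))"
    then have f: "\<And>n. f n \<in> Hp_space m T p" and b: "bounded (range (\<lambda>n. Lp_norm m p (f n)))" by auto
    obtain B where B: "\<And>n. \<bar>Lp_norm m p (f n)\<bar> \<le> B"
      using b by (auto simp: bounded_iff)
    have "bounded (range (\<lambda>n. fourier m (f n) \<psi>))" if \<psi>: "\<psi> \<in> ?F" for \<psi>
    proof -
      have "cmod (fourier m (f n) \<psi>) \<le> B" for n
        using norm_fourier_le_Lp_norm[OF Hp_Lp[OF f[of n]] p, of \<psi>] \<psi> Fc B[of n] by auto
      then show ?thesis by (auto simp: bounded_iff)
    qed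
    from finite_family_convergent_subsequence[OF fin, of "\<lambda>n. fourier m (f n)", OF this]
    obtain r c where r: "strict_mono r" and c: "\<And>\<psi>. \<psi> \<in> ?F \<Longrightarrow> (\<lambda>n. fourier m (f (r n)) \<psi>) \<longlonglongrightarrow> c \<psi>"
      by blast
    define g where "g x = - trig_poly ?F c x" for x
    have "g \<in> analytic_polys"
    proof -
      have "(\<lambda>x. (-1) * (\<Sum>\<psi>\<in>?F. c \<psi> * \<psi> x)) \<in> analytic_polys"
        using fin by (intro analytic_scale analytic_sum analytic_char) auto
      then show ?thesis unfolding g_def trig_poly_def by simp
    qed
    then have g: "g \<in> Hp_space m T p" using p1 by (intro analytic_Hp)
    define s where "s n = (\<Sum>\<psi>\<in>?F. cmod (c \<psi> - fourier m (f (r n)) \<psi>))" for n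
    have s0: "s n \<ge> 0" for n unfolding s_def by (intro sum_nonneg) simp
    have "s \<longlonglongrightarrow> (\<Sum>\<psi>\<in>?F. cmod (c \<psi> - c \<psi>))"
      unfolding s_def by (intro tendsto_sum tendsto_norm tendsto_diff tendsto_const c)
    then have s: "s \<longlonglongrightarrow> 0" by simp
    have le: "Lp_norm m p (\<lambda>x. ?K (f (r n)) x - g x) \<le> s n" for n
    proof -
      let ?q = "trig_poly ?F (\<lambda>\<psi>. c \<psi> - fourier m (f (r n)) \<psi>)"
      have qt: "?q \<in> trig_polys" by (rule trig_poly_in[OF fin Fc])
      have "moment p (\<lambda>x. ?K (f (r n)) x - g x) = moment p ?q"
      proof (rule moment_cong_AE)
        show "AE x in m. ?K (f (r n)) x - g x = ?q x"
          using K[OF f[of "r n"]]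
          by eventually_elim (simp add: g_def trig_poly_def left_diff_distrib sum_subtractf)
        show "(\<lambda>x. ?K (f (r n)) x - g x) \<in> borel_measurable m"
          using p1 by (intro Lp_measurable[of _ p] Hp_Lp Hp_diff semicommutator_Hp f \<xi> g)
        show "?q \<in> borel_measurable m"
          by (intro continuous_measurable trig_polys_continuous qt)
      qed
      also have "\<dots> \<le> moment p (\<lambda>_. of_real (s n))"
      proof (rule Lp_mono(2))
        show "(\<lambda>_. of_real (s n)) \<in> Lp_space m p" by (intro trig_polys_Lp trig_polys_const p1)
        show "?q \<in> borel_measurable m"
          by (intro continuous_measurable trig_polys_continuous qt)
        fix x
        have "cmod (?q x) \<le> (\<Sum>\<psi>\<in>?F. cmod ((c \<psi> - fourier m (f (r n)) \<psi>) * \<psi> x))"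
          unfolding trig_poly_def by (rule norm_sum)
        also have "\<dots> = s n"
          unfolding s_def using Fc by (intro sum.cong refl) (auto simp: norm_mult)
        finally show "cmod (?q x) \<le> cmod (of_real (s n))" by simp
      qed (use p1 in auto)
      also have "\<dots> = s n powr p" using s0[of n] by simp
      finally have "moment p (\<lambda>x. ?K (f (r n)) x - g x) powr (1 / p) \<le> (s n powr p) powr (1 / p)"
        using p1 by (intro powr_mono2 moment_nonneg) auto
      then show ?thesis
        using p1 s0[of n] by (simp add: Lp_norm_eq_moment powr_powr)
    qed
    have "(\<lambda>n. Lp_norm m p (\<lambda>x. ?K (f (r n)) x - g x)) \<longlonglongrightarrow> 0"
      by (rule tendsto_sandwich[OF _ _ tendsto_const s])
        (use le in \<open>simp_all add: Lp_norm_def\<close>)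
    then show "\<exists>g\<in>Hp_space m T p. \<exists>r. strict_mono r \<and>
        (\<lambda>n. Lp_norm m p (\<lambda>x. ?K (f (r n)) x - g x)) \<longlonglongrightarrow> 0"
      using g r by blast
  qed
qed

text \<open>
  For distinct characters \<open>e n\<close> in \<open>T - \<xi>T\<close> the image of \<open>e n\<close> is \<open>- e n\<close>. A limit \<open>g\<close> of a subsequence has
  vanishing Fourier coefficient at every \<open>e k\<close>, because \<open>- e n\<close> has for \<open>n > k\<close>; but then the coefficient
  of \<open>- e n - g\<close> at \<open>e n\<close> is \<open>-1\<close> for all \<open>n\<close>, which contradicts convergence.
\<close>

lemma finite_if_compact:
  assumes \<xi>: "\<xi> \<in> T" and comp: "compact_operator_Hp m T p (semicommutator m T p \<xi> (conj_fun \<xi>))"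
  shows "finite (T - char_mult \<xi> ` T)"
proof (rule ccontr)
  let ?K = "semicommutator m T p \<xi> (conj_fun \<xi>)" and ?F = "T - char_mult \<xi> ` T"
  assume "infinite ?F"
  then obtain e :: "nat \<Rightarrow> 'a \<Rightarrow> complex" where e: "inj e" "range e \<subseteq> ?F"
    using infinite_countable_subset by blast
  have eT: "e n \<in> T" and eF: "e n \<in> ?F" for n using e(2) by auto
  note ec = T_char[OF eT]
  have p1: "p \<ge> 1" "p > 0" using p by auto
  have eH: "e n \<in> Hp_space m T p" for n using p1 by (intro analytic_Hp analytic_char eT)
  have Ke: "AE x in m. ?K (e n) x = - e n x" for n
  proof -
    have "trig_poly {e n} (\<lambda>_. 1) = e n" by (simp add: trig_poly_def)
    then have "AE x in m. P (\<lambda>x. conj_fun \<xi> x * e n x) x = 0"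
      using semicommutator_trig_poly[OF \<xi>, of "{e n}" "\<lambda>_. 1"] eF by simp
    with semicommutator_AE[OF eH[of n] \<xi>] show ?thesis by eventually_elim simp
  qed
  have "Lp_norm m p (e n) = 1" for n
    by (simp add: Lp_norm_def ec)
  then have "range e \<subseteq> Hp_space m T p \<and> bounded (range (\<lambda>n. Lp_norm m p (e n)))"
    using eH by (auto simp: bounded_iff)
  from comp[unfolded compact_operator_Hp_def, THEN conjunct2, THEN conjunct2, rule_format, OF this]
  obtain g r where g: "g \<in> Hp_space m T p" and r: "strict_mono r"
    and lim: "(\<lambda>n. Lp_norm m p (\<lambda>x. ?K (e (r n)) x - g x)) \<longlonglongrightarrow> 0"
    by blast
  have KL: "(\<lambda>x. ?K (e n) x - g x) \<in> Lp_space m p" for n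
    using p1 by (intro Hp_Lp Hp_diff semicommutator_Hp eH \<xi> g)
  have four: "fourier m (\<lambda>x. ?K (e n) x - g x) (e k) = - (if n = k then 1 else 0) - fourier m g (e k)" for n k
  proof -
    have "fourier m (\<lambda>x. ?K (e n) x - g x) (e k) = fourier m (?K (e n)) (e k) - fourier m g (e k)"
      using p1 by (intro fourier_diff ec Lp_integrable[of _ p] Hp_Lp semicommutator_Hp eH \<xi> g)
    also have "fourier m (?K (e n)) (e k) = fourier m (\<lambda>x. (-1) * e n x) (e k)"
      unfolding fourier_def
    proof (rule integral_cong_AE)
      have ce: "(\<lambda>x. cnj (e k x)) \<in> borel_measurable m"
        using char_measurable[OF char_conj[OF ec[of k]]] by (simp add: conj_fun_def)
      show "(\<lambda>x. ?K (e n) x * cnj (e k x)) \<in> borel_measurable m"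
        by (intro borel_measurable_times ce Lp_measurable[of _ p] Hp_Lp semicommutator_Hp eH \<xi>)
      show "(\<lambda>x. (-1) * e n x * cnj (e k x)) \<in> borel_measurable m"
        by (intro borel_measurable_times borel_measurable_const ce char_measurable ec)
      show "AE x in m. ?K (e n) x * cnj (e k x) = (-1) * e n x * cnj (e k x)"
        using Ke[of n] by eventually_elim simp
    qed
    also have "\<dots> = - (if n = k then 1 else 0)"
      unfolding fourier_scale using fourier_char[OF ec[of n] ec[of k]] e(1) by (simp add: inj_eq)
    finally show ?thesis .
  qed
  have le: "cmod (- (if r n = k then 1 else 0) - fourier m g (e k)) \<le> Lp_norm m p (\<lambda>x. ?K (e (r n)) x - g x)" for n k
    using norm_fourier_le_Lp_norm[OF KL p ec[of k], of "r n"] unfolding four .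
  have "fourier m g (e k) = 0" for k
  proof -
    have "cmod (fourier m g (e k)) \<le> Lp_norm m p (\<lambda>x. ?K (e (r n)) x - g x)" if "n \<ge> Suc k" for n
    proof -
      have "r n \<noteq> k" using seq_suble[OF r, of n] that by auto
      then show ?thesis using le[of n k] by simp
    qed
    then have "cmod (fourier m g (e k)) \<le> 0"
      by (intro LIMSEQ_le_const[OF lim]) blast
    then show ?thesis by simp
  qed
  then have "1 \<le> Lp_norm m p (\<lambda>x. ?K (e (r n)) x - g x)" for n
    using le[of n "r n"] by simp
  then have "(1::real) \<le> 0" by (intro LIMSEQ_le_const[OF lim]) blast
  then show False by simp
qed

text \<open>
  If \<open>\<xi>1 = \<xi> \<xi>2\<close> then \<open>\<xi>1 T \<subseteq> \<xi> T\<close>, so \<open>T - \<xi> T\<close> is finite along with \<open>T - \<xi>1 T\<close>. In the converse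
  direction \<open>\<xi>\<close> is its own quotient by the unit character.
\<close>

lemma indexed_iff:
  assumes \<xi>: "\<xi> \<in> T"
  shows "\<xi> \<in> indexed_characters T \<longleftrightarrow> finite (T - char_mult \<xi> ` T)"
proof
  assume "\<xi> \<in> indexed_characters T"
  then obtain \<xi>1 \<xi>2 where x: "\<xi> = char_mult \<xi>1 (conj_fun \<xi>2)" "\<xi>1 \<in> T" "\<xi>2 \<in> T"
    "finite (T - char_mult \<xi>1 ` T)"
    unfolding indexed_characters_def by blast
  have "char_mult \<xi>1 \<psi> = char_mult \<xi> (char_mult \<xi>2 \<psi>)" for \<psi>
    using char_cnj_mult(1)[OF T_char[OF x(3)]]
    by (simp add: x(1) char_mult_def conj_fun_def fun_eq_iff)
  then have "char_mult \<xi>1 ` T \<subseteq> char_mult \<xi> ` T"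
    using T_mult[OF x(3)] by auto
  then show "finite (T - char_mult \<xi> ` T)"
    by (intro finite_subset[OF _ x(4)]) blast
next
  assume fin: "finite (T - char_mult \<xi> ` T)"
  have "\<xi> = char_mult \<xi> (conj_fun (\<lambda>_. 1))" "char_mult (\<lambda>_. 1) ` T = T"
    by (simp_all add: char_mult_def conj_fun_def)
  then show "\<xi> \<in> indexed_characters T"
    unfolding indexed_characters_def using \<xi> T_one fin
    by (intro CollectI exI[of _ \<xi>] exI[of _ "\<lambda>_. 1"]) simp
qed

end

section \<open>The circle group\<close>

lemma unit_complex_cases:
  assumes "cmod w = 1" "Re w = cos t"
  shows "w = cis t \<or> w = cis (- t)"
proof -
  have "(Im w)\<^sup>2 = (sin t)\<^sup>2"
    using assms cmod_power2[of w] by (simp add: sin_squared_eq)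
  then have "Im w = sin t \<or> Im w = - sin t" by (simp add: power2_eq_iff)
  then show ?thesis using assms(2) by (auto simp: complex_eq_iff)
qed

text \<open>
  By connectedness the real part of \<open>\<eta>\<close> takes all values in an interval ending at 1, so the
  image contains an arc around 1; and it is a group.
\<close>

lemma character_surj_circle:
  fixes \<eta> :: "'a::topological_ab_group_add \<Rightarrow> complex"
  assumes conn: "connected (UNIV :: 'a set)" and \<eta>: "\<eta> \<in> characters" and nt: "\<eta> \<noteq> (\<lambda>_. 1)"
  shows "range \<eta> = sphere 0 1"
proof
  show "range \<eta> \<subseteq> sphere 0 1" using char_norm[OF \<eta>] by auto
  have \<eta>0: "\<eta> 0 = 1"
  proof -
    have "\<eta> 0 * \<eta> 0 = \<eta> 0" using char_add[OF \<eta>, of 0 0] by simp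
    moreover have "\<eta> 0 \<noteq> 0" using char_norm[OF \<eta>, of 0] by auto
    ultimately show ?thesis by simp
  qed
  have neg: "\<eta> (- x) = cnj (\<eta> x)" for x
  proof -
    have "\<eta> (- x) * \<eta> x * cnj (\<eta> x) = cnj (\<eta> x)"
      using char_add[OF \<eta>, of "- x" x] \<eta>0 by simp
    then show ?thesis using char_cnj_mult(2)[OF \<eta>, of x] by (simp add: mult.assoc)
  qed
  have pow: "\<exists>y. \<eta> y = \<eta> x ^ n" for x n
  proof (induction n)
    case 0
    then show ?case using \<eta>0 by (intro exI[of _ 0]) simp
  next
    case (Suc n)
    then obtain y where "\<eta> y = \<eta> x ^ n" by blast
    then show ?case by (intro exI[of _ "x + y"]) (simp add: char_add[OF \<eta>])
  qed
  obtain a where a: "\<eta> a \<noteq> 1" using nt by auto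
  have "Re (\<eta> a) \<noteq> 1"
  proof
    assume "Re (\<eta> a) = 1"
    then have "Im (\<eta> a) = 0" using cmod_power2[of "\<eta> a"] char_norm[OF \<eta>, of a] by simp
    then show False using a \<open>Re (\<eta> a) = 1\<close> by (simp add: complex_eq_iff)
  qed
  then have c: "Re (\<eta> a) < 1"
    using complex_Re_le_cmod[of "\<eta> a"] char_norm[OF \<eta>, of a] by simp
  have "connected ((\<lambda>x. Re (\<eta> x)) ` UNIV)"
    by (intro connected_continuous_image conn continuous_on_Re char_continuous[OF \<eta>])
  then have interval: "t \<in> range (\<lambda>x. Re (\<eta> x))" if "Re (\<eta> a) \<le> t" "t \<le> 1" for t
    using that \<eta>0 connectedD_interval[of "range (\<lambda>x. Re (\<eta> x))" "Re (\<eta> a)" 1 t]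
    by (metis one_complex.simps(1) rangeI)
  show "sphere 0 1 \<subseteq> range \<eta>"
  proof
    fix z :: complex assume "z \<in> sphere 0 1"
    then have z: "z = cis (Arg z)" using rcis_cmod_Arg[of z] by (simp add: rcis_def)
    have "(\<lambda>n. cos (Arg z * inverse (real (Suc n)))) \<longlonglongrightarrow> cos (Arg z * 0)"
      by (intro tendsto_cos tendsto_mult tendsto_const LIMSEQ_inverse_real_of_nat)
    then have "\<forall>\<^sub>F n in sequentially. Re (\<eta> a) < cos (Arg z * inverse (real (Suc n)))"
      using c by (intro order_tendstoD(1)) auto
    then obtain n where n: "Re (\<eta> a) < cos (Arg z * inverse (real (Suc n)))"
      by (auto simp: eventually_sequentially)
    define t where "t = Arg z * inverse (real (Suc n))"
    obtain x where "Re (\<eta> x) = cos t"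
      using interval[of "cos t"] n by (auto simp: t_def)
    then have "\<eta> x = cis t \<or> \<eta> x = cis (- t)"
      using unit_complex_cases char_norm[OF \<eta>] by blast
    then obtain y where "\<eta> y = cis t"
      using neg[of x] by (auto simp: cis_cnj)
    then obtain w where "\<eta> w = cis t ^ Suc n" using pow[of y "Suc n"] by metis
    also have "\<dots> = cis (real (Suc n) * t)" by (rule Complex.DeMoivre)
    also have "real (Suc n) * t = Arg z" by (simp add: t_def)
    finally show "z \<in> range \<eta>" using z by (metis rangeI)
  qed
qed

context ordered_haar
begin

text \<open>
  Since \<open>\<xi> \<le> \<psi>\<close> means \<open>\<psi> \<in> \<xi>T\<close> for \<open>\<psi> \<in> T\<close>, these are the elements of the cone strictly below \<open>\<xi>\<close>.
\<close>

definition below :: "('a \<Rightarrow> complex) \<Rightarrow> ('a \<Rightarrow> complex) set" where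
  "below \<xi> = T - char_mult \<xi> ` T"

lemma below_iff: "\<xi> \<in> T \<Longrightarrow> \<psi> \<in> below \<xi> \<longleftrightarrow> \<psi> \<in> T \<and> char_mult (conj_fun \<xi>) \<psi> \<notin> T"
  by (simp add: below_def mem_translate_iff)

lemma char_mult_assoc: "char_mult (char_mult \<xi> \<psi>) \<zeta> = char_mult \<xi> (char_mult \<psi> \<zeta>)"
  by (simp add: char_mult_def mult.assoc)

lemma conj_char_mult: "conj_fun (char_mult \<xi> \<psi>) = char_mult (conj_fun \<xi>) (conj_fun \<psi>)"
  by (simp add: char_mult_def conj_fun_def)

lemma char_mult_commute: "char_mult \<xi> \<psi> = char_mult \<psi> \<xi>"
  by (simp add: char_mult_def mult.commute)

lemma below_psubset:
  assumes \<xi>: "\<xi> \<in> T" and \<psi>: "\<psi> \<in> below \<xi>"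
  shows "below \<psi> \<subset> below \<xi>"
proof
  have \<psi>T: "\<psi> \<in> T" and n: "char_mult (conj_fun \<xi>) \<psi> \<notin> T" using \<psi> below_iff[OF \<xi>] by auto
  have "char_mult (conj_fun \<xi>) \<psi> \<in> characters"
    using \<xi> \<psi>T T_char char_conj char_char_mult by blast
  then have d: "char_mult (conj_fun \<psi>) \<xi> \<in> T"
    using T_total n by (fastforce simp: conj_char_mult char_mult_commute)
  show "below \<psi> \<subseteq> below \<xi>"
  proof
    fix \<zeta> assume \<zeta>: "\<zeta> \<in> below \<psi>"
    have "char_mult (conj_fun \<xi>) \<zeta> \<notin> T"
    proof
      assume "char_mult (conj_fun \<xi>) \<zeta> \<in> T"
      from T_mult[OF d this] have "char_mult (conj_fun \<psi>) (char_mult \<xi> (char_mult (conj_fun \<xi>) \<zeta>)) \<in> T"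
        by (simp only: char_mult_assoc)
      then show False
        using \<zeta> below_iff[OF \<psi>T] by (simp add: char_mult_cancel(2)[OF T_char[OF \<xi>]])
    qed
    then show "\<zeta> \<in> below \<xi>" using \<zeta> below_iff[OF \<xi>] below_iff[OF \<psi>T] by blast
  qed
  have "char_mult (conj_fun \<psi>) \<psi> = (\<lambda>_. 1)"
    using char_cnj_mult(1)[OF T_char[OF \<psi>T]] by (simp add: char_mult_def conj_fun_def)
  then have "\<psi> \<notin> below \<psi>" using below_iff[OF \<psi>T] T_one by simp
  then show "below \<psi> \<noteq> below \<xi>" using \<psi> by blast
qed

text \<open>
  A nontrivial element \<open>\<eta>\<close> of \<open>T\<close> with the fewest elements below it divides every nontrivial \<open>\<psi> \<in> T\<close>,
  and \<open>\<psi> / \<eta>\<close> is below \<open>\<psi>\<close>, so induction on the number of elements below \<open>\<psi>\<close> applies.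
\<close>

lemma cone_generator:
  assumes fin: "\<And>\<xi>. \<xi> \<in> T \<Longrightarrow> finite (below \<xi>)" and nt: "\<exists>\<psi>\<in>T. \<psi> \<noteq> (\<lambda>_. 1)"
  shows "\<exists>\<eta>\<in>T. \<eta> \<noteq> (\<lambda>_. 1) \<and> (\<forall>\<psi>\<in>T. \<exists>n. \<psi> = (\<lambda>x. \<eta> x ^ n))"
proof -
  obtain \<psi>0 where "\<psi>0 \<in> T \<and> \<psi>0 \<noteq> (\<lambda>_. 1)" using nt by blast
  from ex_has_least_nat[of "\<lambda>\<psi>. \<psi> \<in> T \<and> \<psi> \<noteq> (\<lambda>_. 1)", OF this, of "\<lambda>\<xi>. card (below \<xi>)"]
  obtain \<eta> where \<eta>: "\<eta> \<in> T" "\<eta> \<noteq> (\<lambda>_. 1)"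
    and least: "\<And>\<psi>. \<psi> \<in> T \<Longrightarrow> \<psi> \<noteq> (\<lambda>_. 1) \<Longrightarrow> card (below \<eta>) \<le> card (below \<psi>)"
    by blast
  have succ: "char_mult (conj_fun \<eta>) \<psi> \<in> T" if \<psi>: "\<psi> \<in> T" "\<psi> \<noteq> (\<lambda>_. 1)" for \<psi>
  proof (rule ccontr)
    assume "\<not> ?thesis"
    then have "\<psi> \<in> below \<eta>" using below_iff[OF \<eta>(1)] \<psi>(1) by blast
    then have "card (below \<psi>) < card (below \<eta>)"
      by (intro psubset_card_mono fin \<eta>(1) below_psubset)
    then show False using least[OF \<psi>] by simp
  qed
  have "\<exists>n. \<psi> = (\<lambda>x. \<eta> x ^ n)" if "\<psi> \<in> T" for \<psi>
    using that
  proof (induction "card (below \<psi>)" arbitrary: \<psi> rule: less_induct)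
    case less
    show ?case
    proof (cases "\<psi> = (\<lambda>_. 1)")
      case True
      then show ?thesis by (intro exI[of _ 0]) simp
    next
      case False
      define \<tau> where "\<tau> = char_mult (conj_fun \<eta>) \<psi>"
      have \<tau>: "\<tau> \<in> T" unfolding \<tau>_def by (rule succ[OF less.prems False])
      have \<psi>_eq: "\<psi> = char_mult \<eta> \<tau>"
        unfolding \<tau>_def by (rule char_mult_cancel(2)[OF T_char[OF \<eta>(1)], symmetric])
      have "char_mult (conj_fun \<psi>) \<tau> = conj_fun \<eta>"
        unfolding \<psi>_eq conj_char_mult char_mult_assoc
        using char_cnj_mult(1)[OF T_char[OF \<tau>]] by (simp add: char_mult_def conj_fun_def)
      moreover have "conj_fun \<eta> \<notin> T" using T_antisym \<eta> by blast
      ultimately have "\<tau> \<in> below \<psi>" using below_iff[OF less.prems] \<tau> by simp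
      then have "card (below \<tau>) < card (below \<psi>)"
        by (intro psubset_card_mono fin less.prems below_psubset)
      then obtain n where "\<tau> = (\<lambda>x. \<eta> x ^ n)" using less.hyps \<tau> by blast
      then show ?thesis
        by (intro exI[of _ "Suc n"]) (simp add: \<psi>_eq char_mult_def)
    qed
  qed
  then show ?thesis using \<eta> by blast
qed

text \<open>
  The powers of the generator \<open>\<eta>\<close> and their conjugates are all characters, so two points with the
  same value of \<open>\<eta>\<close> are not separated by any character.
\<close>

lemma isomorphic_to_circle_if_finite:
  assumes conn: "connected (UNIV :: 'a set)" and nontriv: "\<exists>x::'a. x \<noteq> 0"
    and fin: "\<And>\<xi>. \<xi> \<in> T \<Longrightarrow> finite (T - char_mult \<xi> ` T)"
  shows "isomorphic_to_circle TYPE('a)"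
proof -
  obtain a :: 'a where "a \<noteq> 0" using nontriv by blast
  then obtain \<psi> where \<psi>: "\<psi> \<in> characters" "\<psi> a \<noteq> \<psi> 0" using characters_separate_points by blast
  have "\<psi> \<noteq> (\<lambda>_. 1)" using \<psi>(2) by auto
  moreover have "conj_fun \<psi> \<noteq> (\<lambda>_. 1)"
  proof
    assume "conj_fun \<psi> = (\<lambda>_. 1)"
    then have "\<psi> = conj_fun (\<lambda>_. 1)" using conj_fun_conj_fun[of \<psi>] by simp
    then show False using \<psi>(2) by (simp add: conj_fun_def)
  qed
  ultimately have "\<exists>\<psi>\<in>T. \<psi> \<noteq> (\<lambda>_. 1)" using T_total[OF \<psi>(1)] by blast
  then obtain \<eta> where \<eta>: "\<eta> \<in> T" "\<eta> \<noteq> (\<lambda>_. 1)" and gen: "\<And>\<psi>. \<psi> \<in> T \<Longrightarrow> \<exists>n. \<psi> = (\<lambda>x. \<eta> x ^ n)"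
    using cone_generator[unfolded below_def, OF fin] by blast
  note \<eta>c = T_char[OF \<eta>(1)]
  have "inj \<eta>"
  proof (rule injI, rule ccontr)
    fix x y assume eq: "\<eta> x = \<eta> y" and "x \<noteq> y"
    then obtain \<xi> where \<xi>: "\<xi> \<in> characters" "\<xi> x \<noteq> \<xi> y" using characters_separate_points by blast
    have T_eq: "\<psi> x = \<psi> y" if "\<psi> \<in> T" for \<psi> using gen[OF that] eq by auto
    from T_total[OF \<xi>(1)] show False
    proof
      assume "\<xi> \<in> T"
      then show False using T_eq \<xi>(2) by blast
    next
      assume "conj_fun \<xi> \<in> T"
      from T_eq[OF this] show False using \<xi>(2) by (simp add: conj_fun_def)
    qed
  qed
  then obtain k where "homeomorphism UNIV (sphere 0 1) \<eta> k"
    using homeomorphism_compact[OF compact_UNIV char_continuous[OF \<eta>c] character_surj_circle[OF conn \<eta>c \<eta>(2)]]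
    by blast
  then show ?thesis
    unfolding isomorphic_to_circle_def using char_add[OF \<eta>c] by blast
qed

end

section \<open>Semicommutators, indices and the circle\<close>

theorem corollary2:
  fixes m :: "'a::{topological_ab_group_add, t2_space} measure"
    and T :: "('a \<Rightarrow> complex) set"
    and p :: real
  assumes "compact (UNIV :: 'a set)"
    and "connected (UNIV :: 'a set)"
    and "\<exists>x::'a. x \<noteq> 0"
    and "normalized_haar m"
    and "positive_cone T"
    and "linearly_ordered_by T"
    and "1 < p"
  shows "(\<forall>\<xi>\<in>T. compact_operator_Hp m T p (semicommutator m T p \<xi> (conj_fun \<xi>))
                  \<longleftrightarrow> \<xi> \<in> indexed_characters T) \<and>
         ((\<forall>\<xi>\<in>T. compact_operator_Hp m T p (semicommutator m T p \<xi> (conj_fun \<xi>)))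
            \<longrightarrow> isomorphic_to_circle TYPE('a))"
proof -
  interpret riesz_haar m T p
    using assms by unfold_locales
  have compact_iff: "compact_operator_Hp m T p (semicommutator m T p \<xi> (conj_fun \<xi>))
      \<longleftrightarrow> finite (T - char_mult \<xi> ` T)" if "\<xi> \<in> T" for \<xi>
    using compact_if_finite[OF that] finite_if_compact[OF that] by blast
  show ?thesis
  proof (intro conjI ballI impI)
    show "compact_operator_Hp m T p (semicommutator m T p \<xi> (conj_fun \<xi>)) \<longleftrightarrow> \<xi> \<in> indexed_characters T"
      if "\<xi> \<in> T" for \<xi>
      using compact_iff[OF that] indexed_iff[OF that] by simp
    assume "\<forall>\<xi>\<in>T. compact_operator_Hp m T p (semicommutator m T p \<xi> (conj_fun \<xi>))"
    then show "isomorphic_to_circle TYPE('a)"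
      using isomorphic_to_circle_if_finite[OF assms(2,3)] compact_iff by blast
  qed
qed

end
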